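(* (1) Let $A\in\mathbb{Z}^{d\times t}$ be a matrix with columns $\boldsymbol{a}_1,\ldots,\boldsymbol{a}_t$, let $\boldsymbol{c}\in\mathbb{Z}^t$ and $\boldsymbol{b}\in\mathbb{Z}^d$. If the integer program $$\min\{\boldsymbol{c}^T\boldsymbol{x}: A\boldsymbol{x}=\boldsymbol{b},\ \boldsymbol{x}\ge 0,\ \boldsymbol{x}\in\mathbb{Z}^t\}$$ has a finite optimum, then there exists an optimal solution $\boldsymbol{x}^*$ with at most $$(d+1)+\lfloor\log(H(X))\rfloor$$ nonzero components, where $X\subset\mathbb{Z}^{d+1}$ is the set of enlarged column vectors $$X=\left\{\begin{pmatrix}\boldsymbol{a}_1\\ c_1\end{pmatrix},\ldots,\begin{pmatrix}\boldsymbol{a}_t\\ c_t\end{pmatrix}\right\}.$$ (2) More generally, let $A\in\mathbb{Z}^{d\times t_1}$ with columns $\boldsymbol{a}_1,\ldots,\boldsymbol{a}_{t_1}$, let $B\in\mathbb{R}^{d\times t_2}$, $\boldsymbol{c}\in\mathbb{Z}^{t_1}$, $\boldsymbol{v}\in\mathbb{R}^{t_2}$ and $\boldsymbol{b}\in\mathbb{Z}^d$. If an optimum exists for the mixed integer program $$\min\{\boldsymbol{c}^T\boldsymbol{x}+\boldsymbol{v}^T\boldsymbol{y}: A\boldsymbol{x}+B\boldsymbol{y}=\boldsymbol{b},\ \boldsymbol{x}\ge0,\ \boldsymbol{y}\ge0,\ \boldsymbol{x}\in\mathbb{Z}^{t_1},\ \boldsymbol{y}\in\mathbb{R}^{t_2}\},$$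 then there is an optimal solution $(\boldsymbol{x},\boldsymbol{y})$ with at most $$(d+1)+\lfloor\log(H(X))\rfloor+\mathrm{rank}(B)$$ nonzero components, where $X$ is the set of enlarged column vectors $\begin{pmatrix}\boldsymbol{a}_i\\ c_i\end{pmatrix}$, $1\le i\le t_1$.
   Context: Here $\log$ is the base-two logarithm. For a finite set $X=\{\boldsymbol{x}_1,\ldots,\boldsymbol{x}_s\}$ of integer vectors in $\mathbb{Z}^n$ (with $s=|X|$), let $W(X)$ be the $s\times n$ matrix with rows $\boldsymbol{x}_1^T,\ldots,\boldsymbol{x}_s^T$, let $\mathrm{span}_{\mathbb{R}}(W(X))\subset\mathbb{R}^s$ be the linear span of its columns, and let $\Lambda(X)=\mathrm{span}_{\mathbb{R}}(W(X))\cap\mathbb{Z}^s$, a lattice of rank equal to the rank of $W(X)$. Then $H(X)=\det(\Lambda(X))$, where the determinant of a lattice with basis $\boldsymbol{v}_1,\ldots,\boldsymbol{v}_r$ is $(\det(\boldsymbol{v}_i\cdot\boldsymbol{v}_j)_{1\le i,j\le r})^{1/2}$ (the determinant of the zero lattice being $1$). *)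

theory Defs
  imports Complex_Main "Jordan_Normal_Form.DL_Rank"
begin

text \<open>
  Matrices and vectors carry their dimension as a term, because the ambient space of the lattice
  attached to a finite set \<open>X\<close> has dimension \<open>card X\<close>.
\<close>

definition lattice_basis :: "nat \<Rightarrow> real vec set \<Rightarrow> real vec list \<Rightarrow> bool" where
  "lattice_basis s L vs \<longleftrightarrow>
     set vs \<subseteq> carrier_vec s \<and> distinct vs \<and>
     module.lin_indpt class_ring (module_vec TYPE(real) s) (set vs) \<and>
     L = {mat_of_cols s vs *\<^sub>v map_vec real_of_int z | z. z \<in> carrier_vec (length vs)}"

definition gram_mat :: "real vec list \<Rightarrow> real mat" where
  "gram_mat vs = mat (length vs) (length vs) (\<lambda>(i, j). vs ! i \<bullet> vs ! j)"

text \<open>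
  The value does not depend on the basis chosen: two bases differ by a unimodular matrix.
  The only basis of the zero lattice is \<open>[]\<close>, and the determinant of the empty matrix is 1.
\<close>

definition lattice_det :: "nat \<Rightarrow> real vec set \<Rightarrow> real" where
  "lattice_det s L = sqrt (det (gram_mat (SOME vs. lattice_basis s L vs)))"

definition row_matrix :: "nat \<Rightarrow> int vec list \<Rightarrow> real mat" where
  "row_matrix n xs = map_mat real_of_int (mat_of_rows n xs)"

definition col_lattice :: "nat \<Rightarrow> int vec list \<Rightarrow> real vec set" where
  "col_lattice n xs =
     vec_space.col_space (length xs) (row_matrix n xs) \<inter>
     map_vec real_of_int ` carrier_vec (length xs)"

text \<open>
  The rows may be listed in any order: reordering them permutes the coordinates of the lattice,
  which preserves inner products.
\<close>

definition H :: "nat \<Rightarrow> int vec set \<Rightarrow> real" where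
  "H n X = (let xs = (SOME xs. distinct xs \<and> set xs = X)
            in lattice_det (card X) (col_lattice n xs))"

definition enlarged_cols :: "int mat \<Rightarrow> int vec \<Rightarrow> int vec set" where
  "enlarged_cols A c = {col A i @\<^sub>v vec_of_list [c $ i] | i. i < dim_col A}"

definition num_nonzero :: "'a::zero vec \<Rightarrow> nat" where
  "num_nonzero x = card {i. i < dim_vec x \<and> x $ i \<noteq> 0}"

definition ip_feasible :: "int mat \<Rightarrow> int vec \<Rightarrow> int vec \<Rightarrow> bool" where
  "ip_feasible A b x \<longleftrightarrow>
     x \<in> carrier_vec (dim_col A) \<and> 0\<^sub>v (dim_col A) \<le> x \<and> A *\<^sub>v x = b"

definition ip_optimal :: "int mat \<Rightarrow> int vec \<Rightarrow> int vec \<Rightarrow> int vec \<Rightarrow> bool" where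
  "ip_optimal A b c = is_arg_min (\<lambda>x. c \<bullet> x) (ip_feasible A b)"

definition mip_feasible :: "int mat \<Rightarrow> real mat \<Rightarrow> int vec \<Rightarrow> int vec \<times> real vec \<Rightarrow> bool" where
  "mip_feasible A B b = (\<lambda>(x, y).
     x \<in> carrier_vec (dim_col A) \<and> y \<in> carrier_vec (dim_col B) \<and>
     0\<^sub>v (dim_col A) \<le> x \<and> 0\<^sub>v (dim_col B) \<le> y \<and>
     map_vec real_of_int (A *\<^sub>v x) + B *\<^sub>v y = map_vec real_of_int b)"

definition mip_optimal ::
  "int mat \<Rightarrow> real mat \<Rightarrow> int vec \<Rightarrow> int vec \<Rightarrow> real vec \<Rightarrow> int vec \<times> real vec \<Rightarrow> bool" where
  "mip_optimal A B b c v =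
     is_arg_min (\<lambda>(x, y). real_of_int (c \<bullet> x) + v \<bullet> y) (mip_feasible A B b)"

end

theory Submission
  imports "HOL-Probability.Distributions" Defs
begin

text \<open>
  Let the columns of the integer matrix \<open>V\<close> be a basis of the lattice \<open>\<Lambda>(X)\<close>, of rank \<open>r \<le> d + 1\<close>. A solution
  of minimal support admits no nontrivial relation with coefficients in \<open>{-1, 0, 1}\<close> between the
  enlarged columns of its support: subtracting a multiple of such a relation would keep the
  solution feasible and its value unchanged, and make a component vanish. So everything reduces to
  the inequality \<open>2^|I| \<le> 2^r sqrt (det (V\<^sup>T V))\<close> for every set \<open>I\<close> of rows \<open>v\<^sub>i\<close> of \<open>V\<close> without such
  a relation.

  Expanding the product, the integral of \<open>\<Prod>i\<in>I. cos\<^sup>2 (\<pi> v\<^sub>i \<cdot> \<theta>)\<close> over the torus equals \<open>2^-|I|\<close>. It is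
  at least the integral over \<open>\<real>\<^sup>r\<close> of the product over all rows of the bumps \<open>cos\<^sup>2 (\<pi> v\<^sub>i \<cdot> \<theta>)\<close> cut off at
  \<open>|v\<^sub>i \<cdot> \<theta>| < 1/2\<close>, because the translates of their common support by integer vectors are disjoint.
  Replacing the bumps one at a time by \<open>exp (-4\<pi> (v\<^sub>i \<cdot> \<theta>)\<^sup>2)\<close> does not increase the integral: both
  profiles have integral 1/2 and cross once on the positive half-line, while by Prekopa-Leindler the
  remaining factors integrate over the hyperplanes \<open>v\<^sub>i \<cdot> \<theta> = t\<close> to an even function of \<open>t\<close> that
  decreases in \<open>|t|\<close>. The Gaussian integral that is left is \<open>2^-r det (V\<^sup>T V)^(-1/2)\<close>. This plays the part
  of Vaaler's cube slicing theorem together with Minkowski's theorem.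
\<close>

text \<open>The argument works on the Fourier side. As
  \<open>cos\<^sup>2 (\<pi> t) = (1 + cos (2 \<pi> t)) / 2\<close> has only the frequencies -1, 0,
  1, with positive weights, the mean over the torus of the product over \<open>I\<close> is a
  weighted count of the relations with coefficients in {-1, 0, 1}, and without a nontrivial one only
  the constant term is left. A question about integer points in a kernel whose dimension grows with
  \<open>|I|\<close> thus becomes an integral in \<open>r\<close> variables. The determinant
  involves all rows of \<open>V\<close>, the torus integral only those in \<open>I\<close>: the
  bumps of the other rows are at most 1 and are dropped in between. Every column of
  \<open>W(X)\<close> lies in the lattice, hence is a combination of the columns of
  \<open>V\<close>, so relations between rows of \<open>V\<close> are relations between enlarged
  columns. The factor 4 pi is forced by the mass 1/2. The logarithmic derivatives of the profiles
  are then -8 pi x and -2 pi tan (pi x), which agree on [0, 1/2) only at 0 and, since tan (pi/4) =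
  1, at 1/4; this gives the single crossing. Continuous variables stay outside the lattice. They are
  reduced as in linear programming, where optimality gives the bound rank B rather than rank B +
  1.\<close>

no_notation vec_nth (infixl "$" 90) and inner (infix "\<bullet>" 70)

subsection \<open>Iterated integrals\<close>

text \<open>
  The dimension \<open>r\<close> varies, so \<open>\<real>\<^sup>r\<close> is the set of coordinates \<open>0..<r\<close> of functions \<open>nat \<Rightarrow> real\<close>; the
  other coordinates are parameters.
\<close>

fun iter_nn_integral :: "nat list \<Rightarrow> ((nat \<Rightarrow> real) \<Rightarrow> ennreal) \<Rightarrow> (nat \<Rightarrow> real) \<Rightarrow> ennreal" where
  "iter_nn_integral [] F x = F x"
| "iter_nn_integral (j # js) F x = (\<integral>\<^sup>+t. iter_nn_integral js F (x(j := t)) \<partial>lborel)"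

lemma measurable_fun_upd_borel [measurable (raw)]:
  fixes f :: "'b \<Rightarrow> nat \<Rightarrow> real"
  assumes [measurable]: "f \<in> borel_measurable M" "g \<in> borel_measurable M"
  shows "(\<lambda>w. (f w)(j := g w)) \<in> borel_measurable M"
proof (rule measurable_coordinatewise_then_product)
  fix i
  have "(\<lambda>w. f w i) \<in> borel_measurable M"
    using assms(1) by (rule measurable_product_then_coordinatewise)
  then show "(\<lambda>w. ((f w)(j := g w)) i) \<in> borel_measurable M"
    using assms(2) by (cases "i = j") auto
qed

text \<open>Interchanging an outer variable with an iterated integral needs joint measurability in
  the parameter \<open>w\<close> and the point \<open>y\<close>, which the induction has to carry
  along; measurability for each fixed \<open>w\<close> would be too weak.\<close>

lemma measurable_iter_nn_integral_param:
  fixes F :: "'b \<Rightarrow> (nat \<Rightarrow> real) \<Rightarrow> ennreal"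
  assumes "(\<lambda>(w, y). F w y) \<in> borel_measurable (M \<Otimes>\<^sub>M borel)"
  shows "(\<lambda>(w, y). iter_nn_integral js (F w) y) \<in> borel_measurable (M \<Otimes>\<^sub>M borel)"
  using assms
proof (induction js arbitrary: F)
  case Nil
  then show ?case by simp
next
  case (Cons j js)
  note Cons.IH[OF Cons.prems, measurable]
  have [measurable]: "(\<lambda>p. iter_nn_integral js (F (fst (fst p))) ((snd (fst p))(j := snd p)))
      \<in> borel_measurable ((M \<Otimes>\<^sub>M borel) \<Otimes>\<^sub>M lborel)"
  proof -
    have "(\<lambda>p. (fst (fst p), (snd (fst p))(j := snd p)))
      \<in> measurable ((M \<Otimes>\<^sub>M borel) \<Otimes>\<^sub>M lborel) (M \<Otimes>\<^sub>M (borel :: (nat \<Rightarrow> real) measure))"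
      by measurable
    from measurable_compose[OF this Cons.IH[OF Cons.prems]] show ?thesis
      by (simp add: split_beta)
  qed
  show ?case
    by (simp add: split_beta) measurable
qed

lemma measurable_iter_nn_integral [measurable (raw)]:
  fixes F :: "'b \<Rightarrow> (nat \<Rightarrow> real) \<Rightarrow> ennreal"
  assumes F: "(\<lambda>p. F (fst p) (snd p)) \<in> borel_measurable (M \<Otimes>\<^sub>M borel)"
    and g: "g \<in> borel_measurable M"
  shows "(\<lambda>w. iter_nn_integral js (F w) (g w)) \<in> borel_measurable M"
proof -
  have "(\<lambda>(w, y). iter_nn_integral js (F w) y) \<in> borel_measurable (M \<Otimes>\<^sub>M borel)"
    using F by (intro measurable_iter_nn_integral_param) (simp add: split_beta')
  from measurable_compose[OF measurable_Pair[OF measurable_ident_sets[OF refl] g] this]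
  show ?thesis by simp
qed

lemma iter_nn_integral_nn_integral_swap:
  fixes F :: "real \<Rightarrow> (nat \<Rightarrow> real) \<Rightarrow> ennreal"
  assumes [measurable]: "(\<lambda>p. F (fst p) (snd p)) \<in> borel_measurable (borel \<Otimes>\<^sub>M borel)"
  shows "iter_nn_integral js (\<lambda>y. \<integral>\<^sup>+t. F t y \<partial>lborel) x
    = (\<integral>\<^sup>+t. iter_nn_integral js (F t) x \<partial>lborel)"
proof (induction js arbitrary: x)
  case (Cons j js)
  have [measurable]: "(\<lambda>(s, t). iter_nn_integral js (F t) (x(j := s)))
      \<in> borel_measurable (lborel \<Otimes>\<^sub>M lborel)"
  proof -
    have "(\<lambda>(w, y). iter_nn_integral js (F w) y) \<in> borel_measurable (borel \<Otimes>\<^sub>M borel)"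
      by (intro measurable_iter_nn_integral_param) (simp add: split_beta')
    from measurable_compose[OF _ this, where f = "\<lambda>(s, t). (t, x(j := s))" and M = "lborel \<Otimes>\<^sub>M lborel"]
    show ?thesis by (simp add: split_beta')
  qed
  show ?case
    unfolding iter_nn_integral.simps Cons by (rule lborel_pair.Fubini') measurable
qed simp

lemma iter_nn_integral_snoc:
  "iter_nn_integral (js @ [j]) F x = iter_nn_integral js (\<lambda>y. \<integral>\<^sup>+t. F (y(j := t)) \<partial>lborel) x"
  by (induction js arbitrary: x) simp_all

lemma iter_nn_integral_append:
  "iter_nn_integral (js @ ks) F x = iter_nn_integral js (iter_nn_integral ks F) x"
  by (induction js arbitrary: x) simp_all

lemma iter_nn_integral_cong:
  assumes "\<And>y. (\<And>i. i \<notin> set js \<Longrightarrow> y i = x i) \<Longrightarrow> F y = G y"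
  shows "iter_nn_integral js F x = iter_nn_integral js G x"
  using assms
proof (induction js arbitrary: x)
  case (Cons j js)
  have "iter_nn_integral js F (x(j := t)) = iter_nn_integral js G (x(j := t))" for t
    by (rule Cons.IH) (rule Cons.prems, auto)
  then show ?case by simp
qed simp

lemma iter_nn_integral_mono:
  assumes "\<And>y. (\<And>i. i \<notin> set js \<Longrightarrow> y i = x i) \<Longrightarrow> F y \<le> G y"
  shows "iter_nn_integral js F x \<le> iter_nn_integral js G x"
  using assms
proof (induction js arbitrary: x)
  case (Cons j js)
  have "iter_nn_integral js F (x(j := t)) \<le> iter_nn_integral js G (x(j := t))" for t
    by (rule Cons.IH) (rule Cons.prems, auto)
  then show ?case by (simp add: nn_integral_mono)
qed simp

lemma iter_nn_integral_fun_upd_swap: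
  assumes "j \<notin> set js"
  shows "iter_nn_integral js F (x(j := t)) = iter_nn_integral js (\<lambda>y. F (y(j := t))) x"
  using assms
proof (induction js arbitrary: x)
  case (Cons i js)
  have "x(j := t, i := s) = x(i := s, j := t)" for s
    using Cons.prems by (auto simp: fun_upd_twist)
  moreover have "iter_nn_integral js F (x(i := s, j := t))
      = iter_nn_integral js (\<lambda>y. F (y(j := t))) (x(i := s))" for s
    using Cons.prems by (intro Cons.IH) simp
  ultimately show ?case unfolding iter_nn_integral.simps by presburger
qed simp

lemma iter_nn_integral_Cons_eq_snoc:
  assumes [measurable]: "F \<in> borel_measurable borel" and "j \<notin> set js"
  shows "iter_nn_integral (j # js) F x = iter_nn_integral (js @ [j]) F x"
proof -
  have "iter_nn_integral (js @ [j]) F x = (\<integral>\<^sup>+t. iter_nn_integral js (\<lambda>y. F (y(j := t))) x \<partial>lborel)"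
    unfolding iter_nn_integral_snoc
    by (rule iter_nn_integral_nn_integral_swap) measurable
  also have "\<dots> = iter_nn_integral (j # js) F x"
    using assms(2) by (simp add: iter_nn_integral_fun_upd_swap)
  finally show ?thesis ..
qed

text \<open>Serves to single out a coordinate on which a given linear form really depends.\<close>

lemma iter_nn_integral_move_front:
  assumes [measurable]: "F \<in> borel_measurable borel" and "j \<notin> set js"
  shows "iter_nn_integral (js @ j # ks) F x = iter_nn_integral (j # js @ ks) F x"
proof -
  have "iter_nn_integral (js @ j # ks) F x = iter_nn_integral (js @ [j]) (iter_nn_integral ks F) x"
    by (simp flip: iter_nn_integral_append)
  also have "\<dots> = iter_nn_integral (j # js) (iter_nn_integral ks F) x"
    using assms(2) by (intro iter_nn_integral_Cons_eq_snoc[symmetric]) measurable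
  finally show ?thesis by (simp add: iter_nn_integral_append)
qed

lemma iter_nn_integral_cmult:
  assumes [measurable]: "F \<in> borel_measurable borel"
  shows "iter_nn_integral js (\<lambda>y. c * F y) x = c * iter_nn_integral js F x"
  by (induction js arbitrary: x) (simp_all add: nn_integral_cmult)

lemma iter_nn_integral_minus:
  assumes [measurable]: "F \<in> borel_measurable borel"
  shows "iter_nn_integral js F (\<lambda>i. - x i) = iter_nn_integral js (\<lambda>y. F (\<lambda>i. - y i)) x"
proof (induction js arbitrary: x)
  case (Cons j js)
  have "iter_nn_integral (j # js) F (\<lambda>i. - x i)
      = (\<integral>\<^sup>+t. iter_nn_integral js F ((\<lambda>i. - x i)(j := 0 + (- 1) * t)) \<partial>lborel)"
    by (subst nn_integral_real_affine[where c = "- 1" and t = 0]) simp_all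
  also have "\<dots> = (\<integral>\<^sup>+t. iter_nn_integral js F (\<lambda>i. - (x(j := t)) i) \<partial>lborel)"
    by (intro nn_integral_cong arg_cong[where f = "iter_nn_integral js F"]) auto
  finally show ?case unfolding iter_nn_integral.simps Cons .
qed simp


subsection \<open>The Prekopa-Leindler inequality and log-concave functions\<close>

text \<open>Were all points less than \<open>p\<close> apart, \<open>I\<close> would fit into an
  interval of length \<open>p\<close> starting at its infimum. The alternative \<open>p = 0\<close>
  covers sets of measure zero such as single points.\<close>

lemma exists_segment_of_emeasure:
  fixes I :: "real set"
  assumes ne: "I \<noteq> {}" and p: "p = 0 \<or> ennreal p < emeasure lborel I" and p0: "0 \<le> p"
  obtains a b where "a \<in> I" "b \<in> I" "a + p \<le> b"
proof (cases "p = 0")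
  case True
  then show ?thesis using ne that by auto
next
  case False
  show ?thesis
  proof (rule ccontr)
    assume "\<not> thesis"
    then have short: "b < a + p" if "a \<in> I" "b \<in> I" for a b
      using that \<open>\<not> thesis\<close> \<open>\<And>a b. a \<in> I \<Longrightarrow> b \<in> I \<Longrightarrow> a + p \<le> b \<Longrightarrow> thesis\<close> by force
    obtain c where c: "c \<in> I" using ne by auto
    have bb: "bdd_below I"
      using short[OF _ c] by (intro bdd_belowI[of _ "c - p"]) force
    have "b \<le> Inf I + p" if "b \<in> I" for b
    proof -
      have "b - p \<le> Inf I"
        using short[OF _ that] by (intro cInf_greatest[OF ne]) force
      then show ?thesis by simp
    qed
    then have "I \<subseteq> {Inf I..Inf I + p}"
      using bb by (auto intro: cInf_lower)
    then have "emeasure lborel I \<le> emeasure lborel {Inf I..Inf I + p}"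
      by (intro emeasure_mono) auto
    also have "\<dots> = ennreal p" using p0 by simp
    finally show False using p False by simp
  qed
qed

text \<open>
  The superlevel sets of a log-concave function of one variable are intervals, so only this trivial
  case of the Brunn-Minkowski inequality is needed.
\<close>

lemma brunn_minkowski_interval:
  fixes I J K :: "real set"
  assumes I: "is_interval I" "I \<noteq> {}" and J: "is_interval J" "J \<noteq> {}"
    and u: "0 < u" "u < 1" and K [measurable]: "K \<in> sets borel"
    and sub: "\<And>x y. x \<in> I \<Longrightarrow> y \<in> J \<Longrightarrow> u * x + (1 - u) * y \<in> K"
  shows "ennreal u * emeasure lborel I + ennreal (1 - u) * emeasure lborel J \<le> emeasure lborel K"
proof -
  \<comment> \<open>A segment of length \<open>p\<close> in \<open>I\<close> and one of length
    \<open>q\<close> in \<open>J\<close>, traversed with the same relative speed \<open>s\<close>,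
    combine to a segment of length \<open>u * p + (1 - u) * q\<close> in \<open>K\<close>.\<close>
  have key: "ennreal (u * p + (1 - u) * q) \<le> emeasure lborel K"
    if p: "p = 0 \<or> ennreal p < emeasure lborel I" "0 \<le> p"
      and q: "q = 0 \<or> ennreal q < emeasure lborel J" "0 \<le> q" for p q
  proof -
    obtain a b where ab: "a \<in> I" "b \<in> I" "a + p \<le> b"
      using exists_segment_of_emeasure[OF I(2) p] .
    obtain a' b' where ab': "a' \<in> J" "b' \<in> J" "a' + q \<le> b'"
      using exists_segment_of_emeasure[OF J(2) q] .
    define l where "l = u * a + (1 - u) * a'"
    have "{l..l + (u * p + (1 - u) * q)} \<subseteq> K"
    proof
      fix z assume z: "z \<in> {l..l + (u * p + (1 - u) * q)}"
      define w where "w = u * p + (1 - u) * q"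
      have w0: "0 \<le> w" using u p(2) q(2) by (simp add: w_def)
      define s where "s = (if w = 0 then 0 else (z - l) / w)"
      have s: "0 \<le> s" "s \<le> 1" "z = l + s * w"
        using z w0 by (auto simp: s_def w_def[symmetric] divide_simps)
      have "a + s * p \<in> I"
      proof (rule mem_is_interval_1_I[OF I(1) ab(1,2)])
        show "a \<le> a + s * p" using s p by simp
        have "s * p \<le> 1 * p" using s p by (intro mult_right_mono) auto
        then show "a + s * p \<le> b" using ab by simp
      qed
      moreover have "a' + s * q \<in> J"
      proof (rule mem_is_interval_1_I[OF J(1) ab'(1,2)])
        show "a' \<le> a' + s * q" using s q by simp
        have "s * q \<le> 1 * q" using s q by (intro mult_right_mono) auto
        then show "a' + s * q \<le> b'" using ab' by simp
      qed
      ultimately have "u * (a + s * p) + (1 - u) * (a' + s * q) \<in> K" by (rule sub)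
      also have "u * (a + s * p) + (1 - u) * (a' + s * q) = z"
        unfolding s(3) l_def w_def by (simp add: algebra_simps)
      finally show "z \<in> K" .
    qed
    then have "emeasure lborel {l..l + (u * p + (1 - u) * q)} \<le> emeasure lborel K"
      by (intro emeasure_mono) auto
    then show ?thesis using u p(2) q(2) by simp
  qed
  show ?thesis
  proof (cases "emeasure lborel K")
    case top
    then show ?thesis by simp
  next
    case (real k)
    \<comment> \<open>If \<open>K\<close> has finite measure, \<open>I\<close> and \<open>J\<close>
      cannot contain points arbitrarily far apart.\<close>
    have fin: "emeasure lborel L < \<infinity>"
      if "\<And>p. 0 \<le> p \<Longrightarrow> p = 0 \<or> ennreal p < emeasure lborel L \<Longrightarrow> v * p \<le> k" "0 < v" for L v
    proof (rule ccontr)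
      assume "\<not> emeasure lborel L < \<infinity>"
      then have "emeasure lborel L = \<infinity>" by (cases "emeasure lborel L") auto
      then have "v * ((k + 1) / v) \<le> k" using that(2) real by (intro that(1)) auto
      then show False using that(2) by simp
    qed
    have "emeasure lborel I < \<infinity>"
      using key[of _ 0] real u by (intro fin[of I u]) auto
    then obtain i where i: "emeasure lborel I = ennreal i" "0 \<le> i"
      by (cases "emeasure lborel I") auto
    have "emeasure lborel J < \<infinity>"
      using key[of 0] real u by (intro fin[of J "1 - u"]) auto
    then obtain j where j: "emeasure lborel J = ennreal j" "0 \<le> j"
      by (cases "emeasure lborel J") auto
    \<comment> \<open>Positive lengths are available only strictly below the measure, hence the loss
      \<open>e\<close>; the maximum with 0 keeps the lengths admissible when the measure is smaller
      than \<open>e\<close>.\<close>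
    have "u * i + (1 - u) * j \<le> k + e" if e: "0 < e" for e
    proof -
      define p where "p = max 0 (i - e)"
      define q where "q = max 0 (j - e)"
      have "ennreal (u * p + (1 - u) * q) \<le> emeasure lborel K"
        unfolding p_def q_def using e i j by (intro key) (auto simp: max_def ennreal_less_iff)
      then have 1: "u * p + (1 - u) * q \<le> k"
        using real by (simp add: ennreal_le_iff)
      have "u * (i - e) \<le> u * p" "(1 - u) * (j - e) \<le> (1 - u) * q"
        using u by (auto simp: p_def q_def intro!: mult_left_mono)
      then show ?thesis using 1 by (simp add: algebra_simps)
    qed
    then have "u * i + (1 - u) * j \<le> k"
      by (rule field_le_epsilon)
    then show ?thesis
      using u real i j by (simp add: ennreal_plus[symmetric] ennreal_mult[symmetric] ennreal_le_iff
          del: ennreal_plus)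
  qed
qed

text \<open>The levels are written as \<open>t * M\<close> with \<open>t\<close> between 0 and 1, so
  that functions with different suprema can be compared at the same relative height
  \<open>t\<close>.\<close>

lemma layer_cake_bounded:
  fixes f :: "real \<Rightarrow> ennreal"
  assumes [measurable]: "f \<in> borel_measurable borel" and M: "0 < M" and le: "\<And>x. f x \<le> ennreal M"
  shows "(\<integral>\<^sup>+x. f x \<partial>lborel)
    = ennreal M * (\<integral>\<^sup>+t. emeasure lborel {x. ennreal (t * M) < f x} * indicator {0<..<1} t \<partial>lborel)"
proof -
  have pt: "f x = ennreal M * (\<integral>\<^sup>+t. indicator {x. ennreal (t * M) < f x} x * indicator {0<..<1} t \<partial>lborel)"
    for x
  proof -
    obtain r where r: "f x = ennreal r" "0 \<le> r" "r \<le> M"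
      using le[of x] M by (cases "f x") (auto simp: top_unique)
    have "(\<integral>\<^sup>+t. indicator {x. ennreal (t * M) < f x} x * indicator {0<..<1} t \<partial>lborel)
        = (\<integral>\<^sup>+t. indicator {0<..<r / M} t \<partial>lborel)"
    proof (intro nn_integral_cong)
      fix t
      have "t < 1" if "t * M < r"
        using that r M mult_right_mono[of 1 t M] by linarith
      then show "indicator {x. ennreal (t * M) < f x} x * indicator {0<..<1} t = (indicator {0<..<r / M} t :: ennreal)"
        using r M by (auto simp: indicator_def ennreal_less_iff field_simps)
    qed
    also have "\<dots> = ennreal (r / M)" using r M by simp
    finally show ?thesis using r M by (simp add: ennreal_mult[symmetric])
  qed
  have "(\<integral>\<^sup>+x. f x \<partial>lborel) = (\<integral>\<^sup>+x. ennreal M *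
      (\<integral>\<^sup>+t. indicator {x. ennreal (t * M) < f x} x * indicator {0<..<1} t \<partial>lborel) \<partial>lborel)"
    using pt by (intro nn_integral_cong)
  also have "\<dots> = ennreal M * (\<integral>\<^sup>+x. \<integral>\<^sup>+t. indicator {x. ennreal (t * M) < f x} x
      * indicator {0<..<1} t \<partial>lborel \<partial>lborel)"
    by (rule nn_integral_cmult) (simp add: indicator_def, measurable)
  also have "(\<integral>\<^sup>+x. \<integral>\<^sup>+t. indicator {x. ennreal (t * M) < f x} x * indicator {0<..<1} t \<partial>lborel \<partial>lborel)
      = (\<integral>\<^sup>+t. \<integral>\<^sup>+x. indicator {x. ennreal (t * M) < f x} x * indicator {0<..<1} t \<partial>lborel \<partial>lborel)"
    by (rule lborel_pair.Fubini') (simp add: indicator_def, measurable)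
  also have "\<dots> = (\<integral>\<^sup>+t. emeasure lborel {x. ennreal (t * M) < f x} * indicator {0<..<1} t \<partial>lborel)"
    by (intro nn_integral_cong) (simp add: nn_integral_multc)
  finally show ?thesis .
qed

text \<open>Meant for the majorant in the Prekopa-Leindler inequality. It may exceed the level
  \<open>M\<close>, so only an inequality is left, and its lower bounds are weak ones, hence the
  closed superlevel sets.\<close>

lemma layer_cake_le:
  fixes h :: "real \<Rightarrow> ennreal"
  assumes [measurable]: "h \<in> borel_measurable borel" and M: "0 < M"
  shows "ennreal M * (\<integral>\<^sup>+t. emeasure lborel {x. ennreal (t * M) \<le> h x} * indicator {0<..<1} t \<partial>lborel)
    \<le> (\<integral>\<^sup>+x. h x \<partial>lborel)"
proof -
  have pt: "ennreal M * (\<integral>\<^sup>+t. indicator {x. ennreal (t * M) \<le> h x} x * indicator {0<..<1} t \<partial>lborel) \<le> h x"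
    for x
  proof (cases "h x")
    case (real r)
    have "(\<integral>\<^sup>+t. indicator {x. ennreal (t * M) \<le> h x} x * indicator {0<..<1} t \<partial>lborel)
        \<le> (\<integral>\<^sup>+t. indicator {0..r / M} t \<partial>lborel)"
      using real M by (intro nn_integral_mono)
        (auto simp: indicator_def ennreal_le_iff field_simps)
    also have "\<dots> = ennreal (r / M)" using real M by simp
    finally have "ennreal M * (\<integral>\<^sup>+t. indicator {x. ennreal (t * M) \<le> h x} x * indicator {0<..<1} t \<partial>lborel)
        \<le> ennreal M * ennreal (r / M)" by (rule mult_left_mono) simp
    then show ?thesis using real M by (simp add: ennreal_mult[symmetric])
  qed simp
  have "ennreal M * (\<integral>\<^sup>+t. emeasure lborel {x. ennreal (t * M) \<le> h x} * indicator {0<..<1} t \<partial>lborel)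
     = ennreal M * (\<integral>\<^sup>+t. \<integral>\<^sup>+x. indicator {x. ennreal (t * M) \<le> h x} x * indicator {0<..<1} t \<partial>lborel \<partial>lborel)"
    by (intro arg_cong2[where f = "(*)"] refl nn_integral_cong) (simp add: nn_integral_multc)
  also have "(\<integral>\<^sup>+t. \<integral>\<^sup>+x. indicator {x. ennreal (t * M) \<le> h x} x * indicator {0<..<1} t \<partial>lborel \<partial>lborel)
     = (\<integral>\<^sup>+x. \<integral>\<^sup>+t. indicator {x. ennreal (t * M) \<le> h x} x * indicator {0<..<1} t \<partial>lborel \<partial>lborel)"
    by (rule lborel_pair.Fubini') (simp add: indicator_def, measurable)
  also have "ennreal M * \<dots> = (\<integral>\<^sup>+x. ennreal M *
      (\<integral>\<^sup>+t. indicator {x. ennreal (t * M) \<le> h x} x * indicator {0<..<1} t \<partial>lborel) \<partial>lborel)"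
    by (rule nn_integral_cmult[symmetric]) (simp add: indicator_def, measurable)
  also have "\<dots> \<le> (\<integral>\<^sup>+x. h x \<partial>lborel)"
    by (intro nn_integral_mono pt)
  finally show ?thesis .
qed

lemma powr_mult_powr_le:
  fixes x y u :: real
  assumes "0 < x" "0 < y" "0 \<le> u" "u \<le> 1"
  shows "x powr u * y powr (1 - u) \<le> u * x + (1 - u) * y"
proof -
  have "exp (u * ln x + (1 - u) * ln y) \<le> u * exp (ln x) + (1 - u) * exp (ln y)"
    using convex_onD[OF exp_convex, of "1 - u" "ln x" "ln y"] assms by simp
  then show ?thesis using assms by (simp add: powr_def exp_add)
qed


text \<open>\<open>M\<close> is the supremum of \<open>f\<close>. Its last property makes the
  superlevel sets at the heights \<open>t * M\<close> nonempty, without which the Brunn-Minkowski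
  inequality fails.\<close>

lemma exists_SUP_real_bound:
  fixes f :: "real \<Rightarrow> ennreal"
  assumes le: "\<And>x. f x \<le> ennreal C" and pos: "0 < (\<integral>\<^sup>+x. f x \<partial>lborel)"
  obtains M where "0 < M" "\<And>x. f x \<le> ennreal M" "\<And>t. 0 < t \<Longrightarrow> t < 1 \<Longrightarrow> \<exists>x. ennreal (t * M) < f x"
proof -
  define S where "S = (SUP x. f x)"
  have "S \<le> ennreal C" unfolding S_def by (rule SUP_least) (rule le)
  then obtain M where M: "S = ennreal M" "0 \<le> M" by (cases S) (auto simp: top_unique)
  have fS: "f x \<le> S" for x unfolding S_def by (rule SUP_upper) simp
  have "M \<noteq> 0"
  proof
    assume "M = 0"
    then have "f x = 0" for x using fS[of x] M by simp
    then show False using pos by simp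
  qed
  show thesis
  proof
    show "0 < M" using M \<open>M \<noteq> 0\<close> by simp
    show "f x \<le> ennreal M" for x using fS M by simp
    show "\<exists>x. ennreal (t * M) < f x" if "0 < t" "t < 1" for t
    proof -
      have "t * M < M" using that \<open>0 < M\<close> by simp
      then have "ennreal (t * M) < S" using M that by (simp add: ennreal_less_iff)
      then show ?thesis unfolding S_def by (auto simp: less_SUP_iff)
    qed
  qed
qed

text \<open>Relative to their suprema, \<open>f\<close> and \<open>g\<close> have nonempty intervals
  as superlevel sets at every height \<open>t\<close> in (0, 1), and the hypothesis on
  \<open>h\<close> puts the convex combination of the two into the superlevel set of
  \<open>h\<close> at height \<open>t * L\<close>. Brunn-Minkowski bounds its length, integration
  over \<open>t\<close> gives an arithmetic mean of the normalised integrals, and the inequality of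
  arithmetic and geometric means turns it into the product of powers. The integrals are represented
  by real lower bounds \<open>A\<close> and \<open>B\<close>.\<close>

lemma prekopa_leindler_bounded:
  fixes f g h :: "real \<Rightarrow> ennreal"
  assumes [measurable]: "f \<in> borel_measurable borel" "g \<in> borel_measurable borel"
      "h \<in> borel_measurable borel"
    and u: "0 < u" "u < 1"
    and f: "\<And>c. 0 \<le> c \<Longrightarrow> is_interval {x. ennreal c < f x}" "\<And>x. f x \<le> ennreal C"
    and g: "\<And>c. 0 \<le> c \<Longrightarrow> is_interval {x. ennreal c < g x}" "\<And>x. g x \<le> ennreal C"
    and h: "\<And>x y a b. 0 < a \<Longrightarrow> 0 < b \<Longrightarrow> ennreal a < f x \<Longrightarrow> ennreal b < g y
        \<Longrightarrow> ennreal (a powr u * b powr (1 - u)) \<le> h (u * x + (1 - u) * y)"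
    and A: "0 < A" "ennreal A < (\<integral>\<^sup>+x. f x \<partial>lborel)"
    and B: "0 < B" "ennreal B < (\<integral>\<^sup>+x. g x \<partial>lborel)"
  shows "ennreal (A powr u * B powr (1 - u)) \<le> (\<integral>\<^sup>+x. h x \<partial>lborel)"
proof -
  have fpos: "0 < (\<integral>\<^sup>+x. f x \<partial>lborel)" and gpos: "0 < (\<integral>\<^sup>+x. g x \<partial>lborel)"
    using A B by (auto intro: le_less_trans[OF zero_le])
  obtain M where M: "0 < M" "\<And>x. f x \<le> ennreal M"
      "\<And>t. 0 < t \<Longrightarrow> t < 1 \<Longrightarrow> \<exists>x. ennreal (t * M) < f x"
    using exists_SUP_real_bound[OF f(2) fpos] by metis
  obtain N where N: "0 < N" "\<And>x. g x \<le> ennreal N"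
      "\<And>t. 0 < t \<Longrightarrow> t < 1 \<Longrightarrow> \<exists>x. ennreal (t * N) < g x"
    using exists_SUP_real_bound[OF g(2) gpos] by metis
  define L where "L = M powr u * N powr (1 - u)"
  have L: "0 < L" using M N by (simp add: L_def)
  define \<phi> where "\<phi> = (\<lambda>t. emeasure lborel {x. ennreal (t * M) < f x} * indicator {0<..<1} t)"
  define \<psi> where "\<psi> = (\<lambda>t. emeasure lborel {x. ennreal (t * N) < g x} * indicator {0<..<1} t)"
  have \<phi>: "\<phi> = (\<lambda>t. (\<integral>\<^sup>+x. indicator {x. ennreal (t * M) < f x} x \<partial>lborel) * indicator {0<..<1} t)"
    and \<psi>: "\<psi> = (\<lambda>t. (\<integral>\<^sup>+x. indicator {x. ennreal (t * N) < g x} x \<partial>lborel) * indicator {0<..<1} t)"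
    by (simp_all add: \<phi>_def \<psi>_def)
  have [measurable]: "\<phi> \<in> borel_measurable borel" "\<psi> \<in> borel_measurable borel"
    unfolding \<phi> \<psi> by (simp_all add: indicator_def)
  have lower: "ennreal (D / P) \<le> I" if "0 < P" "ennreal D < ennreal P * I" "0 < D" for D P I
  proof (cases I)
    case (real i)
    then have "D < P * i" using that by (simp add: ennreal_mult[symmetric] ennreal_less_iff)
    then show ?thesis using real that by (simp add: ennreal_le_iff field_simps)
  qed simp
  have \<phi>A: "ennreal (A / M) \<le> (\<integral>\<^sup>+t. \<phi> t \<partial>lborel)"
    using A M layer_cake_bounded[OF assms(1) M(1,2)] by (intro lower) (auto simp: \<phi>_def)
  have \<psi>B: "ennreal (B / N) \<le> (\<integral>\<^sup>+t. \<psi> t \<partial>lborel)"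
    using B N layer_cake_bounded[OF assms(2) N(1,2)] by (intro lower) (auto simp: \<psi>_def)
  have "A powr u * B powr (1 - u) = L * ((A / M) powr u * (B / N) powr (1 - u))"
    using A B M N by (simp add: L_def powr_divide)
  also have "\<dots> \<le> L * (u * (A / M) + (1 - u) * (B / N))"
    using A B M N u L by (intro mult_left_mono powr_mult_powr_le) auto
  finally have "ennreal (A powr u * B powr (1 - u)) \<le> ennreal (L * (u * (A / M) + (1 - u) * (B / N)))"
    by (rule ennreal_leI)
  also have "\<dots> = ennreal L * (ennreal u * ennreal (A / M) + ennreal (1 - u) * ennreal (B / N))"
    using A B M N u L by (simp add: ennreal_mult[symmetric] ennreal_plus[symmetric] del: ennreal_plus)
  also have "\<dots> \<le> ennreal L * (ennreal u * (\<integral>\<^sup>+t. \<phi> t \<partial>lborel) + ennreal (1 - u) * (\<integral>\<^sup>+t. \<psi> t \<partial>lborel))"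
    by (intro mult_left_mono add_mono \<phi>A \<psi>B) auto
  also have "\<dots> = ennreal L * (\<integral>\<^sup>+t. ennreal u * \<phi> t + ennreal (1 - u) * \<psi> t \<partial>lborel)"
    by (simp add: nn_integral_add nn_integral_cmult)
  also have "\<dots> \<le> ennreal L * (\<integral>\<^sup>+t. emeasure lborel {x. ennreal (t * L) \<le> h x} * indicator {0<..<1} t \<partial>lborel)"
  proof (intro mult_left_mono nn_integral_mono)
    fix t :: real
    show "ennreal u * \<phi> t + ennreal (1 - u) * \<psi> t
        \<le> emeasure lborel {x. ennreal (t * L) \<le> h x} * indicator {0<..<1} t"
    proof (cases "t \<in> {0<..<1}")
      case True
      then have t: "0 < t" "t < 1" by auto
      have tL: "(t * M) powr u * (t * N) powr (1 - u) = t * L"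
        using t M N by (simp add: L_def powr_mult powr_diff field_simps)
      have "ennreal u * emeasure lborel {x. ennreal (t * M) < f x}
          + ennreal (1 - u) * emeasure lborel {x. ennreal (t * N) < g x}
          \<le> emeasure lborel {x. ennreal (t * L) \<le> h x}"
      proof (rule brunn_minkowski_interval)
        fix x y
        assume "x \<in> {x. ennreal (t * M) < f x}" "y \<in> {x. ennreal (t * N) < g x}"
        then show "u * x + (1 - u) * y \<in> {x. ennreal (t * L) \<le> h x}"
          using h[of "t * M" "t * N" x y] t M N by (simp add: tL)
      qed (use t M N u f g in auto)
      then show ?thesis using True by (simp add: \<phi>_def \<psi>_def)
    qed (simp add: \<phi>_def \<psi>_def)
  qed simp
  also have "\<dots> \<le> (\<integral>\<^sup>+x. h x \<partial>lborel)"
    by (rule layer_cake_le) (simp_all add: L)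
  finally show ?thesis .
qed

lemma nn_integral_truncate:
  fixes f :: "real \<Rightarrow> ennreal"
  assumes [measurable]: "f \<in> borel_measurable borel" and A: "A < (\<integral>\<^sup>+x. f x \<partial>lborel)"
  obtains n :: nat where "\<And>m. n \<le> m \<Longrightarrow> A < (\<integral>\<^sup>+x. inf (f x) (of_nat m) \<partial>lborel)"
proof -
  have "(\<integral>\<^sup>+x. f x \<partial>lborel) = (\<integral>\<^sup>+x. (SUP n. inf (f x) (of_nat n)) \<partial>lborel)"
    by (simp flip: inf_SUP add: ennreal_SUP_of_nat_eq_top)
  also have "\<dots> = (SUP n. \<integral>\<^sup>+x. inf (f x) (of_nat n) \<partial>lborel)"
    by (intro nn_integral_monotone_convergence_SUP)
      (auto simp: incseq_def le_fun_def intro: le_infI2)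
  finally obtain n where n: "A < (\<integral>\<^sup>+x. inf (f x) (of_nat n) \<partial>lborel)"
    using A by (auto simp: less_SUP_iff)
  have "A < (\<integral>\<^sup>+x. inf (f x) (of_nat m) \<partial>lborel)" if "n \<le> m" for m
    using that by (intro less_le_trans[OF n] nn_integral_mono) (auto intro: le_infI2)
  then show thesis by (rule that)
qed

text \<open>\<open>f\<close> and \<open>g\<close> are truncated at a common height \<open>m\<close>.
  Each superlevel set stays the same or becomes empty, the integrals still exceed \<open>A\<close>
  and \<open>B\<close> for large \<open>m\<close>, and \<open>h\<close> can be kept because it has
  to dominate less.\<close>

lemma prekopa_leindler:
  fixes f g h :: "real \<Rightarrow> ennreal"
  assumes [measurable]: "f \<in> borel_measurable borel" "g \<in> borel_measurable borel"
      "h \<in> borel_measurable borel"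
    and u: "0 < u" "u < 1"
    and f: "\<And>c. 0 \<le> c \<Longrightarrow> is_interval {x. ennreal c < f x}"
    and g: "\<And>c. 0 \<le> c \<Longrightarrow> is_interval {x. ennreal c < g x}"
    and h: "\<And>x y a b. 0 < a \<Longrightarrow> 0 < b \<Longrightarrow> ennreal a < f x \<Longrightarrow> ennreal b < g y
        \<Longrightarrow> ennreal (a powr u * b powr (1 - u)) \<le> h (u * x + (1 - u) * y)"
    and A: "0 < A" "ennreal A < (\<integral>\<^sup>+x. f x \<partial>lborel)"
    and B: "0 < B" "ennreal B < (\<integral>\<^sup>+x. g x \<partial>lborel)"
  shows "ennreal (A powr u * B powr (1 - u)) \<le> (\<integral>\<^sup>+x. h x \<partial>lborel)"
proof -
  obtain n where n: "\<And>m. n \<le> m \<Longrightarrow> ennreal A < (\<integral>\<^sup>+x. inf (f x) (of_nat m) \<partial>lborel)"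
    using nn_integral_truncate[OF assms(1) A(2)] by blast
  obtain n' where n': "\<And>m. n' \<le> m \<Longrightarrow> ennreal B < (\<integral>\<^sup>+x. inf (g x) (of_nat m) \<partial>lborel)"
    using nn_integral_truncate[OF assms(2) B(2)] by blast
  define m where "m = max n n'"
  have trunc: "is_interval {x. ennreal c < inf (k x) (of_nat m)}"
    if "is_interval {x. ennreal c < k x}" for k :: "real \<Rightarrow> ennreal" and c
    using that by (cases "ennreal c < of_nat m") (simp_all add: inf_min)
  show ?thesis
  proof (rule prekopa_leindler_bounded[where C = "real m"])
    have "inf (k x) (of_nat m) \<le> ennreal (real m)" for k :: "real \<Rightarrow> ennreal" and x
      by (simp add: ennreal_of_nat_eq_real_of_nat)
    then show "inf (f x) (of_nat m) \<le> ennreal (real m)" "inf (g x) (of_nat m) \<le> ennreal (real m)" for x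
      by auto
    show "ennreal A < (\<integral>\<^sup>+x. inf (f x) (of_nat m) \<partial>lborel)"
      "ennreal B < (\<integral>\<^sup>+x. inf (g x) (of_nat m) \<partial>lborel)"
      using n[of m] n'[of m] by (auto simp: m_def)
    show "ennreal (a powr u * b powr (1 - u)) \<le> h (u * x + (1 - u) * y)"
      if "0 < a" "0 < b" "ennreal a < inf (f x) (of_nat m)" "ennreal b < inf (g y) (of_nat m)" for x y a b
      using that by (intro h) (auto simp: inf_min)
  qed (use u f g A B trunc in auto)
qed

text \<open>
  Quantifying over real values strictly below \<open>F x\<close> and \<open>F y\<close> avoids powers of \<open>\<infinity>\<close>.
\<close>

definition log_concave :: "((nat \<Rightarrow> real) \<Rightarrow> ennreal) \<Rightarrow> bool" where
  "log_concave F \<longleftrightarrow> (\<forall>x y a b u. 0 \<le> u \<and> u \<le> 1 \<and> 0 < a \<and> 0 < b \<and> ennreal a < F x \<and> ennreal b < F y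
     \<longrightarrow> ennreal (a powr u * b powr (1 - u)) \<le> F (\<lambda>i. u * x i + (1 - u) * y i))"

lemma log_concaveD:
  assumes "log_concave F" "0 \<le> u" "u \<le> 1" "0 < a" "0 < b" "ennreal a < F x" "ennreal b < F y"
  shows "ennreal (a powr u * b powr (1 - u)) \<le> F (\<lambda>i. u * x i + (1 - u) * y i)"
  using assms unfolding log_concave_def by blast

lemma log_concave_superlevel:
  assumes "log_concave F" "0 \<le> u" "u \<le> 1" "0 \<le> c" "ennreal c < F x" "ennreal c < F y"
  shows "ennreal c < F (\<lambda>i. u * x i + (1 - u) * y i)"
proof -
  have "ennreal c < min (F x) (F y)" using assms by simp
  \<comment> \<open>Log-concavity yields only a weak inequality; strictness comes from applying it
    to a value strictly between \<open>c\<close> and both \<open>F x\<close> and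
    \<open>F y\<close>.\<close>
  then obtain b where b: "ennreal c < b" "b < min (F x) (F y)" using dense by blast
  then obtain a where a: "b = ennreal a" "0 \<le> a" by (cases b) auto
  have "c < a" using a b assms(4) by (simp add: ennreal_less_iff)
  have "ennreal c < ennreal a" using a b by simp
  also have "a = a powr u * a powr (1 - u)"
    using \<open>c < a\<close> assms(4) by (simp flip: powr_add)
  also have "ennreal \<dots> \<le> F (\<lambda>i. u * x i + (1 - u) * y i)"
    using assms a b \<open>c < a\<close> by (intro log_concaveD) auto
  finally show ?thesis .
qed

text \<open>Prekopa's theorem on marginals: the fibres of \<open>F\<close> over \<open>x\<close>,
  over \<open>y\<close> and over their convex combination satisfy the hypothesis of the
  Prekopa-Leindler inequality. The superlevel sets on a line are intervals by log-concavity
  itself.\<close>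

lemma log_concave_nn_integral:
  assumes F: "log_concave F" and [measurable]: "F \<in> borel_measurable borel"
  shows "log_concave (\<lambda>x. \<integral>\<^sup>+t. F (x(j := t)) \<partial>lborel)"
  unfolding log_concave_def
proof (intro allI impI, elim conjE)
  fix x y :: "nat \<Rightarrow> real" and A B u :: real
  assume u: "0 \<le> u" "u \<le> 1" and AB: "0 < A" "0 < B"
    and A: "ennreal A < (\<integral>\<^sup>+t. F (x(j := t)) \<partial>lborel)"
    and B: "ennreal B < (\<integral>\<^sup>+t. F (y(j := t)) \<partial>lborel)"
  let ?z = "\<lambda>i. u * x i + (1 - u) * y i"
  have comb: "(\<lambda>i. v * (w(j := s)) i + (1 - v) * (w'(j := t)) i)
      = (\<lambda>i. v * w i + (1 - v) * w' i)(j := v * s + (1 - v) * t)" for v s t and w w' :: "nat \<Rightarrow> real"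
    by auto
  consider "u = 0" | "u = 1" | "0 < u" "u < 1" using u by linarith
  then show "ennreal (A powr u * B powr (1 - u)) \<le> (\<integral>\<^sup>+t. F (?z(j := t)) \<partial>lborel)"
  proof cases
    case 3
    have int: "is_interval {t. ennreal c < F (w(j := t))}" if "0 \<le> c" for c w
      unfolding is_interval_1
    proof (intro ballI allI impI, elim conjE)
      fix a b s
      assume ab: "a \<in> {t. ennreal c < F (w(j := t))}" "b \<in> {t. ennreal c < F (w(j := t))}"
        and s: "a \<le> s" "s \<le> b"
      define v where "v = (if a = b then 1 else (b - s) / (b - a))"
      have v: "0 \<le> v" "v \<le> 1" "s = v * a + (1 - v) * b"
        using s by (auto simp: v_def divide_simps) (auto simp: algebra_simps)
      have "ennreal c < F (\<lambda>i. v * (w(j := a)) i + (1 - v) * (w(j := b)) i)"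
        using ab log_concave_superlevel[OF F v(1,2) that, of "w(j := a)" "w(j := b)"] by blast
      also have "(\<lambda>i. v * (w(j := a)) i + (1 - v) * (w(j := b)) i) = w(j := s)"
        unfolding comb v(3) by (auto simp: algebra_simps)
      finally show "s \<in> {t. ennreal c < F (w(j := t))}" unfolding mem_Collect_eq .
    qed
    show ?thesis
    proof (rule prekopa_leindler[OF _ _ _ 3])
      fix s t a b
      assume "0 < a" "0 < b" "ennreal a < F (x(j := s))" "ennreal b < F (y(j := t))"
      from log_concaveD[OF F u this]
      show "ennreal (a powr u * b powr (1 - u)) \<le> F (?z(j := u * s + (1 - u) * t))"
        unfolding comb .
    qed (use int AB A B in auto)
  qed (use AB A B in auto)
qed

lemma log_concave_iter_nn_integral:
  assumes F: "log_concave F" and [measurable]: "F \<in> borel_measurable borel"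
  shows "log_concave (iter_nn_integral js F)"
proof (induction js)
  case Nil
  have "iter_nn_integral [] F = F" by auto
  then show ?case using F by simp
next
  case (Cons j js)
  have "iter_nn_integral (j # js) F = (\<lambda>x. \<integral>\<^sup>+t. iter_nn_integral js F (x(j := t)) \<partial>lborel)"
    by auto
  moreover have "log_concave \<dots>"
    by (rule log_concave_nn_integral[OF Cons]) measurable
  ultimately show ?case by (simp only:)
qed


subsection \<open>Replacing a factor under the integral\<close>

text \<open>For finite values the powers can be taken of the values themselves, so that products are
  treated factor by factor. The integrands are of this kind; their integrals may be
  infinite.\<close>

definition log_concave_real :: "((nat \<Rightarrow> real) \<Rightarrow> real) \<Rightarrow> bool" where
  "log_concave_real R \<longleftrightarrow> (\<forall>x. 0 \<le> R x) \<and> (\<forall>x y u. 0 \<le> u \<and> u \<le> 1 \<and> 0 < R x \<and> 0 < R y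
     \<longrightarrow> R x powr u * R y powr (1 - u) \<le> R (\<lambda>i. u * x i + (1 - u) * y i))"

lemma log_concave_ennreal:
  assumes "log_concave_real R"
  shows "log_concave (\<lambda>x. ennreal (R x))"
  unfolding log_concave_def
proof (intro allI impI, elim conjE)
  fix x y :: "nat \<Rightarrow> real" and a b u :: real
  assume u: "0 \<le> u" "u \<le> 1" and ab: "0 < a" "0 < b" "ennreal a < ennreal (R x)" "ennreal b < ennreal (R y)"
  then have R: "a < R x" "b < R y" by (simp_all add: ennreal_less_iff)
  have "a powr u * b powr (1 - u) \<le> R x powr u * R y powr (1 - u)"
    using u ab R by (intro mult_mono powr_mono2) auto
  also have "\<dots> \<le> R (\<lambda>i. u * x i + (1 - u) * y i)"
    using assms u ab R unfolding log_concave_real_def by simp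
  finally show "ennreal (a powr u * b powr (1 - u)) \<le> ennreal (R (\<lambda>i. u * x i + (1 - u) * y i))"
    by (rule ennreal_leI)
qed

lemma log_concave_real_mult:
  assumes R: "log_concave_real R" and S: "log_concave_real S"
  shows "log_concave_real (\<lambda>x. R x * S x)"
  unfolding log_concave_real_def
proof (intro conjI allI impI, goal_cases)
  case 1
  show ?case using R S by (simp add: log_concave_real_def)
next
  case (2 x y u)
  then have u: "0 \<le> u" "u \<le> 1" by auto
  have nn: "0 \<le> R z" "0 \<le> S z" for z using R S by (auto simp: log_concave_real_def)
  then have pos: "0 < R x" "0 < S x" "0 < R y" "0 < S y"
    using 2 by (auto simp: zero_less_mult_iff less_le)
  have "(R x * S x) powr u * (R y * S y) powr (1 - u)
      = (R x powr u * R y powr (1 - u)) * (S x powr u * S y powr (1 - u))"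
    using pos by (simp add: powr_mult)
  also have "\<dots> \<le> R (\<lambda>i. u * x i + (1 - u) * y i) * S (\<lambda>i. u * x i + (1 - u) * y i)"
    using R S u pos nn unfolding log_concave_real_def by (intro mult_mono) auto
  finally show ?case .
qed

lemma log_concave_real_prod:
  assumes "\<And>i. i \<in> I \<Longrightarrow> log_concave_real (R i)"
  shows "log_concave_real (\<lambda>x. \<Prod>i\<in>I. R i x)"
  using assms
proof (induction I rule: infinite_finite_induct)
  case (insert i I)
  then show ?case by (simp add: log_concave_real_mult)
qed (simp_all add: log_concave_real_def)

lemma log_concave_real_linear:
  assumes R: "log_concave_real R"
    and S: "\<And>x y u. S (\<lambda>i. u * x i + (1 - u) * y i) = (\<lambda>i. u * S x i + (1 - u) * S y i)"
  shows "log_concave_real (\<lambda>x. R (S x))"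
  using R unfolding log_concave_real_def S by blast

text \<open>Where \<open>f\<close> exceeds \<open>g\<close>, \<open>k\<close> is at least
  \<open>k a\<close>, and where it falls below, \<open>k\<close> is at most \<open>k a\<close>; so
  \<open>(f - g) * (k - k a)\<close> is nonnegative. The integral of \<open>(f - g) * k a\<close>
  vanishes as the masses agree. With values in \<open>ennreal\<close> the subtracted terms are moved
  to the other side and cancelled at the end.\<close>

lemma single_crossing_nn_integral_mono:
  fixes f g :: "real \<Rightarrow> real" and k :: "real \<Rightarrow> ennreal"
  assumes [measurable]: "f \<in> borel_measurable borel" "g \<in> borel_measurable borel" "k \<in> borel_measurable borel"
    and nn: "\<And>x. 0 \<le> f x" "\<And>x. 0 \<le> g x"
    and eq: "(\<integral>\<^sup>+x. f x \<partial>lborel) = (\<integral>\<^sup>+x. g x \<partial>lborel)" and fin: "(\<integral>\<^sup>+x. f x \<partial>lborel) < \<infinity>"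
    and cross: "\<And>x. \<bar>x\<bar> \<le> a \<Longrightarrow> g x \<le> f x" "\<And>x. a \<le> \<bar>x\<bar> \<Longrightarrow> f x \<le> g x" "0 < a"
      "\<And>x. \<bar>x\<bar> < a \<Longrightarrow> 0 < f x"
    and k: "\<And>s t. \<bar>s\<bar> \<le> \<bar>t\<bar> \<Longrightarrow> k t \<le> k s"
  shows "(\<integral>\<^sup>+x. ennreal (g x) * k x \<partial>lborel) \<le> (\<integral>\<^sup>+x. ennreal (f x) * k x \<partial>lborel)"
proof (cases "k a")
  case (real r)
  have "(\<integral>\<^sup>+x. ennreal (g x) * k x \<partial>lborel) + (\<integral>\<^sup>+x. f x \<partial>lborel) * k a
      = (\<integral>\<^sup>+x. ennreal (g x) * k x + ennreal (f x) * k a \<partial>lborel)"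
    by (simp add: nn_integral_add nn_integral_multc)
  also have "\<dots> \<le> (\<integral>\<^sup>+x. ennreal (f x) * k x + ennreal (g x) * k a \<partial>lborel)"
  proof (intro nn_integral_mono)
    fix x
    have swap: "ennreal p * c + ennreal q * d \<le> ennreal q * c + ennreal p * d"
      if pq: "p \<le> q" "0 \<le> p" and cd: "d \<le> c" for p q c d
    proof -
      obtain e where e: "c = d + e" using cd by (metis le_iff_add)
      have "ennreal p * e \<le> ennreal q * e" using pq by (intro mult_right_mono ennreal_leI) auto
      then have "ennreal p * d + ennreal q * d + ennreal p * e \<le> ennreal p * d + ennreal q * d + ennreal q * e"
        by (rule add_left_mono)
      then show ?thesis unfolding e by (simp add: distrib_left ac_simps)
    qed
    show "ennreal (g x) * k x + ennreal (f x) * k a \<le> ennreal (f x) * k x + ennreal (g x) * k a"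
    proof (cases "\<bar>x\<bar> \<le> a")
      case True
      then show ?thesis using cross(1)[of x] k[of x a] nn by (intro swap) auto
    next
      case False
      then have "ennreal (f x) * k a + ennreal (g x) * k x \<le> ennreal (g x) * k a + ennreal (f x) * k x"
        using cross(2)[of x] cross(3) k[of a x] nn by (intro swap) auto
      then show ?thesis by (simp add: ac_simps)
    qed
  qed
  also have "\<dots> = (\<integral>\<^sup>+x. ennreal (f x) * k x \<partial>lborel) + (\<integral>\<^sup>+x. f x \<partial>lborel) * k a"
    by (simp add: nn_integral_add nn_integral_multc eq)
  finally have le: "(\<integral>\<^sup>+x. ennreal (g x) * k x \<partial>lborel) + (\<integral>\<^sup>+x. f x \<partial>lborel) * k a
      \<le> (\<integral>\<^sup>+x. ennreal (f x) * k x \<partial>lborel) + (\<integral>\<^sup>+x. f x \<partial>lborel) * k a" .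
  have "(\<integral>\<^sup>+x. f x \<partial>lborel) * k a \<noteq> \<infinity>"
    using fin real by (simp add: ennreal_mult_eq_top_iff)
  with le show ?thesis
    by (metis add.commute ennreal_add_left_cancel_le infinity_ennreal_def)
next
  \<comment> \<open>No cancellation is possible here, but \<open>k\<close> is infinite on the whole
    interval where \<open>f\<close> is positive, so the right-hand side is infinite.\<close>
  case top
  have "\<infinity> = (\<integral>\<^sup>+x. \<infinity> * indicator {-a<..<a} x \<partial>lborel)"
    using cross(3) by (simp add: nn_integral_cmult ennreal_mult_eq_top_iff)
  also have "\<dots> \<le> (\<integral>\<^sup>+x. ennreal (f x) * k x \<partial>lborel)"
  proof (intro nn_integral_mono)
    fix x
    show "\<infinity> * indicator {-a<..<a} x \<le> ennreal (f x) * k x"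
    proof (cases "x \<in> {-a<..<a}")
      case True
      then have "\<bar>x\<bar> < a" by auto
      then have "0 < f x" "\<bar>x\<bar> \<le> \<bar>a\<bar>" using cross(4)[of x] by auto
      then have "\<infinity> \<le> k x" using k[of x a] top by simp
      then show ?thesis using True \<open>0 < f x\<close> by (simp add: top_unique ennreal_mult_top)
    qed simp
  qed
  finally show ?thesis by (simp add: top_unique)
qed

text \<open>
  The linear substitution that turns the form \<open>v \<cdot> y\<close> into the coordinate \<open>y j\<close>.
\<close>

definition shear :: "nat \<Rightarrow> nat \<Rightarrow> (nat \<Rightarrow> real) \<Rightarrow> (nat \<Rightarrow> real) \<Rightarrow> nat \<Rightarrow> real" where
  "shear r j v y = y(j := (y j - (\<Sum>k\<in>{..<r} - {j}. v k * y k)) / v j)"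

lemma measurable_shear [measurable]: "shear r j v \<in> borel_measurable borel"
  unfolding shear_def by measurable

lemma sum_shear:
  assumes "j < r" "v j \<noteq> 0"
  shows "(\<Sum>k<r. v k * shear r j v y k) = y j"
proof -
  have "(\<Sum>k<r. v k * shear r j v y k)
      = v j * shear r j v y j + (\<Sum>k\<in>{..<r} - {j}. v k * shear r j v y k)"
    using assms by (intro sum.remove) auto
  also have "(\<Sum>k\<in>{..<r} - {j}. v k * shear r j v y k) = (\<Sum>k\<in>{..<r} - {j}. v k * y k)"
    by (intro sum.cong) (auto simp: shear_def)
  finally show ?thesis using assms by (simp add: shear_def)
qed

lemma shear_comb:
  assumes "v j \<noteq> 0"
  shows "shear r j v (\<lambda>i. u * x i + (1 - u) * y i) = (\<lambda>i. u * shear r j v x i + (1 - u) * shear r j v y i)"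
proof -
  have "(\<Sum>k\<in>{..<r} - {j}. v k * (u * x k + (1 - u) * y k))
      = u * (\<Sum>k\<in>{..<r} - {j}. v k * x k) + (1 - u) * (\<Sum>k\<in>{..<r} - {j}. v k * y k)"
    unfolding sum_distrib_left sum.distrib[symmetric] by (intro sum.cong) (auto simp: algebra_simps)
  then show ?thesis using assms
    by (intro ext) (simp add: shear_def divide_simps, simp add: algebra_simps)
qed

lemma shear_minus: "shear r j v (\<lambda>i. - x i) = (\<lambda>i. - shear r j v x i)"
  by (intro ext) (simp add: shear_def sum_negf minus_divide_left)

text \<open>With \<open>j\<close> innermost and the other coordinates fixed, the substitution is
  affine in one real variable, with Jacobian \<open>1 / \<bar>v j\<bar>\<close>. The coordinate is
  moved back to the front for the use that follows.\<close>

lemma iter_nn_integral_shear: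
  assumes [measurable]: "F \<in> borel_measurable borel" and j: "j \<notin> set js" "v j \<noteq> 0"
  shows "iter_nn_integral (j # js) F x
    = ennreal (1 / \<bar>v j\<bar>) * iter_nn_integral (j # js) (\<lambda>y. F (shear r j v y)) x"
proof -
  have "(\<integral>\<^sup>+t. F (y(j := t)) \<partial>lborel)
      = ennreal (1 / \<bar>v j\<bar>) * (\<integral>\<^sup>+t. F (shear r j v (y(j := t))) \<partial>lborel)" for y
  proof -
    let ?a = "\<Sum>k\<in>{..<r} - {j}. v k * y k"
    have sh: "shear r j v (y(j := t)) = y(j := - ?a / v j + 1 / v j * t)" for t
    proof -
      have "(\<Sum>k\<in>{..<r} - {j}. v k * (y(j := t)) k) = ?a" by (intro sum.cong) auto
      then show ?thesis unfolding shear_def by (auto simp: diff_divide_distrib)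
    qed
    have "(\<integral>\<^sup>+t. F (y(j := t)) \<partial>lborel)
      = ennreal \<bar>1 / v j\<bar> * (\<integral>\<^sup>+t. F (y(j := - ?a / v j + 1 / v j * t)) \<partial>lborel)"
      using j(2) by (intro nn_integral_real_affine) auto
    then show ?thesis unfolding sh by simp
  qed
  then have "iter_nn_integral (js @ [j]) F x
      = ennreal (1 / \<bar>v j\<bar>) * iter_nn_integral (js @ [j]) (\<lambda>y. F (shear r j v y)) x"
    unfolding iter_nn_integral_snoc by (subst iter_nn_integral_cmult[symmetric]) simp_all
  then show ?thesis
    using j(1) by (simp add: iter_nn_integral_Cons_eq_snoc del: iter_nn_integral.simps)
qed

text \<open>After the shear the linear form is the outermost variable: the integral is split over
  the parallel hyperplanes on which the form takes the value \<open>t\<close>.\<close>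

lemma iter_nn_integral_ridge:
  fixes f :: "real \<Rightarrow> real"
  assumes [measurable]: "f \<in> borel_measurable borel" "R \<in> borel_measurable borel"
    and f: "\<And>t. 0 \<le> f t" and j: "j \<notin> set js" "j < r" "v j \<noteq> 0"
  shows "iter_nn_integral (j # js) (\<lambda>y. ennreal (f (\<Sum>k<r. v k * y k) * R y)) x
    = ennreal (1 / \<bar>v j\<bar>) * (\<integral>\<^sup>+t. ennreal (f t)
        * iter_nn_integral js (\<lambda>y. ennreal (R (shear r j v y))) (x(j := t)) \<partial>lborel)"
proof -
  have "iter_nn_integral (j # js) (\<lambda>y. ennreal (f (\<Sum>k<r. v k * y k) * R y)) x
    = ennreal (1 / \<bar>v j\<bar>) * iter_nn_integral (j # js) (\<lambda>y. ennreal (f (y j) * R (shear r j v y))) x"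
    using j by (subst iter_nn_integral_shear[where r = r and v = v]) (simp_all add: sum_shear)
  also have "iter_nn_integral (j # js) (\<lambda>y. ennreal (f (y j) * R (shear r j v y))) x
    = (\<integral>\<^sup>+t. ennreal (f t) * iter_nn_integral js (\<lambda>y. ennreal (R (shear r j v y))) (x(j := t)) \<partial>lborel)"
    unfolding iter_nn_integral.simps
  proof (intro nn_integral_cong)
    fix t
    have "iter_nn_integral js (\<lambda>y. ennreal (f (y j) * R (shear r j v y))) (x(j := t))
        = iter_nn_integral js (\<lambda>y. ennreal (f t) * ennreal (R (shear r j v y))) (x(j := t))"
    proof (rule iter_nn_integral_cong)
      fix y assume "\<And>i. i \<notin> set js \<Longrightarrow> y i = (x(j := t)) i"
      from this[OF j(1)] show "ennreal (f (y j) * R (shear r j v y)) = ennreal (f t) * ennreal (R (shear r j v y))"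
        using f by (simp add: ennreal_mult')
    qed
    then show "iter_nn_integral js (\<lambda>y. ennreal (f (y j) * R (shear r j v y))) (x(j := t))
        = ennreal (f t) * iter_nn_integral js (\<lambda>y. ennreal (R (shear r j v y))) (x(j := t))"
      by (simp add: iter_nn_integral_cmult)
  qed
  finally show ?thesis .
qed

text \<open>The function \<open>k\<close> of the comparison is the integral of \<open>R\<close> over
  the hyperplanes. All parameters are set to 0, so that reflecting the point is the same as
  reflecting \<open>t\<close>, which makes \<open>k\<close> even.\<close>

lemma iter_nn_integral_ridge_mono:
  fixes f g :: "real \<Rightarrow> real"
  assumes [measurable]: "f \<in> borel_measurable borel" "g \<in> borel_measurable borel" "R \<in> borel_measurable borel"
    and nn: "\<And>x. 0 \<le> f x" "\<And>x. 0 \<le> g x"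
    and eq: "(\<integral>\<^sup>+x. f x \<partial>lborel) = (\<integral>\<^sup>+x. g x \<partial>lborel)" and fin: "(\<integral>\<^sup>+x. f x \<partial>lborel) < \<infinity>"
    and cross: "\<And>x. \<bar>x\<bar> \<le> a \<Longrightarrow> g x \<le> f x" "\<And>x. a \<le> \<bar>x\<bar> \<Longrightarrow> f x \<le> g x" "0 < a"
      "\<And>x. \<bar>x\<bar> < a \<Longrightarrow> 0 < f x"
    and R: "log_concave_real R" "\<And>x. R (\<lambda>i. - x i) = R x"
    and j: "j \<notin> set js" "j < r" "v j \<noteq> 0"
  shows "iter_nn_integral (j # js) (\<lambda>y. ennreal (g (\<Sum>k<r. v k * y k) * R y)) (\<lambda>_. 0)
    \<le> iter_nn_integral (j # js) (\<lambda>y. ennreal (f (\<Sum>k<r. v k * y k) * R y)) (\<lambda>_. 0)"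
proof -
  define G where "G = iter_nn_integral js (\<lambda>y. ennreal (R (shear r j v y)))"
  have G: "log_concave G" unfolding G_def
    by (intro log_concave_iter_nn_integral log_concave_ennreal log_concave_real_linear[OF R(1)] shear_comb j)
      measurable
  have Geven: "G (\<lambda>i. - x i) = G x" for x unfolding G_def
    by (subst iter_nn_integral_minus) (simp_all add: shear_minus R(2))
  define k where "k = (\<lambda>t. G ((\<lambda>_. 0)(j := t)))"
  have [measurable]: "k \<in> borel_measurable borel" unfolding k_def G_def by measurable
  have kmono: "k t \<le> k s" if st: "\<bar>s\<bar> \<le> \<bar>t\<bar>" for s t
  proof (rule ccontr)
    assume "\<not> k t \<le> k s"
    then have "k s < k t" by simp
    then obtain b where b: "b = k s" "0 \<le> b" "b < k t" by auto
    then obtain c where c: "k s = ennreal c" "0 \<le> c" by (cases "k s") auto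
    \<comment> \<open>The weight that writes \<open>s\<close> as a convex combination of
      \<open>t\<close> and \<open>- t\<close>. For \<open>t = 0\<close> also \<open>s = 0\<close>,
      and the weight is arbitrary.\<close>
    define u where "u = (if t = 0 then 1 else (1 + s / t) / 2)"
    have u: "0 \<le> u" "u \<le> 1" "s = u * t + (1 - u) * (- t)"
      using st by (auto simp: u_def field_simps abs_if split: if_splits)
    have e: "(\<lambda>i. - ((\<lambda>_. 0)(j := t)) i) = (\<lambda>_. 0)(j := - t)" by auto
    have "k (- t) = k t" using Geven[of "(\<lambda>_. 0)(j := t)"] unfolding k_def e by simp
    moreover have kt: "ennreal c < k t" using b c by simp
    ultimately have "ennreal c < k (- t)" by simp
    from log_concave_superlevel[OF G u(1,2) c(2) kt[unfolded k_def] this[unfolded k_def]]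
    have "ennreal c < G (\<lambda>i. u * ((\<lambda>_. 0)(j := t)) i + (1 - u) * ((\<lambda>_. 0)(j := - t)) i)" .
    also have "(\<lambda>i. u * ((\<lambda>_. 0)(j := t)) i + (1 - u) * ((\<lambda>_. 0)(j := - t)) i) = (\<lambda>_. 0)(j := s)"
      using u(3) by auto
    finally have "ennreal c < k s" unfolding k_def .
    then show False using c by simp
  qed
  have "(\<integral>\<^sup>+t. ennreal (g t) * k t \<partial>lborel) \<le> (\<integral>\<^sup>+t. ennreal (f t) * k t \<partial>lborel)"
    by (rule single_crossing_nn_integral_mono[OF _ _ _ nn eq fin cross kmono]) simp_all
  then show ?thesis
    using j nn by (subst (1 2) iter_nn_integral_ridge) (auto simp: k_def G_def intro: mult_left_mono)
qed


section \<open>The two profiles: a cosine arch and a Gaussian of the same mass\<close>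

definition cos_bump :: "real \<Rightarrow> real" where
  "cos_bump x = (if \<bar>x\<bar> < 1 / 2 then (cos (pi * x))\<^sup>2 else 0)"

text \<open>This is \<open>exp (- \<pi> (2 x)\<^sup>2)\<close>, the centred Gaussian with value 1 at
  0 and total mass 1/2.\<close>

definition gauss :: "real \<Rightarrow> real" where
  "gauss x = exp (- 4 * pi * x\<^sup>2)"

lemma measurable_cos_bump [measurable]: "cos_bump \<in> borel_measurable borel"
  unfolding cos_bump_def by measurable

lemma measurable_gauss [measurable]: "gauss \<in> borel_measurable borel"
  unfolding gauss_def by measurable

lemma cos_bump_nonneg: "0 \<le> cos_bump x" and gauss_pos: "0 < gauss x"
  by (auto simp: cos_bump_def gauss_def)

lemma cos_pi_mult_pos: "\<bar>x\<bar> < 1 / 2 \<Longrightarrow> 0 < cos (pi * x)"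
  using mult_strict_left_mono[of x "1/2" pi] mult_strict_left_mono[of "- (1/2)" x pi]
  by (intro cos_gt_zero_pi) auto

lemma cos_bump_pos: "\<bar>x\<bar> < 1 / 2 \<Longrightarrow> 0 < cos_bump x"
  using cos_pi_mult_pos[of x] by (simp add: cos_bump_def)

lemma nn_integral_cos_bump: "(\<integral>\<^sup>+x. ennreal (cos_bump x) \<partial>lborel) = ennreal (1 / 2)"
proof -
  define F where "F x = x / 2 + sin (2 * pi * x) / (4 * pi)" for x
  have "(\<integral>\<^sup>+x. ennreal (cos_bump x) \<partial>lborel)
      = (\<integral>\<^sup>+x. ennreal ((cos (pi * x))\<^sup>2) * indicator {- (1/2)..1/2} x \<partial>lborel)"
  proof (intro nn_integral_cong)
    fix x :: real
    consider "\<bar>x\<bar> < 1 / 2" | "x = 1 / 2" | "x = - (1 / 2)" | "1 / 2 < \<bar>x\<bar>" by linarith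
    then show "ennreal (cos_bump x) = ennreal ((cos (pi * x))\<^sup>2) * indicator {- (1/2)..1/2} x"
    proof cases
      case 2
      have "cos (pi * x) = 0" unfolding 2 by simp
      then show ?thesis by (simp add: cos_bump_def)
    next
      case 3
      have "cos (pi * x) = 0" unfolding 3 by simp
      then show ?thesis by (simp add: cos_bump_def)
    qed (auto simp: cos_bump_def indicator_def abs_if split: if_splits)
  qed
  also have "\<dots> = F (1/2) - F (- (1/2))"
  proof (rule nn_integral_FTC_Icc)
    show "(F has_real_derivative (cos (pi * x))\<^sup>2) (at x)" for x
    proof -
      have "(F has_real_derivative (1 / 2 + cos (2 * pi * x) / 2)) (at x)"
        unfolding F_def by (auto intro!: derivative_eq_intros simp: field_simps)
      also have "1 / 2 + cos (2 * pi * x) / 2 = (cos (pi * x))\<^sup>2"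
        using cos_double_cos[of "pi * x"] by (simp add: field_simps)
      finally show ?thesis .
    qed
  qed auto
  also have "F (1/2) - F (- (1/2)) = 1 / 2"
    by (simp add: F_def)
  finally show ?thesis .
qed

text \<open>Completing the square in one variable. The coefficients \<open>b\<close> and
  \<open>c\<close> will contain the remaining variables, and \<open>c - b\<^sup>2 / a\<close> is
  then the form of the Schur complement.\<close>

lemma nn_integral_gauss_quadratic:
  assumes "0 < a"
  shows "(\<integral>\<^sup>+t. ennreal (exp (- 4 * pi * (a * t\<^sup>2 + 2 * b * t + c))) \<partial>lborel)
    = ennreal (1 / (2 * sqrt a)) * ennreal (exp (- 4 * pi * (c - b\<^sup>2 / a)))"
proof -
  \<comment> \<open>Chosen so that \<open>1 / (2 * \<sigma>\<^sup>2)\<close> equals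
    \<open>4 * pi * a\<close>, which makes the integrand a multiple of a normal density with mean
    \<open>- b / a\<close>.\<close>
  define \<sigma> where "\<sigma> = sqrt (1 / (8 * pi * a))"
  have \<sigma>: "0 < \<sigma>" "\<sigma>\<^sup>2 = 1 / (8 * pi * a)" using assms by (auto simp: \<sigma>_def)
  have "(\<integral>\<^sup>+t. ennreal (normal_density (- b / a) \<sigma> t) \<partial>lborel) = 1"
  proof -
    interpret prob_space "density lborel (normal_density (- b / a) \<sigma>)"
      using \<sigma>(1) by (rule prob_space_normal_density)
    show ?thesis using emeasure_space_1 by (simp add: emeasure_density)
  qed
  moreover have "exp (- 4 * pi * (a * t\<^sup>2 + 2 * b * t + c))
      = (1 / (2 * sqrt a)) * exp (- 4 * pi * (c - b\<^sup>2 / a)) * normal_density (- b / a) \<sigma> t" for t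
  proof -
    have "2 * pi * \<sigma>\<^sup>2 = 1 / (4 * a)" by (simp add: \<sigma>(2))
    then have p: "1 / sqrt (2 * pi * \<sigma>\<^sup>2) = 2 * sqrt a"
      by (simp only:) (simp add: real_sqrt_divide real_sqrt_mult)
    have "a * (t - (- b / a))\<^sup>2 = a * t\<^sup>2 + 2 * b * t + b\<^sup>2 / a"
      using assms by (simp add: power2_sum power_divide algebra_simps) (simp add: power2_eq_square)
    moreover have "1 / (2 * \<sigma>\<^sup>2) = 4 * pi * a" by (simp add: \<sigma>(2))
    ultimately have "(t - (- b / a))\<^sup>2 / (2 * \<sigma>\<^sup>2) = 4 * pi * (a * t\<^sup>2 + 2 * b * t + b\<^sup>2 / a)"
      by (metis (no_types, opaque_lifting) mult.assoc mult.commute times_divide_eq_right mult_1_right)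
    then have "normal_density (- b / a) \<sigma> t
        = 2 * sqrt a * exp (- (4 * pi * (a * t\<^sup>2 + 2 * b * t + b\<^sup>2 / a)))"
      unfolding normal_density_def p by (simp only: minus_divide_left[symmetric])
    moreover have "exp (- 4 * pi * (a * t\<^sup>2 + 2 * b * t + c)) = exp (- 4 * pi * (c - b\<^sup>2 / a))
        * exp (- (4 * pi * (a * t\<^sup>2 + 2 * b * t + b\<^sup>2 / a)))"
      unfolding exp_add[symmetric] by (rule arg_cong[of _ _ exp]) (simp add: algebra_simps)
    ultimately show ?thesis using assms by simp
  qed
  ultimately have "(\<integral>\<^sup>+t. ennreal (exp (- 4 * pi * (a * t\<^sup>2 + 2 * b * t + c))) \<partial>lborel)
      = ennreal (1 / (2 * sqrt a) * exp (- 4 * pi * (c - b\<^sup>2 / a)))"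
    (is "?I = ennreal ?K")
  proof -
    assume one: "(\<integral>\<^sup>+t. ennreal (normal_density (- b / a) \<sigma> t) \<partial>lborel) = 1"
      and eq: "\<And>t. exp (- 4 * pi * (a * t\<^sup>2 + 2 * b * t + c)) = ?K * normal_density (- b / a) \<sigma> t"
    have K: "0 \<le> ?K" using assms by simp
    have "?I = (\<integral>\<^sup>+t. ennreal ?K * ennreal (normal_density (- b / a) \<sigma> t) \<partial>lborel)"
      by (intro nn_integral_cong) (simp only: eq ennreal_mult'[OF K])
    also have "\<dots> = ennreal ?K * (\<integral>\<^sup>+t. ennreal (normal_density (- b / a) \<sigma> t) \<partial>lborel)"
      by (rule nn_integral_cmult) simp
    finally show ?thesis by (simp only: one mult_1_right)
  qed
  then show ?thesis using assms by (subst ennreal_mult[symmetric]) simp_all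
qed

lemma nn_integral_gauss: "(\<integral>\<^sup>+x. ennreal (gauss x) \<partial>lborel) = ennreal (1 / 2)"
  using nn_integral_gauss_quadratic[of 1 0 0] by (simp add: gauss_def)

lemma tan_convex: "convex_on {0..<pi/2} tan"
proof (rule convex_on_realI)
  fix x :: real assume x: "x \<in> {0..<pi/2}"
  then have "cos x \<noteq> 0" using cos_gt_zero_pi[of x] by auto
  then show "(tan has_real_derivative inverse ((cos x)\<^sup>2)) (at x)" by (rule DERIV_tan)
next
  fix x y :: real assume xy: "x \<in> {0..<pi/2}" "y \<in> {0..<pi/2}" "x \<le> y"
  then have "0 < cos y" "cos y \<le> cos x"
    using cos_gt_zero_pi[of y] by (auto intro!: cos_monotone_0_pi_le)
  then show "inverse ((cos x)\<^sup>2) \<le> inverse ((cos y)\<^sup>2)"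
    by (intro le_imp_inverse_le power_mono) auto
qed auto

text \<open>The line \<open>4 * x\<close> is the chord of the convex function
  \<open>tan (pi * x)\<close> from 0 to 1/4. Convexity puts the graph below it between these points
  and above it beyond 1/4.\<close>

lemma tan_pi_mult_le: "0 \<le> x \<Longrightarrow> x \<le> 1 / 4 \<Longrightarrow> tan (pi * x) \<le> 4 * x"
  using convex_onD[OF tan_convex, of "4 * x" 0 "pi / 4"] by (simp add: tan_45 mult.commute)

lemma tan_pi_mult_ge: "1 / 4 \<le> x \<Longrightarrow> x < 1 / 2 \<Longrightarrow> 4 * x \<le> tan (pi * x)"
proof -
  assume x: "1 / 4 \<le> x" "x < 1 / 2"
  have "tan (pi / 4) \<le> 1 / (4 * x) * tan (pi * x)"
    using convex_onD[OF tan_convex, of "1 / (4 * x)" 0 "pi * x"] x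
    by (simp add: field_simps mult.commute)
  then show ?thesis using x by (simp add: tan_45 field_simps)
qed

lemma cos_gauss_single_crossing:
  obtains a where "0 < a" "a < 1 / 2"
    "\<And>x. \<bar>x\<bar> \<le> a \<Longrightarrow> gauss x \<le> cos_bump x" "\<And>x. a \<le> \<bar>x\<bar> \<Longrightarrow> cos_bump x \<le> gauss x"
proof -
  \<comment> \<open>Half the logarithm of the quotient of the bump and the Gaussian. As \<open>tan (\<pi> x)\<close> is convex and meets
    \<open>4 x\<close> at \<open>x = 1/4\<close>, it increases up to \<open>1/4\<close> and decreases afterwards.\<close>
  define L where "L x = ln (cos (pi * x)) + 2 * pi * x\<^sup>2" for x
  have der: "(L has_real_derivative pi * (4 * x - tan (pi * x))) (at x)" if "\<bar>x\<bar> < 1 / 2" for x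
  proof -
    have "((\<lambda>x. cos (pi * x)) has_real_derivative - sin (pi * x) * pi) (at x)"
      by (auto intro!: derivative_eq_intros)
    from DERIV_chain2[OF DERIV_ln_divide[OF cos_pi_mult_pos[OF that]] this]
    have "(L has_real_derivative 1 / cos (pi * x) * (- sin (pi * x) * pi) + 2 * pi * (2 * x)) (at x)"
      unfolding L_def by (rule DERIV_add) (auto intro!: derivative_eq_intros)
    then show ?thesis by (simp add: tan_def algebra_simps)
  qed
  have inc: "L x \<le> L y" if "0 \<le> x" "x \<le> y" "y \<le> 1 / 4" for x y
  proof (rule DERIV_nonneg_imp_nondecreasing[OF \<open>x \<le> y\<close>])
    fix z assume z: "x \<le> z" "z \<le> y"
    then have "0 \<le> pi * (4 * z - tan (pi * z))" using that tan_pi_mult_le[of z] by simp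
    with der[of z] z that show "\<exists>d. (L has_real_derivative d) (at z) \<and> 0 \<le> d" by auto
  qed
  have dec: "L y \<le> L x" if "1 / 4 \<le> x" "x \<le> y" "y < 1 / 2" for x y
  proof (rule DERIV_nonpos_imp_nonincreasing[OF \<open>x \<le> y\<close>])
    fix z assume z: "x \<le> z" "z \<le> y"
    then have "pi * (4 * z - tan (pi * z)) \<le> 0"
      using that tan_pi_mult_ge[of z] by (simp add: mult_nonneg_nonpos)
    with der[of z] z that show "\<exists>d. (L has_real_derivative d) (at z) \<and> d \<le> 0" by auto
  qed
  have L0: "L 0 = 0" by (simp add: L_def)
  have even: "gauss x = gauss \<bar>x\<bar>" "cos_bump x = cos_bump \<bar>x\<bar>" for x
    by (auto simp: gauss_def cos_bump_def abs_if)
  have gL: "gauss x \<le> cos_bump x \<longleftrightarrow> 0 \<le> L x" "cos_bump x \<le> gauss x \<longleftrightarrow> L x \<le> 0" if "0 \<le> x" "x < 1 / 2" for x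
  proof -
    have c: "0 < cos (pi * x)" using that by (intro cos_pi_mult_pos) auto
    have e: "gauss x = (exp (- 2 * pi * x\<^sup>2))\<^sup>2" "cos_bump x = (exp (ln (cos (pi * x))))\<^sup>2"
      using that c by (auto simp: gauss_def cos_bump_def exp_double[symmetric])
    show "gauss x \<le> cos_bump x \<longleftrightarrow> 0 \<le> L x" "cos_bump x \<le> gauss x \<longleftrightarrow> L x \<le> 0"
      unfolding e power2_le_iff_abs_le[OF exp_ge_zero] abs_exp_cancel exp_le_cancel_iff
      by (auto simp: L_def)
  qed
  \<comment> \<open>The crossing lies where \<open>L\<close> decreases: \<open>L (1/4)\<close> is
    still nonnegative, while at 1/2 the cosine vanishes and the exponential does not. The difference
    of the square roots is used instead of \<open>L\<close>, because it is continuous up to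
    1/2.\<close>
  have "\<exists>a\<ge>1/4. a \<le> 1/2 \<and> cos (pi * a) - exp (- 2 * pi * a\<^sup>2) = 0"
  proof (rule IVT2')
    have "0 \<le> L (1/4)" using inc[of 0 "1/4"] L0 by simp
    then have "- 2 * pi * (1/4)\<^sup>2 \<le> ln (cos (pi * (1/4)))" by (simp add: L_def)
    moreover have "0 < cos (pi * (1/4))" by (intro cos_pi_mult_pos) auto
    ultimately show "0 \<le> cos (pi * (1/4)) - exp (- 2 * pi * (1/4)\<^sup>2)"
      by (simp add: ln_ge_iff)
  qed (auto intro!: continuous_intros)
  then obtain a where a: "1/4 \<le> a" "a \<le> 1/2" "cos (pi * a) - exp (- 2 * pi * a\<^sup>2) = 0" by blast
  have "a \<noteq> 1 / 2"
  proof
    assume "a = 1 / 2"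
    have "cos (pi * a) = 0" unfolding \<open>a = 1 / 2\<close> by simp
    then show False using a(3) by simp
  qed
  then have a2: "a < 1 / 2" using a by simp
  have La: "L a = 0" using a(3) by (simp add: L_def)
  show thesis
  proof (rule that[of a])
    fix x :: real
    assume x: "\<bar>x\<bar> \<le> a"
    have "0 \<le> L \<bar>x\<bar>"
    proof (cases "\<bar>x\<bar> \<le> 1 / 4")
      case True
      then show ?thesis using inc[of 0 "\<bar>x\<bar>"] L0 by simp
    next
      case False
      then show ?thesis using dec[of "\<bar>x\<bar>" a] La x a2 by simp
    qed
    then show "gauss x \<le> cos_bump x" using gL(1)[of "\<bar>x\<bar>"] x a2 even[of x] by simp
  next
    fix x :: real
    assume x: "a \<le> \<bar>x\<bar>"
    show "cos_bump x \<le> gauss x"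
    proof (cases "\<bar>x\<bar> < 1 / 2")
      case True
      then have "L \<bar>x\<bar> \<le> 0" using dec[of a "\<bar>x\<bar>"] La x a by simp
      then show ?thesis using gL(2)[of "\<bar>x\<bar>"] True even[of x] by simp
    next
      case False
      then show ?thesis using gauss_pos[of x] by (simp add: cos_bump_def)
    qed
  qed (use a a2 in auto)
qed


lemma log_concave_real_ridge:
  fixes f :: "real \<Rightarrow> real"
  assumes "\<And>t. 0 \<le> f t"
    and f: "\<And>a b u. 0 \<le> u \<Longrightarrow> u \<le> 1 \<Longrightarrow> 0 < f a \<Longrightarrow> 0 < f b
      \<Longrightarrow> f a powr u * f b powr (1 - u) \<le> f (u * a + (1 - u) * b)"
  shows "log_concave_real (\<lambda>y. f (\<Sum>k<r. v k * y k))"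
  unfolding log_concave_real_def
proof (intro conjI allI impI, goal_cases)
  case (2 x y u)
  have "(\<Sum>k<r. v k * (u * x k + (1 - u) * y k))
      = u * (\<Sum>k<r. v k * x k) + (1 - u) * (\<Sum>k<r. v k * y k)"
    unfolding sum_distrib_left sum.distrib[symmetric] by (intro sum.cong) (auto simp: algebra_simps)
  then show ?case using f 2 by simp
qed (use assms in auto)

lemma cos_concave: "concave_on {-(pi/2)..pi/2} cos"
  unfolding concave_on_def
proof (rule convex_on_realI)
  show "((\<lambda>x. - cos x) has_real_derivative sin x) (at x)" for x
    by (auto intro!: derivative_eq_intros)
  show "sin x \<le> sin y" if "x \<in> {-(pi/2)..pi/2}" "y \<in> {-(pi/2)..pi/2}" "x \<le> y" for x y
    using that by (intro sin_monotone_2pi_le) auto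
qed auto

text \<open>The cosine is concave and positive on the open arch, hence log-concave by the weighted
  inequality of arithmetic and geometric means, and squaring preserves this.\<close>

lemma cos_bump_log_concave:
  assumes u: "0 \<le> u" "u \<le> 1" and ab: "0 < cos_bump a" "0 < cos_bump b"
  shows "cos_bump a powr u * cos_bump b powr (1 - u) \<le> cos_bump (u * a + (1 - u) * b)"
proof -
  have a: "\<bar>a\<bar> < 1 / 2" and b: "\<bar>b\<bar> < 1 / 2" using ab by (auto simp: cos_bump_def split: if_splits)
  have seg: "u * a + (1 - u) * b \<in> {-(1/2)<..<1/2}"
  proof -
    have ab': "- (1/2) < a" "a < 1/2" "- (1/2) < b" "b < 1/2" using a b by linarith+
    have "(1 - u) * b + u * a \<in> {-(1/2)<..<1/2::real}"
      using convexD_alt[of "{-(1/2)<..<1/2::real}" b a u] ab' u by simp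
    then show ?thesis by (simp add: add.commute)
  qed
  let ?c = "\<lambda>x. cos (pi * x)"
  have pos: "0 < ?c a" "0 < ?c b" using a b by (auto intro: cos_pi_mult_pos)
  have dom: "pi * x \<in> {-(pi/2)..pi/2}" if "\<bar>x\<bar> < 1 / 2" for x
    using that mult_left_mono[of x "1/2" pi] mult_left_mono[of "-(1/2)" x pi] by auto
  have "?c a powr u * ?c b powr (1 - u) \<le> u * ?c a + (1 - u) * ?c b"
    using pos u by (intro powr_mult_powr_le) auto
  also have "\<dots> \<le> cos (u * (pi * a) + (1 - u) * (pi * b))"
    using concave_onD[OF cos_concave, of "1 - u" "pi * a" "pi * b"] dom[OF a] dom[OF b] u by simp
  also have "u * (pi * a) + (1 - u) * (pi * b) = pi * (u * a + (1 - u) * b)"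
    by (simp add: algebra_simps)
  finally have le: "(?c a powr u * ?c b powr (1 - u))\<^sup>2 \<le> (?c (u * a + (1 - u) * b))\<^sup>2"
    by (intro power_mono) auto
  have "(?c a powr u * ?c b powr (1 - u))\<^sup>2 = ((?c a)\<^sup>2) powr u * ((?c b)\<^sup>2) powr (1 - u)"
    using pos by (simp add: power2_eq_square powr_mult)
  moreover have "\<bar>u * a + (1 - u) * b\<bar> < 1 / 2"
    using seg unfolding greaterThanLessThan_iff abs_less_iff by linarith
  ultimately show ?thesis using a b le by (simp add: cos_bump_def)
qed

lemma gauss_log_concave:
  assumes u: "0 \<le> u" "u \<le> 1"
  shows "gauss a powr u * gauss b powr (1 - u) \<le> gauss (u * a + (1 - u) * b)"
proof -
  have "0 \<le> u * (1 - u) * (a - b)\<^sup>2" using u by simp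
  also have "\<dots> = (u * a\<^sup>2 + (1 - u) * b\<^sup>2) - (u * a + (1 - u) * b)\<^sup>2"
    by (simp add: power2_eq_square algebra_simps)
  finally have "4 * pi * (u * a + (1 - u) * b)\<^sup>2 \<le> 4 * pi * (u * a\<^sup>2 + (1 - u) * b\<^sup>2)"
    by (intro mult_left_mono) auto
  then have "exp (- (4 * pi * (u * a\<^sup>2 + (1 - u) * b\<^sup>2))) \<le> exp (- (4 * pi * (u * a + (1 - u) * b)\<^sup>2))"
    by simp
  moreover have "gauss a powr u * gauss b powr (1 - u) = exp (- (4 * pi * (u * a\<^sup>2 + (1 - u) * b\<^sup>2)))"
    by (simp add: gauss_def powr_def exp_add[symmetric] algebra_simps)
  ultimately show ?thesis by (simp add: gauss_def)
qed

lemma iter_nn_integral_gauss_le_cos_bump: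
  fixes v :: "nat \<Rightarrow> nat \<Rightarrow> real"
  shows "iter_nn_integral [0..<r] (\<lambda>y. ennreal (\<Prod>i<s. gauss (\<Sum>k<r. v i k * y k))) (\<lambda>_. 0)
    \<le> iter_nn_integral [0..<r] (\<lambda>y. ennreal (\<Prod>i<s. cos_bump (\<Sum>k<r. v i k * y k))) (\<lambda>_. 0)"
proof -
  \<comment> \<open>Hybrid products: bumps in the first \<open>m\<close> factors and Gaussians in
    the others, so that consecutive values of \<open>m\<close> differ in a single factor.\<close>
  define h where "h m i = (if i < m then cos_bump else gauss)" for m i :: nat
  define P where "P m = iter_nn_integral [0..<r]
      (\<lambda>y. ennreal (\<Prod>i<s. h m i (\<Sum>k<r. v i k * y k))) (\<lambda>_. 0)" for m
  have [measurable]: "h m i \<in> borel_measurable borel" for m i by (simp add: h_def)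
  have h: "0 \<le> h m i t" "h m i (- t) = h m i t" for m i t
    by (auto simp: h_def cos_bump_nonneg less_imp_le[OF gauss_pos]) (auto simp: cos_bump_def gauss_def)
  have lc: "log_concave_real (\<lambda>y. h m i (\<Sum>k<r. v i k * y k))" for m i
    using cos_bump_log_concave gauss_log_concave
    by (intro log_concave_real_ridge h) (auto simp: h_def)
  have step: "P m \<le> P (Suc m)" if m: "m < s" for m
  proof -
    define R where "R y = (\<Prod>i\<in>{..<s} - {m}. h m i (\<Sum>k<r. v i k * y k))" for y
    have [measurable]: "R \<in> borel_measurable borel" unfolding R_def by measurable
    have P0: "(\<Prod>i<s. h m i (\<Sum>k<r. v i k * y k)) = gauss (\<Sum>k<r. v m k * y k) * R y" for y
      using m by (subst prod.remove[of _ m]) (auto simp: R_def h_def)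
    have P1: "(\<Prod>i<s. h (Suc m) i (\<Sum>k<r. v i k * y k)) = cos_bump (\<Sum>k<r. v m k * y k) * R y" for y
    proof -
      have "(\<Prod>i\<in>{..<s} - {m}. h (Suc m) i (\<Sum>k<r. v i k * y k)) = R y"
        unfolding R_def by (intro prod.cong) (auto simp: h_def less_Suc_eq)
      then show ?thesis using m by (subst prod.remove[of _ m]) (auto simp: h_def)
    qed
    show ?thesis
    \<comment> \<open>A zero row contributes the factor 1 before and after the exchange, as both
      profiles equal 1 at 0. Any other row has a coordinate along which the shear is
      possible.\<close>
    proof (cases "\<exists>j<r. v m j \<noteq> 0")
      case False
      then have "(\<Sum>k<r. v m k * y k) = 0" for y by simp
      then show ?thesis unfolding P_def P0 P1 by (simp add: cos_bump_def gauss_def)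
    next
      case True
      then obtain j where j: "j < r" "v m j \<noteq> 0" by blast
      have split: "[0..<r] = [0..<j] @ j # [Suc j..<r]"
        using j(1) by (metis append_Cons append_Nil less_imp_le_nat upt_add_eq_append upt_conv_Cons zero_le le_add_diff_inverse)
      obtain a where a: "0 < a" "a < 1 / 2" "\<And>x. \<bar>x\<bar> \<le> a \<Longrightarrow> gauss x \<le> cos_bump x"
          "\<And>x. a \<le> \<bar>x\<bar> \<Longrightarrow> cos_bump x \<le> gauss x"
        using cos_gauss_single_crossing by blast
      have "iter_nn_integral (j # [0..<j] @ [Suc j..<r]) (\<lambda>y. ennreal (gauss (\<Sum>k<r. v m k * y k) * R y)) (\<lambda>_. 0)
        \<le> iter_nn_integral (j # [0..<j] @ [Suc j..<r]) (\<lambda>y. ennreal (cos_bump (\<Sum>k<r. v m k * y k) * R y)) (\<lambda>_. 0)"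
      proof (rule iter_nn_integral_ridge_mono[where a = a and f = cos_bump and g = gauss])
        show "log_concave_real R" unfolding R_def by (intro log_concave_real_prod lc)
        show "R (\<lambda>i. - x i) = R x" for x unfolding R_def by (simp add: sum_negf h)
        show "0 < cos_bump x" if "\<bar>x\<bar> < a" for x using that a by (intro cos_bump_pos) auto
      qed (use j a in \<open>auto simp: cos_bump_nonneg less_imp_le[OF gauss_pos] nn_integral_cos_bump nn_integral_gauss simp del: ennreal_half\<close>)
      then show ?thesis unfolding P_def P0 P1 split
        by (subst (1 2) iter_nn_integral_move_front) auto
    qed
  qed
  have "P 0 \<le> P m" if "m \<le> s" for m
    using that
  proof (induction m)
    case (Suc m)
    then show ?case using step[of m] by auto
  qed simp
  from this[of s] have "P 0 \<le> P s" by simp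
  then show ?thesis by (simp add: P_def h_def)
qed


subsection \<open>Gaussian integrals\<close>

definition schur_complement :: "nat \<Rightarrow> (nat \<Rightarrow> nat \<Rightarrow> real) \<Rightarrow> nat \<Rightarrow> nat \<Rightarrow> real" where
  "schur_complement r q i j = q i j - q i r * q r j / q r r"

definition quad_form :: "nat \<Rightarrow> (nat \<Rightarrow> nat \<Rightarrow> real) \<Rightarrow> (nat \<Rightarrow> real) \<Rightarrow> real" where
  "quad_form r q y = (\<Sum>i<r. \<Sum>j<r. q i j * y i * y j)"

lemma quad_form_Suc:
  assumes sym: "\<And>i j. q i j = q j i"
  shows "quad_form (Suc r) q y = q r r * (y r)\<^sup>2 + 2 * (\<Sum>i<r. q i r * y i) * y r + quad_form r q y"
proof -
  have "(\<Sum>j<r. q r j * y r * y j) = (\<Sum>i<r. q i r * y i * y r)"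
    by (intro sum.cong) (auto simp: sym[of r])
  moreover have "2 * (\<Sum>i<r. q i r * y i) * y r = (\<Sum>i<r. q i r * y i * y r) + (\<Sum>i<r. q i r * y i * y r)"
    by (simp add: sum_distrib_right)
  ultimately show ?thesis
    by (simp add: quad_form_def sum.distrib power2_eq_square)
qed

lemma quad_form_schur:
  assumes sym: "\<And>i j. q i j = q j i"
  shows "quad_form r (schur_complement r q) y = quad_form r q y - (\<Sum>i<r. q i r * y i)\<^sup>2 / q r r"
proof -
  have "(\<Sum>i<r. q i r * y i)\<^sup>2 / q r r = (\<Sum>i<r. \<Sum>j<r. (q i r * y i) * (q j r * y j) / q r r)"
    by (simp add: power2_eq_square sum_product sum_divide_distrib)
  also have "quad_form r q y - \<dots> = quad_form r (schur_complement r q) y"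
    unfolding quad_form_def sum_subtractf[symmetric] schur_complement_def
  proof (intro sum.cong refl)
    fix i j
    show "q i j * y i * y j - q i r * y i * (q j r * y j) / q r r
        = (q i j - q i r * q r j / q r r) * y i * y j"
      using sym[of r j] by (simp add: left_diff_distrib)
  qed
  finally show ?thesis ..
qed

text \<open>Right multiplication by a unipotent block matrix clears the last row up to its corner
  entry and leaves the Schur complement in the upper left block.\<close>

lemma det_schur_complement:
  fixes q :: "nat \<Rightarrow> nat \<Rightarrow> real"
  assumes "q r r \<noteq> 0"
  shows "det (mat (Suc r) (Suc r) (\<lambda>(i, j). q i j))
    = q r r * det (mat r r (\<lambda>(i, j). schur_complement r q i j))"
proof -
  let ?Q = "mat (Suc r) (Suc r) (\<lambda>(i, j). q i j)"
  let ?A = "mat r r (\<lambda>(i, j). q i j)" and ?B = "mat r 1 (\<lambda>(i, j). q i r)"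
  let ?C = "mat 1 r (\<lambda>(i, j). q r j)" and ?D = "mat 1 1 (\<lambda>(i, j). q r r)"
  let ?E = "mat 1 r (\<lambda>(i, j). - q r j / q r r)"
  let ?S = "mat r r (\<lambda>(i, j). schur_complement r q i j)"
  have Q: "?Q = four_block_mat ?A ?B ?C ?D"
    by (rule eq_matI) (auto simp: less_Suc_eq)
  have "?Q * four_block_mat (1\<^sub>m r) (0\<^sub>m r 1) ?E (1\<^sub>m 1)
    = four_block_mat (?A * 1\<^sub>m r + ?B * ?E) (?A * 0\<^sub>m r 1 + ?B * 1\<^sub>m 1)
      (?C * 1\<^sub>m r + ?D * ?E) (?C * 0\<^sub>m r 1 + ?D * 1\<^sub>m 1)"
    unfolding Q by (rule mult_four_block_mat) auto
  also have "?A * 1\<^sub>m r + ?B * ?E = ?S"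
    by (rule eq_matI) (auto simp: scalar_prod_def schur_complement_def)
  also have "?C * 1\<^sub>m r + ?D * ?E = 0\<^sub>m 1 r"
    using assms by (intro eq_matI) (auto simp: scalar_prod_def)
  finally have "det (?Q * four_block_mat (1\<^sub>m r) (0\<^sub>m r 1) ?E (1\<^sub>m 1)) = det ?S * det (?C * 0\<^sub>m r 1 + ?D * 1\<^sub>m 1)"
    by (simp only:) (rule det_four_block_mat_lower_left_zero, auto)
  also have "det (?C * 0\<^sub>m r 1 + ?D * 1\<^sub>m 1) = q r r"
    by (subst det_single) auto
  finally have "det (?Q * four_block_mat (1\<^sub>m r) (0\<^sub>m r 1) ?E (1\<^sub>m 1)) = det ?S * q r r" .
  moreover have "det (?Q * four_block_mat (1\<^sub>m r) (0\<^sub>m r 1) ?E (1\<^sub>m 1))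
      = det ?Q * det (four_block_mat (1\<^sub>m r) (0\<^sub>m r 1) ?E (1\<^sub>m 1))"
    by (rule det_mult[of _ "Suc r"]) auto
  moreover have "det (four_block_mat (1\<^sub>m r) (0\<^sub>m r 1) ?E (1\<^sub>m 1)) = 1"
    by (subst det_four_block_mat_upper_right_zero) auto
  ultimately show ?thesis by (simp add: mult.commute)
qed

text \<open>Integrating out the last variable leaves the Gaussian of the Schur complement in one
  variable less, and the pivot \<open>q r r\<close> splits off from the determinant in the same
  way.\<close>

lemma iter_nn_integral_gauss_quad_form:
  fixes q :: "nat \<Rightarrow> nat \<Rightarrow> real"
  assumes sym: "\<And>i j. q i j = q j i"
    and pd: "\<And>y. \<exists>i<r. y i \<noteq> 0 \<Longrightarrow> 0 < quad_form r q y"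
  shows "0 < det (mat r r (\<lambda>(i, j). q i j))"
    and "iter_nn_integral [0..<r] (\<lambda>y. ennreal (exp (- 4 * pi * quad_form r q y))) x
      = ennreal (1 / (2 ^ r * sqrt (det (mat r r (\<lambda>(i, j). q i j)))))"
  using assms
proof (induction r arbitrary: q)
  case 0
  {
    case 1
    show ?case by simp
  next
    case 2
    show ?case by (simp add: quad_form_def)
  }
next
  case (Suc r)
  have main: "0 < q r r \<and> (\<forall>i j. schur_complement r q i j = schur_complement r q j i) \<and>
      (\<forall>y. (\<exists>i<r. y i \<noteq> 0) \<longrightarrow> 0 < quad_form r (schur_complement r q) y)"
    if sym: "\<And>i j. q i j = q j i"
      and pd: "\<And>y. \<exists>i<Suc r. y i \<noteq> 0 \<Longrightarrow> 0 < quad_form (Suc r) q y" for q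
  proof (intro conjI allI impI)
    have "quad_form (Suc r) q (\<lambda>i. if i = r then 1 else 0) = q r r"
      by (simp add: quad_form_Suc[OF sym]) (simp add: quad_form_def)
    then show qrr: "0 < q r r" using pd[of "\<lambda>i. if i = r then 1 else 0"] by auto
    show "schur_complement r q i j = schur_complement r q j i" for i j
      unfolding schur_complement_def using sym[of i j] sym[of r i] sym[of r j] by simp
    fix y :: "nat \<Rightarrow> real" assume y: "\<exists>i<r. y i \<noteq> 0"
    let ?b = "\<Sum>i<r. q i r * y i"
    \<comment> \<open>The last coordinate that minimises the form for given \<open>y\<close>. The
      minimum is the form of the Schur complement, which therefore inherits positivity.\<close>
    let ?z = "y(r := - ?b / q r r)"
    have "(\<Sum>i<r. q i r * ?z i) = ?b" "quad_form r q ?z = quad_form r q y"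
      by (auto simp: quad_form_def intro!: sum.cong)
    then have "quad_form (Suc r) q ?z = quad_form r (schur_complement r q) y"
      unfolding quad_form_Suc[OF sym] quad_form_schur[OF sym]
      using qrr by (simp add: field_simps power2_eq_square)
    moreover have "0 < quad_form (Suc r) q ?z"
    proof -
      obtain i where "i < r" "y i \<noteq> 0" using y by blast
      then show ?thesis by (intro pd exI[of _ i]) auto
    qed
    ultimately show "0 < quad_form r (schur_complement r q) y" by simp
  qed
  {
    case 1
    note m = main[OF this]
    from m have "0 < det (mat r r (\<lambda>(i, j). schur_complement r q i j))"
      by (intro Suc.IH(1)) auto
    then show ?case using m by (subst det_schur_complement) auto
  next
    case 2
    note m = main[OF this]
    let ?d = "det (mat r r (\<lambda>(i, j). schur_complement r q i j))"
    have inner: "(\<integral>\<^sup>+t. ennreal (exp (- 4 * pi * quad_form (Suc r) q (y(r := t)))) \<partial>lborel)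
        = ennreal (1 / (2 * sqrt (q r r))) * ennreal (exp (- 4 * pi * quad_form r (schur_complement r q) y))" for y
    proof -
      have e: "(\<Sum>i<r. q i r * (y(r := t)) i) = (\<Sum>i<r. q i r * y i)" "quad_form r q (y(r := t)) = quad_form r q y" for t
        by (auto simp: quad_form_def intro!: sum.cong)
      show ?thesis
        unfolding quad_form_Suc[OF 2(1)] quad_form_schur[OF 2(1)] e fun_upd_same
        using m by (intro nn_integral_gauss_quadratic) auto
    qed
    have "iter_nn_integral [0..<Suc r] (\<lambda>y. ennreal (exp (- 4 * pi * quad_form (Suc r) q y))) x
        = ennreal (1 / (2 * sqrt (q r r))) *
          iter_nn_integral [0..<r] (\<lambda>y. ennreal (exp (- 4 * pi * quad_form r (schur_complement r q) y))) x"
      unfolding upt_Suc_append[OF le0] iter_nn_integral_snoc inner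
      by (rule iter_nn_integral_cmult) (simp add: quad_form_def)
    also have "iter_nn_integral [0..<r] (\<lambda>y. ennreal (exp (- 4 * pi * quad_form r (schur_complement r q) y))) x
        = ennreal (1 / (2 ^ r * sqrt ?d))"
      using m by (intro Suc.IH(2)) auto
    also have "ennreal (1 / (2 * sqrt (q r r))) * ennreal (1 / (2 ^ r * sqrt ?d))
        = ennreal (1 / (2 ^ Suc r * sqrt (q r r * ?d)))"
      using m by (subst ennreal_mult'[symmetric]) (auto simp: real_sqrt_mult mult_ac)
    also have "q r r * ?d = det (mat (Suc r) (Suc r) (\<lambda>(i, j). q i j))"
      using m by (subst det_schur_complement) auto
    finally show ?case .
  }
qed

text \<open>The exponents add up to the sum of the squares of the linear forms, whose matrix is the
  Gram matrix of the columns of \<open>v\<close>; independence of the columns is its positive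
  definiteness.\<close>

lemma iter_nn_integral_prod_gauss:
  fixes v :: "nat \<Rightarrow> nat \<Rightarrow> real"
  assumes indep: "\<And>y. (\<And>i. i < s \<Longrightarrow> (\<Sum>k<r. v i k * y k) = 0) \<Longrightarrow> \<forall>k<r. y k = 0"
  shows "0 < det (mat r r (\<lambda>(k, l). \<Sum>i<s. v i k * v i l))"
    and "iter_nn_integral [0..<r] (\<lambda>y. ennreal (\<Prod>i<s. gauss (\<Sum>k<r. v i k * y k))) x
      = ennreal (1 / (2 ^ r * sqrt (det (mat r r (\<lambda>(k, l). \<Sum>i<s. v i k * v i l)))))"
proof -
  define q where "q k l = (\<Sum>i<s. v i k * v i l)" for k l
  have sym: "q k l = q l k" for k l by (simp add: q_def mult.commute)
  have qf: "quad_form r q y = (\<Sum>i<s. (\<Sum>k<r. v i k * y k)\<^sup>2)" for y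
  proof -
    have "quad_form r q y = (\<Sum>k<r. \<Sum>l<r. \<Sum>i<s. (v i k * y k) * (v i l * y l))"
      unfolding quad_form_def q_def sum_distrib_right by (intro sum.cong refl) (simp add: mult_ac)
    also have "\<dots> = (\<Sum>k<r. \<Sum>i<s. \<Sum>l<r. (v i k * y k) * (v i l * y l))"
      by (intro sum.cong refl sum.swap)
    also have "\<dots> = (\<Sum>i<s. \<Sum>k<r. \<Sum>l<r. (v i k * y k) * (v i l * y l))"
      by (rule sum.swap)
    finally show ?thesis by (simp add: power2_eq_square sum_product)
  qed
  have pd: "0 < quad_form r q y" if nz: "\<exists>k<r. y k \<noteq> 0" for y
  proof -
    obtain i where i: "i < s" "(\<Sum>k<r. v i k * y k) \<noteq> 0" using indep[of y] nz by blast
    then have "0 < (\<Sum>k<r. v i k * y k)\<^sup>2" by simp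
    also have "\<dots> \<le> (\<Sum>i<s. (\<Sum>k<r. v i k * y k)\<^sup>2)"
      using i by (intro member_le_sum) auto
    finally show ?thesis by (simp add: qf)
  qed
  have g: "(\<Prod>i<s. gauss (\<Sum>k<r. v i k * y k)) = exp (- 4 * pi * quad_form r q y)" for y
    unfolding qf gauss_def by (simp add: exp_sum[symmetric] sum_distrib_left sum_negf)
  show "0 < det (mat r r (\<lambda>(k, l). \<Sum>i<s. v i k * v i l))"
    using iter_nn_integral_gauss_quad_form(1)[OF sym pd] unfolding q_def .
  show "iter_nn_integral [0..<r] (\<lambda>y. ennreal (\<Prod>i<s. gauss (\<Sum>k<r. v i k * y k))) x
      = ennreal (1 / (2 ^ r * sqrt (det (mat r r (\<lambda>(k, l). \<Sum>i<s. v i k * v i l)))))"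
    unfolding g using iter_nn_integral_gauss_quad_form(2)[OF sym pd] unfolding q_def .
qed


subsection \<open>Integrals over the torus\<close>

text \<open>Half-open, so that the integer translates tile the space without overlap. As a weight it
  turns an iterated integral into one over the torus.\<close>

definition unit_box :: "nat list \<Rightarrow> (nat \<Rightarrow> real) \<Rightarrow> ennreal" where
  "unit_box js y = (\<Prod>j\<leftarrow>js. indicator {0..<1} (y j))"

text \<open>The sum over all translates by integer vectors supported on \<open>js\<close>.\<close>

fun lattice_sum :: "nat list \<Rightarrow> ((nat \<Rightarrow> real) \<Rightarrow> ennreal) \<Rightarrow> (nat \<Rightarrow> real) \<Rightarrow> ennreal" where
  "lattice_sum [] F y = F y"
| "lattice_sum (j # js) F y = (\<Sum>n. lattice_sum js F (y(j := y j + of_int (int_decode n))))"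

lemma measurable_unit_box [measurable]: "unit_box js \<in> borel_measurable borel"
proof -
  have "(\<lambda>y. unit_box js y) \<in> borel_measurable borel"
    by (induction js) (simp_all add: unit_box_def)
  then show ?thesis by simp
qed

lemma measurable_lattice_sum [measurable]:
  assumes [measurable]: "F \<in> borel_measurable borel"
  shows "lattice_sum js F \<in> borel_measurable borel"
proof -
  have "(\<lambda>y. lattice_sum js F y) \<in> borel_measurable borel"
  proof (induction js)
    case (Cons j js)
    note [measurable] = Cons
    show ?case by simp
  qed simp
  then show ?thesis by simp
qed

lemma measurable_iter_nn_integral_fun_upd:
  assumes [measurable]: "F \<in> borel_measurable borel"
  shows "(\<lambda>t. iter_nn_integral js F (x(j := t))) \<in> borel_measurable borel"
  by measurable

lemma iter_nn_integral_suminf: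
  assumes [measurable]: "\<And>n. F n \<in> borel_measurable borel"
  shows "iter_nn_integral js (\<lambda>y. \<Sum>n. F n y) x = (\<Sum>n. iter_nn_integral js (F n) x)"
proof (induction js arbitrary: x)
  case (Cons j js)
  show ?case unfolding iter_nn_integral.simps Cons 
    by (rule nn_integral_suminf) (simp add: measurable_iter_nn_integral_fun_upd assms)
qed simp

text \<open>The line is cut at the integers and every piece is translated back to the unit interval.
  \<open>int_decode\<close> enumerates the integers because series run over natural numbers.\<close>

lemma nn_integral_unfold_int:
  fixes f :: "real \<Rightarrow> ennreal"
  assumes [measurable]: "f \<in> borel_measurable borel"
  shows "(\<integral>\<^sup>+t. f t \<partial>lborel)
    = (\<integral>\<^sup>+t. indicator {0..<1} t * (\<Sum>n. f (t + of_int (int_decode n))) \<partial>lborel)"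
proof -
  let ?z = "\<lambda>n. of_int (int_decode n) :: real"
  have "f t = (\<Sum>n. f t * indicator {?z n..<?z n + 1} t)" for t
  proof -
    let ?m = "int_encode \<lfloor>t\<rfloor>"
    have "(\<Sum>n. f t * indicator {?z n..<?z n + 1} t) = (\<Sum>n\<in>{?m}. f t * indicator {?z n..<?z n + 1} t)"
    proof (rule suminf_finite)
      fix n assume "n \<notin> {?m}"
      then have "int_decode n \<noteq> \<lfloor>t\<rfloor>" by (metis int_decode_inverse singletonI)
      then have "t \<notin> {?z n..<?z n + 1}" by (auto simp: floor_unique)
      then show "f t * indicator {?z n..<?z n + 1} t = 0" by simp
    qed simp
    then show ?thesis by (simp add: indicator_def)
  qed
  then have "(\<integral>\<^sup>+t. f t \<partial>lborel) = (\<integral>\<^sup>+t. (\<Sum>n. f t * indicator {?z n..<?z n + 1} t) \<partial>lborel)"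
    by (intro nn_integral_cong) blast
  also have "\<dots> = (\<Sum>n. \<integral>\<^sup>+t. f t * indicator {?z n..<?z n + 1} t \<partial>lborel)"
    by (rule nn_integral_suminf) simp
  also have "\<dots> = (\<Sum>n. \<integral>\<^sup>+t. indicator {0..<1} t * f (t + ?z n) \<partial>lborel)"
  proof (rule suminf_cong)
    fix n
    have "(\<integral>\<^sup>+t. f t * indicator {?z n..<?z n + 1} t \<partial>lborel)
        = ennreal \<bar>1\<bar> * (\<integral>\<^sup>+t. f (?z n + 1 * t) * indicator {?z n..<?z n + 1} (?z n + 1 * t) \<partial>lborel)"
      by (rule nn_integral_real_affine) simp_all
    also have "\<dots> = (\<integral>\<^sup>+t. indicator {0..<1} t * f (t + ?z n) \<partial>lborel)"
      by (simp, intro nn_integral_cong) (auto simp: indicator_def add.commute)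
    finally show "(\<integral>\<^sup>+t. f t * indicator {?z n..<?z n + 1} t \<partial>lborel)
        = (\<integral>\<^sup>+t. indicator {0..<1} t * f (t + ?z n) \<partial>lborel)" .
  qed
  also have "\<dots> = (\<integral>\<^sup>+t. (\<Sum>n. indicator {0..<1} t * f (t + ?z n)) \<partial>lborel)"
    by (rule nn_integral_suminf[symmetric]) simp
  finally show ?thesis by simp
qed

lemma unit_box_Cons: "unit_box (j # js) y = indicator {0..<1} (y j) * unit_box js y"
  by (simp add: unit_box_def)

lemma unit_box_fun_upd: "j \<notin> set js \<Longrightarrow> unit_box js (y(j := t)) = unit_box js y"
  unfolding unit_box_def by (intro arg_cong[where f = prod_list] map_cong) auto

text \<open>Unfolding coordinate by coordinate: an integral over the whole space is the integral of
  the periodisation over the unit cube.\<close>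

lemma iter_nn_integral_unfold:
  assumes F [measurable]: "F \<in> borel_measurable borel" and "distinct js"
  shows "iter_nn_integral js F x = iter_nn_integral js (\<lambda>y. unit_box js y * lattice_sum js F y) x"
  using assms(2)
proof (induction js arbitrary: x)
  case Nil
  show ?case by (simp add: unit_box_def)
next
  case (Cons j js)
  then have j: "j \<notin> set js" and IH: "\<And>x. iter_nn_integral js F x
      = iter_nn_integral js (\<lambda>y. unit_box js y * lattice_sum js F y) x" by auto
  let ?z = "\<lambda>n. of_int (int_decode n) :: real"
  have "iter_nn_integral (j # js) F x
      = (\<integral>\<^sup>+t. indicator {0..<1} t * (\<Sum>n. iter_nn_integral js F (x(j := t + ?z n))) \<partial>lborel)"
    unfolding iter_nn_integral.simps by (rule nn_integral_unfold_int) simp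
  also have "\<dots> = (\<integral>\<^sup>+t. iter_nn_integral js (\<lambda>y. unit_box (j # js) y * lattice_sum (j # js) F y) (x(j := t)) \<partial>lborel)"
  proof (intro nn_integral_cong)
    fix t
    have "iter_nn_integral js (\<lambda>y. unit_box (j # js) y * lattice_sum (j # js) F y) (x(j := t))
        = iter_nn_integral js (\<lambda>y. unit_box (j # js) (y(j := t)) * lattice_sum (j # js) F (y(j := t))) x"
      by (rule iter_nn_integral_fun_upd_swap[OF j])
    also have "\<dots> = iter_nn_integral js (\<lambda>y. indicator {0..<1} t *
        (\<Sum>n. unit_box js y * lattice_sum js F (y(j := t + ?z n)))) x"
      using j by (intro iter_nn_integral_cong) (simp add: unit_box_Cons unit_box_fun_upd mult.assoc)
    also have "\<dots> = indicator {0..<1} t *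
        iter_nn_integral js (\<lambda>y. \<Sum>n. unit_box js y * lattice_sum js F (y(j := t + ?z n))) x"
      by (rule iter_nn_integral_cmult) simp
    also have "iter_nn_integral js (\<lambda>y. \<Sum>n. unit_box js y * lattice_sum js F (y(j := t + ?z n))) x
        = (\<Sum>n. iter_nn_integral js (\<lambda>y. unit_box js y * lattice_sum js F (y(j := t + ?z n))) x)"
      by (rule iter_nn_integral_suminf) simp
    also have "\<dots> = (\<Sum>n. iter_nn_integral js F (x(j := t + ?z n)))"
    proof -
      have "iter_nn_integral js F (x(j := c)) = iter_nn_integral js
          (\<lambda>y. unit_box js y * lattice_sum js F (y(j := c))) x" for c
        using iter_nn_integral_fun_upd_swap[OF j, of "\<lambda>y. unit_box js y * lattice_sum js F y"]
        unfolding IH[of "x(j := c)"] unit_box_fun_upd[OF j] .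
      then show ?thesis by simp
    qed
    finally show "indicator {0..<1} t * (\<Sum>n. iter_nn_integral js F (x(j := t + ?z n)))
        = iter_nn_integral js (\<lambda>y. unit_box (j # js) y * lattice_sum (j # js) F y) (x(j := t))" ..
  qed
  finally show ?case unfolding iter_nn_integral.simps .
qed

lemma lattice_sum_pos_imp:
  assumes "lattice_sum js F y \<noteq> 0"
  obtains z :: "nat \<Rightarrow> int" where "F (\<lambda>i. y i + of_int (z i)) \<noteq> 0" "\<And>i. i \<notin> set js \<Longrightarrow> z i = 0"
  using assms
proof (induction js arbitrary: y thesis)
  case Nil
  show ?case by (rule Nil(1)[of "\<lambda>_. 0"]) (use Nil(2) in auto)
next
  case (Cons j js)
  have "\<exists>n. lattice_sum js F (y(j := y j + of_int (int_decode n))) \<noteq> 0"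
  proof (rule ccontr)
    assume "\<nexists>n. lattice_sum js F (y(j := y j + of_int (int_decode n))) \<noteq> 0"
    then show False using Cons.prems(2) by simp
  qed
  then obtain n where n: "lattice_sum js F (y(j := y j + of_int (int_decode n))) \<noteq> 0" ..
  obtain z where z: "F (\<lambda>i. (y(j := y j + of_int (int_decode n))) i + of_int (z i)) \<noteq> 0"
      "\<And>i. i \<notin> set js \<Longrightarrow> z i = 0"
    using Cons.IH[OF _ n] by blast
  have "(\<lambda>i. (y(j := y j + of_int (int_decode n))) i + of_int (z i))
      = (\<lambda>i. y i + of_int ((z(j := z j + int_decode n)) i))" by auto
  with z(1) have "F (\<lambda>i. y i + of_int ((z(j := z j + int_decode n)) i)) \<noteq> 0" by metis
  then show ?case by (rule Cons.prems(1)) (use z(2) in auto)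
qed

text \<open>At each coordinate \<open>inj\<close> leaves at most one index with a nonzero inner sum,
  so the series collapses to a single term, which is bounded by induction.\<close>

lemma lattice_sum_le:
  assumes le: "\<And>z :: nat \<Rightarrow> int. F (\<lambda>i. y i + of_int (z i)) \<le> C"
    and inj: "\<And>(z :: nat \<Rightarrow> int) z'. F (\<lambda>i. y i + of_int (z i)) \<noteq> 0 \<Longrightarrow> F (\<lambda>i. y i + of_int (z' i)) \<noteq> 0
      \<Longrightarrow> (\<And>i. i \<notin> set js \<Longrightarrow> z i = 0 \<and> z' i = 0) \<Longrightarrow> z = z'"
    and "distinct js"
  shows "lattice_sum js F y \<le> C"
  using assms
proof (induction js arbitrary: y)
  case Nil
  then show ?case using Nil(1)[of "\<lambda>_. 0"] by simp
next
  case (Cons j js)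
  let ?y = "\<lambda>n. y(j := y j + of_int (int_decode n))"
  have shift: "(\<lambda>i. ?y n i + of_int (z i)) = (\<lambda>i. y i + of_int ((z(j := z j + int_decode n)) i))"
    for n and z :: "nat \<Rightarrow> int" by auto
  have each: "lattice_sum js F (?y n) \<le> C" for n
  proof (rule Cons.IH)
    show "F (\<lambda>i. ?y n i + of_int (z i)) \<le> C" for z :: "nat \<Rightarrow> int"
      unfolding shift by (rule Cons.prems(1))
    show "z = z'" if z: "F (\<lambda>i. ?y n i + of_int (z i)) \<noteq> 0" "F (\<lambda>i. ?y n i + of_int (z' i)) \<noteq> 0"
      and 0: "\<And>i. i \<notin> set js \<Longrightarrow> z i = 0 \<and> z' i = 0" for z z' :: "nat \<Rightarrow> int"
    proof -
      have "z(j := z j + int_decode n) = z'(j := z' j + int_decode n)"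
        using z unfolding shift by (rule Cons.prems(2)) (use 0 in auto)
      then have "z i = z' i" for i by (cases "i = j") (metis add_right_cancel fun_upd_apply)+
      then show ?thesis by auto
    qed
  qed (use Cons.prems(3) in auto)
  have one: "m = n" if mn: "lattice_sum js F (?y m) \<noteq> 0" "lattice_sum js F (?y n) \<noteq> 0" for m n
  proof -
    obtain z where z: "F (\<lambda>i. ?y m i + of_int (z i)) \<noteq> 0" "\<And>i. i \<notin> set js \<Longrightarrow> z i = 0"
      using lattice_sum_pos_imp[OF mn(1)] by blast
    obtain z' where z': "F (\<lambda>i. ?y n i + of_int (z' i)) \<noteq> 0" "\<And>i. i \<notin> set js \<Longrightarrow> z' i = 0"
      using lattice_sum_pos_imp[OF mn(2)] by blast
    have "z(j := z j + int_decode m) = z'(j := z' j + int_decode n)"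
      using z(1) z'(1) unfolding shift by (rule Cons.prems(2)) (use z z' in auto)
    then have "z j + int_decode m = z' j + int_decode n" by (metis fun_upd_same)
    moreover have "z j = 0" "z' j = 0" using z(2) z'(2) Cons.prems(3) by auto
    ultimately have "int_decode m = int_decode n" by simp
    then show "m = n" by (metis int_decode_inverse)
  qed
  show ?case
  proof (cases "\<exists>n. lattice_sum js F (?y n) \<noteq> 0")
    case True
    then obtain n where n: "lattice_sum js F (?y n) \<noteq> 0" ..
    have "lattice_sum (j # js) F y = (\<Sum>m\<in>{n}. lattice_sum js F (?y m))"
      unfolding lattice_sum.simps by (rule suminf_finite) (use one n in auto)
    then show ?thesis using each by simp
  qed simp
qed

text \<open>At a point of the torus at most one translate of \<open>F\<close> is nonzero, and it is
  at most the value of the periodic \<open>G\<close> there. Two translates are compared by taking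
  the first of them as the base point of \<open>inj\<close>.\<close>

lemma iter_nn_integral_packing:
  assumes F [measurable]: "F \<in> borel_measurable borel" and js: "distinct js"
    and le: "\<And>y. F y \<le> G y" and per: "\<And>y (z :: nat \<Rightarrow> int). G (\<lambda>i. y i + of_int (z i)) = G y"
    and inj: "\<And>y (z :: nat \<Rightarrow> int). F y \<noteq> 0 \<Longrightarrow> F (\<lambda>i. y i + of_int (z i)) \<noteq> 0
      \<Longrightarrow> (\<And>i. i \<notin> set js \<Longrightarrow> z i = 0) \<Longrightarrow> z = (\<lambda>_. 0)"
  shows "iter_nn_integral js F x \<le> iter_nn_integral js (\<lambda>y. unit_box js y * G y) x"
proof -
  have "lattice_sum js F y \<le> G y" for y
  proof (rule lattice_sum_le[OF _ _ js])
    show "F (\<lambda>i. y i + of_int (z i)) \<le> G y" for z :: "nat \<Rightarrow> int"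
      using le[of "\<lambda>i. y i + of_int (z i)"] by (simp add: per)
    fix z z' :: "nat \<Rightarrow> int"
    assume F: "F (\<lambda>i. y i + of_int (z i)) \<noteq> 0" "F (\<lambda>i. y i + of_int (z' i)) \<noteq> 0"
      and 0: "\<And>i. i \<notin> set js \<Longrightarrow> z i = 0 \<and> z' i = 0"
    have "(\<lambda>i. z' i - z i) = (\<lambda>_. 0)"
    proof (rule inj[OF F(1)])
      have "(\<lambda>i. y i + of_int (z i) + of_int (z' i - z i)) = (\<lambda>i. y i + of_int (z' i) :: real)" by auto
      then show "F (\<lambda>i. y i + of_int (z i) + of_int (z' i - z i)) \<noteq> 0" using F(2) by metis
    qed (use 0 in auto)
    then have "z' i - z i = 0" for i by meson
    then show "z = z'" by auto
  qed
  then show ?thesis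
    unfolding iter_nn_integral_unfold[OF F js] by (intro iter_nn_integral_mono mult_left_mono) auto
qed


section \<open>Fourier expansion of products of cosines\<close>

lemma cis_prod: "(\<Prod>i\<in>I. cis (f i)) = cis (\<Sum>i\<in>I. f i)"
  by (induction I rule: infinite_finite_induct) (simp_all add: cis_mult)

text \<open>Each factor is \<open>1 + (cis a + cis (- a)) / 2\<close>, a sum over the three
  frequencies -1, 0, 1. The product is multiplied out over the complex numbers, where frequencies
  add, and the real part is taken.\<close>

lemma prod_one_plus_cos:
  fixes a :: "'i \<Rightarrow> real"
  assumes "finite I"
  shows "(\<Prod>i\<in>I. 1 + cos (a i)) = (\<Sum>e\<in>PiE I (\<lambda>_. {-1, 0, 1 :: int}).
    (\<Prod>i\<in>I. if e i = 0 then 1 else 1 / 2) * cos (\<Sum>i\<in>I. of_int (e i) * a i))"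
proof -
  let ?c = "\<lambda>e :: int. if e = 0 then 1 else 1 / 2 :: real"
  have "complex_of_real (\<Prod>i\<in>I. 1 + cos (a i))
      = (\<Prod>i\<in>I. \<Sum>e\<in>{-1, 0, 1 :: int}. of_real (?c e) * cis (of_int e * a i))"
    unfolding of_real_prod by (intro prod.cong refl) (simp add: complex_eq_iff)
  also have "\<dots> = (\<Sum>e\<in>PiE I (\<lambda>_. {-1, 0, 1 :: int}). \<Prod>i\<in>I. of_real (?c (e i)) * cis (of_int (e i) * a i))"
    by (rule prod_sum_PiE) (use assms in auto)
  also have "\<dots> = (\<Sum>e\<in>PiE I (\<lambda>_. {-1, 0, 1 :: int}).
      of_real (\<Prod>i\<in>I. ?c (e i)) * cis (\<Sum>i\<in>I. of_int (e i) * a i))"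
    by (simp add: prod.distrib cis_prod)
  finally have "Re (complex_of_real (\<Prod>i\<in>I. 1 + cos (a i))) = Re (\<Sum>e\<in>PiE I (\<lambda>_. {-1, 0, 1 :: int}).
      of_real (\<Prod>i\<in>I. ?c (e i)) * cis (\<Sum>i\<in>I. of_int (e i) * a i))" by (rule arg_cong)
  then show ?thesis by (simp del: of_real_prod)
qed

text \<open>A nonzero integer frequency runs through full periods, so the cosine contributes
  nothing; the added 1 keeps the integrand nonnegative. The phase \<open>c\<close> stands for the
  other coordinates.\<close>

lemma nn_integral_one_plus_cos:
  fixes u :: int
  assumes "u \<noteq> 0"
  shows "(\<integral>\<^sup>+t. indicator {0..<1} t * ennreal (1 + cos (2 * pi * (of_int u * t + c))) \<partial>lborel) = 1"
proof -
  have "(\<integral>\<^sup>+t. indicator {0..<1} t * ennreal (1 + cos (2 * pi * (of_int u * t + c))) \<partial>lborel)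
      = (\<integral>\<^sup>+t. ennreal (1 + cos (2 * pi * (of_int u * t + c))) * indicator {0..1} t \<partial>lborel)"
  proof (rule nn_integral_cong_AE)
    show "AE t in lborel. indicator {0..<1} t * ennreal (1 + cos (2 * pi * (of_int u * t + c)))
        = ennreal (1 + cos (2 * pi * (of_int u * t + c))) * indicator {0..1} t"
      using AE_lborel_singleton[of 1] by eventually_elim (auto simp: indicator_def)
  qed
  also have "\<dots> = ennreal ((1 + sin (2 * pi * (of_int u * 1 + c)) / (2 * pi * of_int u))
      - (0 + sin (2 * pi * (of_int u * 0 + c)) / (2 * pi * of_int u)))"
  proof (rule nn_integral_FTC_Icc)
    fix x :: real
    show "((\<lambda>t. t + sin (2 * pi * (of_int u * t + c)) / (2 * pi * of_int u))
        has_real_derivative 1 + cos (2 * pi * (of_int u * x + c))) (at x)"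
    proof -
      have "((\<lambda>t. 2 * pi * (of_int u * t + c)) has_real_derivative 2 * pi * of_int u) (at x)"
        by (auto intro!: derivative_eq_intros)
      from DERIV_add[OF DERIV_ident DERIV_cdivide[OF DERIV_chain2[OF DERIV_sin this], of "2 * pi * of_int u"]]
      show ?thesis using assms by simp
    qed
    show "0 \<le> 1 + cos (2 * pi * (of_int u * x + c))"
      using cos_ge_minus_one[of "2 * pi * (of_int u * x + c)"] by linarith
  qed auto
  also have "sin (2 * pi * (of_int u * 1 + c)) = sin (2 * pi * (of_int u * 0 + c))"
  proof -
    have "2 * pi * (of_int u * 1 + c) = 2 * pi * c + 2 * pi * of_int u" by (simp add: algebra_simps)
    then show ?thesis by (simp add: sin_add)
  qed
  finally show ?thesis by simp
qed

lemma iter_nn_integral_unit_box: "iter_nn_integral js (unit_box js) x = 1" if "distinct js"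
  using that
proof (induction js arbitrary: x)
  case (Cons j js)
  have "iter_nn_integral js (unit_box (j # js)) (x(j := t)) = indicator {0..<1} t" for t
  proof -
    have "iter_nn_integral js (unit_box (j # js)) (x(j := t))
        = iter_nn_integral js (\<lambda>y. unit_box (j # js) (y(j := t))) x"
      using Cons.prems by (intro iter_nn_integral_fun_upd_swap) auto
    also have "\<dots> = iter_nn_integral js (\<lambda>y. indicator {0..<1} t * unit_box js y) x"
      using Cons.prems by (simp add: unit_box_Cons unit_box_fun_upd)
    also have "\<dots> = indicator {0..<1} t"
      using Cons by (simp add: iter_nn_integral_cmult)
    finally show ?thesis .
  qed
  then show ?case by simp
qed (simp add: unit_box_def)

lemma unit_box_move_front: "unit_box (js @ j # ks) = unit_box (j # js @ ks)"
  unfolding unit_box_def map_append list.map prod_list.append prod_list.Cons append_Cons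
  by (intro ext) (rule mult.left_commute)

text \<open>A coordinate with nonzero frequency is integrated innermost, where the others only shift
  the phase.\<close>

lemma iter_nn_integral_one_plus_cos:
  fixes u :: "nat \<Rightarrow> int"
  assumes "\<exists>k<r. u k \<noteq> 0"
  shows "iter_nn_integral [0..<r] (\<lambda>y. unit_box [0..<r] y * ennreal (1 + cos (2 * pi * (\<Sum>k<r. of_int (u k) * y k)))) x = 1"
proof -
  obtain j where j: "j < r" "u j \<noteq> 0" using assms by blast
  define ks where "ks = [0..<j] @ [Suc j..<r]"
  have split: "[0..<r] = [0..<j] @ j # [Suc j..<r]"
    using j(1) by (metis append_Cons append_Nil less_imp_le_nat upt_add_eq_append upt_conv_Cons zero_le le_add_diff_inverse)
  have ks: "j \<notin> set ks" "distinct ks" by (auto simp: ks_def)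
  let ?F = "\<lambda>y. ennreal (1 + cos (2 * pi * (\<Sum>k<r. of_int (u k) * y k)))"
  have "iter_nn_integral [0..<r] (\<lambda>y. unit_box [0..<r] y * ?F y) x
      = iter_nn_integral (j # ks) (\<lambda>y. unit_box (j # ks) y * ?F y) x"
    unfolding split unit_box_move_front ks_def by (rule iter_nn_integral_move_front) auto
  also have "\<dots> = iter_nn_integral (ks @ [j]) (\<lambda>y. unit_box (j # ks) y * ?F y) x"
    using ks by (intro iter_nn_integral_Cons_eq_snoc) simp
  also have "\<dots> = iter_nn_integral ks (unit_box ks) x"
    unfolding iter_nn_integral_snoc
  proof (rule iter_nn_integral_cong)
    fix y :: "nat \<Rightarrow> real"
    let ?c = "\<Sum>k\<in>{..<r} - {j}. of_int (u k) * y k"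
    have s: "(\<Sum>k<r. of_int (u k) * (y(j := t)) k) = of_int (u j) * t + ?c" for t
      using j(1) by (subst sum.remove[of _ j]) (auto intro!: sum.cong)
    have "(\<integral>\<^sup>+t. unit_box (j # ks) (y(j := t)) * ?F (y(j := t)) \<partial>lborel)
        = (\<integral>\<^sup>+t. unit_box ks y * (indicator {0..<1} t * ennreal (1 + cos (2 * pi * (of_int (u j) * t + ?c)))) \<partial>lborel)"
      unfolding s using ks by (intro nn_integral_cong) (simp add: unit_box_Cons unit_box_fun_upd mult_ac)
    also have "\<dots> = unit_box ks y"
      using nn_integral_one_plus_cos[OF j(2)] by (simp add: nn_integral_cmult)
    finally show "(\<integral>\<^sup>+t. unit_box (j # ks) (y(j := t)) * ?F (y(j := t)) \<partial>lborel) = unit_box ks y" .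
  qed
  also have "\<dots> = 1" by (rule iter_nn_integral_unit_box[OF ks(2)])
  finally show ?thesis .
qed

lemma iter_nn_integral_add:
  assumes [measurable]: "F \<in> borel_measurable borel" "G \<in> borel_measurable borel"
  shows "iter_nn_integral js (\<lambda>y. F y + G y) x = iter_nn_integral js F x + iter_nn_integral js G x"
  by (induction js arbitrary: x)
    (simp_all add: nn_integral_add measurable_iter_nn_integral_fun_upd)

lemma iter_nn_integral_sum:
  assumes F: "\<And>i. i \<in> I \<Longrightarrow> F i \<in> borel_measurable borel"
  shows "iter_nn_integral js (\<lambda>y. \<Sum>i\<in>I. F i y) x = (\<Sum>i\<in>I. iter_nn_integral js (F i) x)"
  using F
proof (induction I rule: infinite_finite_induct)
  case (insert i I)
  then show ?case by (simp add: iter_nn_integral_add)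
next
  case empty
  show ?case using iter_nn_integral_cmult[of "\<lambda>_. 0" js 0 x] by simp
next
  case (infinite I)
  then show ?case using iter_nn_integral_cmult[of "\<lambda>_. 0" js 0 x] by simp
qed

text \<open>By \<open>norel\<close> the zero pattern \<open>z\<close> is the only one with zero
  frequency, so all other terms of the expansion average out. The halves from the double angle
  formula remain.\<close>

lemma iter_nn_integral_prod_cos_squared:
  fixes V :: "'i \<Rightarrow> nat \<Rightarrow> int"
  assumes I: "finite I"
    and norel: "\<And>e. e \<in> PiE I (\<lambda>_. {-1, 0, 1}) \<Longrightarrow> \<exists>i\<in>I. e i \<noteq> 0 \<Longrightarrow> \<exists>k<r. (\<Sum>i\<in>I. e i * V i k) \<noteq> 0"
  shows "iter_nn_integral [0..<r] (\<lambda>y. unit_box [0..<r] y *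
      ennreal (\<Prod>i\<in>I. (cos (pi * (\<Sum>k<r. of_int (V i k) * y k)))\<^sup>2)) x = ennreal (1 / 2 ^ card I)"
proof -
  define X where "X i y = (\<Sum>k<r. of_int (V i k) * y k)" for i and y :: "nat \<Rightarrow> real"
  define w :: "('i \<Rightarrow> int) \<Rightarrow> real" where "w e = (\<Prod>i\<in>I. if e i = 0 then 1 else 1 / 2)" for e
  define E where "E = PiE I (\<lambda>_. {-1, 0, 1 :: int})"
  define z :: "'i \<Rightarrow> int" where "z = (\<lambda>i\<in>I. 0)"
  define u where "u e k = (\<Sum>i\<in>I. e i * V i k)" for e k
  define W where "W = (\<Sum>e\<in>E - {z}. w e)"
  have X [measurable]: "X i \<in> borel_measurable borel" for i unfolding X_def by measurable
  have fin: "finite E" unfolding E_def using I by (intro finite_PiE) auto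
  have zE: "z \<in> E" by (auto simp: z_def E_def)
  have w0: "0 < w e" for e unfolding w_def by (intro prod_pos) auto
  have wz: "w z = 1" by (simp add: w_def z_def)
  have W0: "0 \<le> W" unfolding W_def by (intro sum_nonneg less_imp_le w0)
  have freq: "(\<Sum>i\<in>I. of_int (e i) * (2 * pi * X i y)) = 2 * pi * (\<Sum>k<r. of_int (u e k) * y k)" for e y
  proof -
    have "(\<Sum>i\<in>I. of_int (e i) * (2 * pi * X i y))
        = (\<Sum>i\<in>I. \<Sum>k<r. 2 * pi * (of_int (e i * V i k) * y k))"
      unfolding X_def sum_distrib_left by (intro sum.cong refl) simp
    also have "\<dots> = (\<Sum>k<r. \<Sum>i\<in>I. 2 * pi * (of_int (e i * V i k) * y k))" by (rule sum.swap)
    also have "\<dots> = 2 * pi * (\<Sum>k<r. of_int (u e k) * y k)"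
      unfolding u_def of_int_sum sum_distrib_left sum_distrib_right by (rule refl)
    finally show ?thesis .
  qed
  \<comment> \<open>Adding the constant \<open>W\<close> makes every term nonnegative, as the integrals are nonnegative ones.\<close>
  have expand: "(\<Prod>i\<in>I. 1 + cos (2 * pi * X i y)) + W
      = 1 + (\<Sum>e\<in>E - {z}. w e * (1 + cos (2 * pi * (\<Sum>k<r. of_int (u e k) * y k))))" for y
  proof -
    have "(\<Prod>i\<in>I. 1 + cos (2 * pi * X i y)) = (\<Sum>e\<in>E. w e * cos (2 * pi * (\<Sum>k<r. of_int (u e k) * y k)))"
      unfolding prod_one_plus_cos[OF I] freq E_def w_def by (rule refl)
    also have "\<dots> = 1 + (\<Sum>e\<in>E - {z}. w e * cos (2 * pi * (\<Sum>k<r. of_int (u e k) * y k)))"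
      using fin zE wz by (subst sum.remove[of _ z]) (auto simp: u_def z_def)
    finally show ?thesis by (simp add: W_def sum.distrib distrib_left)
  qed
  have cos0: "0 \<le> 1 + cos s" for s :: real using cos_ge_minus_one[of s] by linarith
  let ?B = "unit_box [0..<r]"
  let ?J = "\<lambda>F. iter_nn_integral [0..<r] F x"
  have box: "?J ?B = 1" by (rule iter_nn_integral_unit_box) simp
  have one: "?J (\<lambda>y. ?B y * ennreal (1 + cos (2 * pi * (\<Sum>k<r. of_int (u e k) * y k)))) = 1"
    if e: "e \<in> E - {z}" for e
  proof (rule iter_nn_integral_one_plus_cos)
    have "\<exists>i\<in>I. e i \<noteq> 0"
    proof (rule ccontr)
      assume "\<not> (\<exists>i\<in>I. e i \<noteq> 0)"
      then have "e = z" using e by (auto simp: E_def z_def PiE_def extensional_def fun_eq_iff)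
      then show False using e by simp
    qed
    then show "\<exists>k<r. u e k \<noteq> 0" using e unfolding u_def E_def by (intro norel) auto
  qed
  have "?J (\<lambda>y. ?B y * ennreal (\<Prod>i\<in>I. 1 + cos (2 * pi * X i y))) + ennreal W
      = ?J (\<lambda>y. ?B y * ennreal (\<Prod>i\<in>I. 1 + cos (2 * pi * X i y)) + ennreal W * ?B y)"
    by (subst iter_nn_integral_add) (simp_all only: iter_nn_integral_cmult measurable_unit_box box mult_1_right, measurable)
  also have "\<dots> = ?J (\<lambda>y. ?B y + (\<Sum>e\<in>E - {z}. ennreal (w e) *
      (?B y * ennreal (1 + cos (2 * pi * (\<Sum>k<r. of_int (u e k) * y k))))))"
  proof (rule iter_nn_integral_cong)
    fix y
    have "?B y * ennreal (\<Prod>i\<in>I. 1 + cos (2 * pi * X i y)) + ennreal W * ?B y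
        = ?B y * ennreal ((\<Prod>i\<in>I. 1 + cos (2 * pi * X i y)) + W)"
    proof -
      have "0 \<le> (\<Prod>i\<in>I. 1 + cos (2 * pi * X i y))" by (intro prod_nonneg cos0)
      then have e: "ennreal ((\<Prod>i\<in>I. 1 + cos (2 * pi * X i y)) + W)
          = ennreal (\<Prod>i\<in>I. 1 + cos (2 * pi * X i y)) + ennreal W"
        by (rule ennreal_plus[OF _ W0])
      show ?thesis
        unfolding e distrib_left[of "?B y"] by (subst mult.commute[of "ennreal W"]) (rule refl)
    qed
    also have "ennreal ((\<Prod>i\<in>I. 1 + cos (2 * pi * X i y)) + W)
        = 1 + (\<Sum>e\<in>E - {z}. ennreal (w e) * ennreal (1 + cos (2 * pi * (\<Sum>k<r. of_int (u e k) * y k))))"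
    proof -
      let ?g = "\<lambda>e. 1 + cos (2 * pi * (\<Sum>k<r. of_int (u e k) * y k))"
      have nn: "0 \<le> w e * ?g e" for e by (intro mult_nonneg_nonneg less_imp_le[OF w0] cos0)
      have "ennreal (1 + (\<Sum>e\<in>E - {z}. w e * ?g e)) = ennreal 1 + ennreal (\<Sum>e\<in>E - {z}. w e * ?g e)"
        by (rule ennreal_plus) (auto intro!: sum_nonneg nn)
      also have "ennreal (\<Sum>e\<in>E - {z}. w e * ?g e) = (\<Sum>e\<in>E - {z}. ennreal (w e * ?g e))"
        by (rule sum_ennreal[symmetric]) (rule nn)
      also have "\<dots> = (\<Sum>e\<in>E - {z}. ennreal (w e) * ennreal (?g e))"
        by (intro sum.cong refl ennreal_mult less_imp_le[OF w0] cos0)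
      finally show ?thesis unfolding expand by (simp only: ennreal_1)
    qed
    also have "?B y * (1 + (\<Sum>e\<in>E - {z}. ennreal (w e) * ennreal (1 + cos (2 * pi * (\<Sum>k<r. of_int (u e k) * y k)))))
        = ?B y + (\<Sum>e\<in>E - {z}. ennreal (w e) *
      (?B y * ennreal (1 + cos (2 * pi * (\<Sum>k<r. of_int (u e k) * y k)))))"
      by (simp only: distrib_left[of "?B y"] mult_1_right sum_distrib_left[of "?B y"] mult.left_commute[of "?B y"])
    finally show "?B y * ennreal (\<Prod>i\<in>I. 1 + cos (2 * pi * X i y)) + ennreal W * ?B y
        = ?B y + (\<Sum>e\<in>E - {z}. ennreal (w e) *
      (?B y * ennreal (1 + cos (2 * pi * (\<Sum>k<r. of_int (u e k) * y k)))))" .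
  qed
  also have "\<dots> = 1 + (\<Sum>e\<in>E - {z}. ennreal (w e))"
  proof -
    define g where "g e y = ?B y * ennreal (1 + cos (2 * pi * (\<Sum>k<r. of_int (u e k) * y k)))" for e y
    have [measurable]: "g e \<in> borel_measurable borel" for e unfolding g_def by simp
    have "?J (\<lambda>y. ?B y + (\<Sum>e\<in>E - {z}. ennreal (w e) * g e y))
        = ?J ?B + (\<Sum>e\<in>E - {z}. ?J (\<lambda>y. ennreal (w e) * g e y))"
    proof (subst iter_nn_integral_add)
      have m: "(\<lambda>y. ennreal (w e) * g e y) \<in> borel_measurable borel" for e by simp
      show "(\<lambda>y. \<Sum>e\<in>E - {z}. ennreal (w e) * g e y) \<in> borel_measurable borel"
        by (intro borel_measurable_sum m)
      show "?J ?B + ?J (\<lambda>y. \<Sum>e\<in>E - {z}. ennreal (w e) * g e y)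
          = ?J ?B + (\<Sum>e\<in>E - {z}. ?J (\<lambda>y. ennreal (w e) * g e y))"
        by (rule arg_cong[OF iter_nn_integral_sum]) (rule m)
    qed simp
    also have "\<dots> = 1 + (\<Sum>e\<in>E - {z}. ennreal (w e))"
    proof -
      have "?J (\<lambda>y. ennreal (w e) * g e y) = ennreal (w e)" if "e \<in> E - {z}" for e
        using one[OF that] iter_nn_integral_cmult[of "g e" "[0..<r]" "ennreal (w e)" x]
        unfolding g_def[symmetric] by simp
      then show ?thesis by (simp add: box)
    qed
    finally show ?thesis unfolding g_def .
  qed
  also have "\<dots> = 1 + ennreal W"
    by (simp add: W_def less_imp_le[OF w0])
  finally have J1: "?J (\<lambda>y. ?B y * ennreal (\<Prod>i\<in>I. 1 + cos (2 * pi * X i y))) = 1"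
    unfolding add.commute[of _ "ennreal W"] ennreal_add_left_cancel by simp
  have half: "(\<Prod>i\<in>I. (cos (pi * X i y))\<^sup>2) = 1 / 2 ^ card I * (\<Prod>i\<in>I. 1 + cos (2 * pi * X i y))" for y
  proof -
    have sq: "(cos (pi * X i y))\<^sup>2 = 1 / 2 * (1 + cos (2 * pi * X i y))" for i
      using cos_double_cos[of "pi * X i y"] by (simp add: mult.assoc)
    show ?thesis unfolding sq prod.distrib by (simp add: power_one_over)
  qed
  have "?J (\<lambda>y. ?B y * ennreal (\<Prod>i\<in>I. (cos (pi * X i y))\<^sup>2))
      = ?J (\<lambda>y. ennreal (1 / 2 ^ card I) * (?B y * ennreal (\<Prod>i\<in>I. 1 + cos (2 * pi * X i y))))"
  proof (rule iter_nn_integral_cong)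
    fix y
    show "?B y * ennreal (\<Prod>i\<in>I. (cos (pi * X i y))\<^sup>2)
        = ennreal (1 / 2 ^ card I) * (?B y * ennreal (\<Prod>i\<in>I. 1 + cos (2 * pi * X i y)))"
      unfolding half by (subst ennreal_mult', simp, rule mult.left_commute)
  qed
  also have "\<dots> = ennreal (1 / 2 ^ card I)"
    by (simp add: iter_nn_integral_cmult J1)
  finally show ?thesis unfolding X_def .
qed

text \<open>The rows in \<open>I\<close> decide the torus side, while \<open>D\<close> is formed
  with all \<open>s\<close> rows. Comparing an upper and a lower estimate of the same integral of
  bumps brings the two together.\<close>

lemma two_power_card_le_gram_det:
  fixes V :: "nat \<Rightarrow> nat \<Rightarrow> int"
  assumes indep: "\<And>y :: nat \<Rightarrow> real. (\<And>i. i < s \<Longrightarrow> (\<Sum>k<r. of_int (V i k) * y k) = 0) \<Longrightarrow> \<forall>k<r. y k = 0"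
    and I: "I \<subseteq> {..<s}"
    and norel: "\<And>e. e \<in> PiE I (\<lambda>_. {-1, 0, 1}) \<Longrightarrow> \<exists>i\<in>I. e i \<noteq> 0 \<Longrightarrow> \<exists>k<r. (\<Sum>i\<in>I. e i * V i k) \<noteq> 0"
  defines "D \<equiv> det (mat r r (\<lambda>(k, l). \<Sum>i<s. real_of_int (V i k) * real_of_int (V i l)))"
  shows "0 < D" and "2 ^ card I \<le> 2 ^ r * sqrt D"
proof -
  define X where "X i y = (\<Sum>k<r. of_int (V i k) * y k)" for i and y :: "nat \<Rightarrow> real"
  have [measurable]: "X i \<in> borel_measurable borel" for i unfolding X_def by measurable
  show D: "0 < D" unfolding D_def
    by (rule iter_nn_integral_prod_gauss(1)[where v = "\<lambda>i k. of_int (V i k)"]) (use indep in auto)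
  have finI: "finite I" using I finite_subset by blast
  let ?J = "\<lambda>F. iter_nn_integral [0..<r] F (\<lambda>_. 0)"
  have "ennreal (1 / (2 ^ r * sqrt D)) = ?J (\<lambda>y. ennreal (\<Prod>i<s. gauss (X i y)))"
    unfolding D_def X_def
    by (rule iter_nn_integral_prod_gauss(2)[where v = "\<lambda>i k. of_int (V i k)", symmetric]) (use indep in auto)
  also have "\<dots> \<le> ?J (\<lambda>y. ennreal (\<Prod>i<s. cos_bump (X i y)))"
    unfolding X_def by (rule iter_nn_integral_gauss_le_cos_bump)
  also have "\<dots> \<le> ?J (\<lambda>y. unit_box [0..<r] y * ennreal (\<Prod>i\<in>I. (cos (pi * X i y))\<^sup>2))"
  proof (rule iter_nn_integral_packing)
    show "ennreal (\<Prod>i<s. cos_bump (X i y)) \<le> ennreal (\<Prod>i\<in>I. (cos (pi * X i y))\<^sup>2)" for y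
    proof (rule ennreal_leI)
      have b: "cos_bump t \<le> 1" for t
        by (simp add: cos_bump_def abs_square_le_1)
      have "(\<Prod>i<s. cos_bump (X i y)) = (\<Prod>i\<in>I. cos_bump (X i y)) * (\<Prod>i\<in>{..<s} - I. cos_bump (X i y))"
        using I by (subst prod.subset_diff[of I]) (auto simp: mult.commute)
      also have "\<dots> \<le> (\<Prod>i\<in>I. (cos (pi * X i y))\<^sup>2) * 1"
      proof (rule mult_mono)
        show "(\<Prod>i\<in>I. cos_bump (X i y)) \<le> (\<Prod>i\<in>I. (cos (pi * X i y))\<^sup>2)"
          by (intro prod_mono) (simp add: cos_bump_def)
        show "(\<Prod>i\<in>{..<s} - I. cos_bump (X i y)) \<le> 1"
          using b by (intro prod_le_1) (simp add: cos_bump_nonneg)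
      qed (auto intro!: prod_nonneg simp: cos_bump_nonneg)
      finally show "(\<Prod>i<s. cos_bump (X i y)) \<le> (\<Prod>i\<in>I. (cos (pi * X i y))\<^sup>2)" by simp
    qed
    have Xz: "X i (\<lambda>k. y k + of_int (z k)) = X i y + of_int (\<Sum>k<r. V i k * z k)" for i y and z :: "nat \<Rightarrow> int"
      by (simp add: X_def algebra_simps sum.distrib)
    have per: "(cos (pi * (t + of_int m)))\<^sup>2 = (cos (pi * t))\<^sup>2" for t and m :: int
    proof -
      have "cos (2 * (pi * (t + of_int m))) = cos (2 * (pi * t) + 2 * pi * of_int m)"
        by (simp add: algebra_simps)
      also have "\<dots> = cos (2 * (pi * t))" by (simp add: cos_add)
      finally show ?thesis unfolding cos_double_cos by simp
    qed
    show "ennreal (\<Prod>i\<in>I. (cos (pi * X i (\<lambda>k. y k + of_int (z k))))\<^sup>2) = ennreal (\<Prod>i\<in>I. (cos (pi * X i y))\<^sup>2)"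
      for y and z :: "nat \<Rightarrow> int"
      unfolding Xz per by (rule refl)
    fix y and z :: "nat \<Rightarrow> int"
    assume y: "ennreal (\<Prod>i<s. cos_bump (X i y)) \<noteq> 0"
      and yz: "ennreal (\<Prod>i<s. cos_bump (X i (\<lambda>k. y k + of_int (z k)))) \<noteq> 0"
      and z: "\<And>i. i \<notin> set [0..<r] \<Longrightarrow> z i = 0"
    have small: "\<bar>X i y'\<bar> < 1 / 2" if "ennreal (\<Prod>i<s. cos_bump (X i y')) \<noteq> 0" "i < s" for i y'
    proof (rule ccontr)
      assume "\<not> \<bar>X i y'\<bar> < 1 / 2"
      then have "cos_bump (X i y') = 0" by (simp add: cos_bump_def)
      then have "(\<Prod>i<s. cos_bump (X i y')) = 0" using that(2) by (intro prod_zero) auto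
      then show False using that(1) by (simp only: ennreal_0 simp_thms)
    qed
    \<comment> \<open>Here the cutoff at 1/2 matters: both points give the form values of modulus
      less than 1/2, so the integer by which they differ has modulus less than 1 and
      vanishes.\<close>
    have "(\<Sum>k<r. of_int (V i k) * real_of_int (z k)) = 0" if i: "i < s" for i
    proof -
      have "\<bar>of_int (\<Sum>k<r. V i k * z k) :: real\<bar> < 1"
        using small[OF y i] small[OF yz i] unfolding Xz by linarith
      then have "(\<Sum>k<r. V i k * z k) = 0" by linarith
      then have "real_of_int (\<Sum>k<r. V i k * z k) = 0" by simp
      then show ?thesis by simp
    qed
    from indep[of "\<lambda>k. of_int (z k)", OF this] have "\<forall>k<r. z k = 0" by simp
    then show "z = (\<lambda>_. 0)" using z by (auto simp: fun_eq_iff)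
  qed simp_all
  also have "\<dots> = ennreal (1 / 2 ^ card I)"
    unfolding X_def using finI norel by (rule iter_nn_integral_prod_cos_squared)
  finally have "1 / (2 ^ r * sqrt D) \<le> 1 / 2 ^ card I" by (simp add: ennreal_le_iff)
  then show "2 ^ card I \<le> 2 ^ r * sqrt D" using D by (simp add: field_simps)
qed


subsection \<open>Lattice bases\<close>

text \<open>Independence of the list and not of its set: a repeated vector counts as a dependence,
  so one condition covers both distinctness and independence of the set.\<close>

definition real_independent :: "nat \<Rightarrow> real vec list \<Rightarrow> bool" where
  "real_independent n vs \<longleftrightarrow> (\<forall>y :: nat \<Rightarrow> real.
     (\<forall>i<n. (\<Sum>k<length vs. y k * (vs ! k $ i)) = 0) \<longrightarrow> (\<forall>k<length vs. y k = 0))"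

lemma mat_of_cols_mult_vec_index:
  fixes vs :: "real vec list"
  assumes "i < n" "z \<in> carrier_vec (length vs)"
  shows "(mat_of_cols n vs *\<^sub>v z) $ i = (\<Sum>k<length vs. z $ k * (vs ! k $ i))"
  using assms by (simp add: scalar_prod_def mat_of_cols_index atLeast0LessThan mult.commute)

lemma real_independent_imp:
  assumes vs: "set vs \<subseteq> carrier_vec n" and ind: "real_independent n vs"
  shows "distinct vs" and "module.lin_indpt class_ring (module_vec TYPE(real) n) (set vs)"
proof -
  show dist: "distinct vs"
  proof (rule ccontr)
    assume "\<not> distinct vs"
    then obtain a b where ab: "a < length vs" "b < length vs" "a \<noteq> b" "vs ! a = vs ! b"
      by (auto simp: distinct_conv_nth)
    let ?y = "\<lambda>k. if k = a then 1 else if k = b then - 1 else 0 :: real"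
    have "(\<Sum>k<length vs. ?y k * (vs ! k $ i)) = 0" for i
    proof -
      have "(\<Sum>k<length vs. ?y k * (vs ! k $ i)) = (\<Sum>k\<in>{a, b}. ?y k * (vs ! k $ i))"
        using ab by (intro sum.mono_neutral_right) auto
      then show ?thesis using ab by simp
    qed
    then have "\<forall>k<length vs. ?y k = 0"
      by (intro ind[unfolded real_independent_def, THEN spec, THEN mp] allI impI)
    from this[rule_format, OF ab(1)] show False by simp
  qed
  interpret vec_space "TYPE(real)" n .
  show "lin_indpt (set vs)"
  proof
    assume "lin_dep (set vs)"
    then have "lin_dep (set (cols (mat_of_cols n vs)))" using vs by simp
    then obtain z where z: "z \<in> carrier_vec (length vs)" "z \<noteq> 0\<^sub>v (length vs)" "mat_of_cols n vs *\<^sub>v z = 0\<^sub>v n"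
      by (rule lin_depE[rotated]) (use vs dist in auto)
    have "(\<Sum>k<length vs. z $ k * (vs ! k $ i)) = 0" if "i < n" for i
      using mat_of_cols_mult_vec_index[OF that z(1)] z(3) that by simp
    then have "\<forall>k<length vs. z $ k = 0" using ind unfolding real_independent_def by blast
    then have "z = 0\<^sub>v (length vs)" using z(1) by (intro eq_vecI) auto
    then show False using z(2) by simp
  qed
qed

lemma lin_indpt_imp_real_independent:
  assumes vs: "set vs \<subseteq> carrier_vec n" and dist: "distinct vs"
    and ind: "module.lin_indpt class_ring (module_vec TYPE(real) n) (set vs)"
  shows "real_independent n vs"
  unfolding real_independent_def
proof (intro allI impI)
  fix y :: "nat \<Rightarrow> real" and k
  assume y: "\<forall>i<n. (\<Sum>k<length vs. y k * (vs ! k $ i)) = 0" and k: "k < length vs"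
  interpret vec_space "TYPE(real)" n .
  let ?z = "vec (length vs) y"
  have "mat_of_cols n vs *\<^sub>v ?z = 0\<^sub>v n"
  proof (rule eq_vecI)
    fix i assume "i < dim_vec (0\<^sub>v n)"
    then have i: "i < n" by simp
    have "(\<Sum>k<length vs. ?z $ k * (vs ! k $ i)) = (\<Sum>k<length vs. y k * (vs ! k $ i))"
      by (intro sum.cong) auto
    then show "(mat_of_cols n vs *\<^sub>v ?z) $ i = 0\<^sub>v n $ i"
      using mat_of_cols_mult_vec_index[OF i, of ?z vs] y i by simp
  qed simp
  then have "?z = 0\<^sub>v (length vs)"
    using lin_depI[of "mat_of_cols n vs" "length vs" ?z] vs dist ind by auto
  then have "?z $ k = 0" using k by simp
  then show "y k = 0" using k by simp
qed

text \<open>Division with remainder by the least positive element.\<close>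

lemma int_subgroup_generator:
  fixes C :: "int set"
  assumes 0: "0 \<in> C" and diff: "\<And>a b. a \<in> C \<Longrightarrow> b \<in> C \<Longrightarrow> a - b \<in> C" and ne: "C \<noteq> {0}"
  obtains g where "0 < g" "g \<in> C" "\<And>a. a \<in> C \<Longrightarrow> g dvd a"
proof -
  have neg: "- a \<in> C" if "a \<in> C" for a using diff[OF 0 that] by simp
  have add: "a + b \<in> C" if "a \<in> C" "b \<in> C" for a b using diff[OF that(1) neg[OF that(2)]] by simp
  have mult: "int m * a \<in> C" if "a \<in> C" for m a
    by (induction m) (use 0 add that in \<open>auto simp: distrib_right\<close>)
  have imult: "q * a \<in> C" if "a \<in> C" for q a
    using mult[OF that, of "nat q"] neg[OF mult[OF that, of "nat (- q)"]] by (cases "0 \<le> q") auto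
  obtain c where c: "c \<in> C" "c \<noteq> 0" using 0 ne by blast
  then have "\<exists>m. 0 < m \<and> int m \<in> C"
    using neg[OF c(1)] by (intro exI[of _ "nat \<bar>c\<bar>"]) (auto simp: abs_if)
  then obtain m where m: "0 < m \<and> int m \<in> C" "\<And>k. k < m \<Longrightarrow> \<not> (0 < k \<and> int k \<in> C)"
    using exists_least_iff[of "\<lambda>m. 0 < m \<and> int m \<in> C"] by blast
  show thesis
  proof (rule that[of "int m"])
    fix a assume "a \<in> C"
    then have "a - (a div int m) * int m \<in> C" using m(1) by (intro diff imult) auto
    then have "a mod int m \<in> C" by (simp add: minus_div_mult_eq_mod)
    moreover have "0 \<le> a mod int m" "a mod int m < int m" using m(1) by auto
    ultimately have "\<not> 0 < nat (a mod int m)" using m(2)[of "nat (a mod int m)"] by auto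
    then have "a mod int m = 0" using \<open>0 \<le> a mod int m\<close> by simp
    then show "int m dvd a" by auto
  qed (use m in auto)
qed

text \<open>
  \<open>k\<close> decreases from \<open>s\<close>: when the \<open>k\<close>-th coordinates of the elements vanishing below \<open>k\<close> form a
  nonzero subgroup of the integers, an element attaining its generator is added to the basis.
\<close>

lemma exists_echelon_basis:
  fixes L :: "(nat \<Rightarrow> int) set"
  assumes 0: "(\<lambda>_. 0) \<in> L" and diff: "\<And>x y. x \<in> L \<Longrightarrow> y \<in> L \<Longrightarrow> (\<lambda>i. x i - y i) \<in> L"
    and bd: "\<And>x i. x \<in> L \<Longrightarrow> s \<le> i \<Longrightarrow> x i = 0" and "k \<le> s"
  shows "\<exists>vs. set vs \<subseteq> L \<and> (\<forall>v\<in>set vs. \<forall>i<k. v i = 0) \<and>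
    (\<forall>x\<in>L. (\<forall>i<k. x i = 0) \<longrightarrow> (\<exists>z. \<forall>i. x i = (\<Sum>m<length vs. z m * (vs ! m) i))) \<and>
    (\<forall>y :: nat \<Rightarrow> real. (\<forall>i<s. (\<Sum>m<length vs. y m * of_int ((vs ! m) i)) = 0) \<longrightarrow> (\<forall>m<length vs. y m = 0))"
  using \<open>k \<le> s\<close>
proof (induction k rule: inc_induct)
  case base
  show ?case
  proof (intro exI[of _ "[]"] conjI ballI impI)
    fix x assume x: "x \<in> L" "\<forall>i<s. x i = 0"
    then have "x i = 0" for i using bd[of x i] by (cases "i < s") auto
    then show "\<exists>z. \<forall>i. x i = (\<Sum>m<length []. z m * ([] ! m) i)" by simp
  qed auto
next
  case (step k)
  from step.IH obtain vs where vs': "set vs \<subseteq> L" "\<forall>v\<in>set vs. \<forall>i<Suc k. v i = 0"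
    and gen': "\<forall>x\<in>L. (\<forall>i<Suc k. x i = 0) \<longrightarrow> (\<exists>z. \<forall>i. x i = (\<Sum>m<length vs. z m * (vs ! m) i))"
    and ind': "\<forall>y :: nat \<Rightarrow> real. (\<forall>i<s. (\<Sum>m<length vs. y m * of_int ((vs ! m) i)) = 0)
      \<longrightarrow> (\<forall>m<length vs. y m = 0)"
    by (elim exE conjE)
  have vs: "set vs \<subseteq> L" "\<And>v i. v \<in> set vs \<Longrightarrow> i < Suc k \<Longrightarrow> v i = 0"
    by (rule vs'(1)) (use vs'(2) in blast)
  have gen: "\<exists>z. \<forall>i. x i = (\<Sum>m<length vs. z m * (vs ! m) i)" if "x \<in> L" "\<And>i. i < Suc k \<Longrightarrow> x i = 0" for x
    using gen'[rule_format, OF that(1)] that(2) by blast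
  have ind: "\<forall>m<length vs. y m = 0"
    if "\<And>i. i < s \<Longrightarrow> (\<Sum>m<length vs. y m * of_int ((vs ! m) i)) = 0" for y :: "nat \<Rightarrow> real"
    using ind'[rule_format, of y] that by blast
  have neg: "(\<lambda>i. - x i) \<in> L" if "x \<in> L" for x using diff[OF 0 that] by simp
  have add: "(\<lambda>i. x i + y i) \<in> L" if "x \<in> L" "y \<in> L" for x y
    using diff[OF that(1) neg[OF that(2)]] by simp
  have mult: "(\<lambda>i. int m * x i) \<in> L" if "x \<in> L" for m x
  proof (induction m)
    case (Suc m)
    from add[OF that Suc] show ?case by (simp add: distrib_right)
  qed (use 0 in simp)
  have imult: "(\<lambda>i. q * x i) \<in> L" if "x \<in> L" for q x
    using mult[OF that, of "nat q"] neg[OF mult[OF that, of "nat (- q)"]] by (cases "0 \<le> q") auto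
  define C where "C = {x k | x. x \<in> L \<and> (\<forall>i<k. x i = 0)}"
  have C0: "0 \<in> C" using 0 by (force simp: C_def)
  show ?case
  proof (cases "C = {0}")
    case True
    have "\<exists>z. \<forall>i. x i = (\<Sum>m<length vs. z m * (vs ! m) i)" if x: "x \<in> L" "\<forall>i<k. x i = 0" for x
    proof -
      have "x k \<in> C" using x by (auto simp: C_def)
      then have "x k = 0" using True by simp
      then show ?thesis using x by (intro gen) (auto simp: less_Suc_eq)
    qed
    then show ?thesis using vs ind by (intro exI[of _ vs]) auto
  next
    case False
    have Cd: "a - b \<in> C" if ab: "a \<in> C" "b \<in> C" for a b
    proof -
      obtain x y where "x \<in> L" "\<forall>i<k. x i = 0" "a = x k" "y \<in> L" "\<forall>i<k. y i = 0" "b = y k"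
        using ab by (auto simp: C_def)
      then show ?thesis unfolding C_def by (intro CollectI exI[of _ "\<lambda>i. x i - y i"]) (auto intro: diff)
    qed
    obtain g where g: "0 < g" "g \<in> C" "\<And>a. a \<in> C \<Longrightarrow> g dvd a"
      using int_subgroup_generator[OF C0 Cd False] by blast
    obtain w where w: "w \<in> L" "\<And>i. i < k \<Longrightarrow> w i = 0" "w k = g" using g(2) by (auto simp: C_def)
    have split: "(\<Sum>m<length (w # vs). f m * h ((w # vs) ! m)) = f 0 * h w + (\<Sum>m<length vs. f (Suc m) * h (vs ! m))"
      for f :: "nat \<Rightarrow> 'c :: comm_ring_1" and h
      by (simp del: sum.lessThan_Suc add: sum.lessThan_Suc_shift)
    have 1: "\<exists>z. \<forall>i. x i = (\<Sum>m<length (w # vs). z m * ((w # vs) ! m) i)" if x: "x \<in> L" "\<forall>i<k. x i = 0" for x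
    proof -
      have "x k \<in> C" using x by (auto simp: C_def)
      then obtain q where q: "x k = g * q" using g(3) by blast
      \<comment> \<open>Subtracting \<open>q\<close> times \<open>w\<close> clears coordinate
        \<open>k\<close>, so that the generators found for \<open>Suc k\<close> apply.\<close>
      have "\<exists>z. \<forall>i. x i - q * w i = (\<Sum>m<length vs. z m * (vs ! m) i)"
        using x w q by (intro gen diff imult) (auto simp: less_Suc_eq)
      then obtain z where z: "\<And>i. x i - q * w i = (\<Sum>m<length vs. z m * (vs ! m) i)" by blast
      show ?thesis
      proof (intro exI[of _ "case_nat q z"] allI)
        fix i
        show "x i = (\<Sum>m<length (w # vs). case_nat q z m * ((w # vs) ! m) i)"
          using z[of i] split[of "case_nat q z" "\<lambda>v. v i"] by simp
      qed
    qed
    have 2: "\<forall>m<length (w # vs). y m = 0"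
      if y: "\<forall>i<s. (\<Sum>m<length (w # vs). y m * of_int (((w # vs) ! m) i)) = 0" for y :: "nat \<Rightarrow> real"
    proof -
      have e: "y 0 * of_int (w i) + (\<Sum>m<length vs. y (Suc m) * of_int ((vs ! m) i)) = 0" if "i < s" for i
        using y that split[of y "\<lambda>v. of_int (v i)"] by simp
      \<comment> \<open>All vectors of \<open>vs\<close> vanish at \<open>k\<close>, so this
        coordinate isolates the coefficient of \<open>w\<close>.\<close>
      have "(\<Sum>m<length vs. y (Suc m) * of_int ((vs ! m) k)) = 0"
        using vs(2) by (intro sum.neutral) auto
      then have y0: "y 0 = 0" using e[of k] step.hyps w(3) g(1) by simp
      then have "\<forall>m<length vs. y (Suc m) = 0" using e by (intro ind) simp
      then show ?thesis using y0 by (auto simp: less_Suc_eq_0_disj)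
    qed
    show ?thesis
      using vs w 1 2 by (intro exI[of _ "w # vs"]) auto
  qed
qed


section \<open>The lattice of integer points in a column space\<close>

lemma row_matrix_carrier [simp]: "row_matrix n xs \<in> carrier_mat (length xs) n"
  by (simp add: row_matrix_def)

lemma mem_col_lattice:
  "y \<in> col_lattice n xs \<longleftrightarrow> (\<exists>q \<in> carrier_vec n. row_matrix n xs *\<^sub>v q = y) \<and>
    (\<exists>u \<in> carrier_vec (length xs). y = map_vec real_of_int u)"
proof -
  interpret vec_space "TYPE(real)" "length xs" .
  have "dim_row (row_matrix n xs) = length xs" "dim_col (row_matrix n xs) = n"
    by (rule carrier_matD[OF row_matrix_carrier])+
  then show ?thesis
    unfolding col_lattice_def col_space_eq[OF row_matrix_carrier] by auto
qed

text \<open>\<open>lattice_det\<close> chooses a basis by \<open>SOME\<close>, which says something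
  only once a basis is known to exist.\<close>

lemma exists_lattice_basis: "\<exists>vs. lattice_basis (length xs) (col_lattice n xs) vs"
proof -
  define s where "s = length xs"
  define W where "W = row_matrix n xs"
  have W: "W \<in> carrier_mat s n" by (simp add: W_def s_def)
  define rv where "rv x = vec s (\<lambda>i. real_of_int (x i))" for x :: "nat \<Rightarrow> int"
  \<comment> \<open>The lattice as integer functions, extended by zero from \<open>s\<close> on; the
    echelon construction is applied at \<open>k = 0\<close>, where it generates all of
    \<open>L\<close>.\<close>
  define L where "L = {x :: nat \<Rightarrow> int. (\<forall>i\<ge>s. x i = 0) \<and> (\<exists>q\<in>carrier_vec n. W *\<^sub>v q = rv x)}"
  have L0: "(\<lambda>_. 0) \<in> L"
  proof -
    have "W *\<^sub>v 0\<^sub>v n = rv (\<lambda>_. 0)"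
      using W by (intro eq_vecI) (auto simp: rv_def)
    then show ?thesis unfolding L_def by (intro CollectI conjI bexI[of _ "0\<^sub>v n"]) auto
  qed
  have Ld: "(\<lambda>i. x i - y i) \<in> L" if xy: "x \<in> L" "y \<in> L" for x y
  proof -
    obtain p q where pq: "p \<in> carrier_vec n" "W *\<^sub>v p = rv x" "q \<in> carrier_vec n" "W *\<^sub>v q = rv y"
      using xy unfolding L_def by blast
    have "W *\<^sub>v (p - q) = rv x - rv y"
      using pq W by (simp add: mult_minus_distrib_mat_vec)
    also have "\<dots> = rv (\<lambda>i. x i - y i)" by (intro eq_vecI) (auto simp: rv_def)
    finally show ?thesis using xy pq unfolding L_def by (intro CollectI conjI bexI[of _ "p - q"]) auto
  qed
  have bd: "x i = 0" if "x \<in> L" "s \<le> i" for x i using that by (auto simp: L_def)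
  have "\<exists>us. set us \<subseteq> L \<and> (\<forall>v\<in>set us. \<forall>i<0. v i = 0) \<and>
    (\<forall>x\<in>L. (\<forall>i<0. x i = 0) \<longrightarrow> (\<exists>z. \<forall>i. x i = (\<Sum>m<length us. z m * (us ! m) i))) \<and>
    (\<forall>y :: nat \<Rightarrow> real. (\<forall>i<s. (\<Sum>m<length us. y m * of_int ((us ! m) i)) = 0) \<longrightarrow> (\<forall>m<length us. y m = 0))"
    by (rule exists_echelon_basis) (fact L0, rule Ld, assumption, assumption, rule bd, assumption, assumption, rule le0)
  then obtain us where us: "set us \<subseteq> L" and "\<forall>v\<in>set us. \<forall>i<0. v i = 0"
    and gen: "\<forall>x\<in>L. (\<forall>i<0. x i = 0) \<longrightarrow> (\<exists>z. \<forall>i. x i = (\<Sum>m<length us. z m * (us ! m) i))"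
    and ind: "\<forall>y :: nat \<Rightarrow> real. (\<forall>i<s. (\<Sum>m<length us. y m * of_int ((us ! m) i)) = 0)
      \<longrightarrow> (\<forall>m<length us. y m = 0)"
    by (elim exE conjE)
  define vs where "vs = map rv us"
  have vsi: "vs ! k $ i = of_int ((us ! k) i)" if "k < length us" "i < s" for k i
    using that by (simp add: vs_def rv_def)
  have carr: "set vs \<subseteq> carrier_vec s" by (auto simp: vs_def rv_def)
  have "real_independent s vs"
    unfolding real_independent_def
  proof (intro allI impI)
    fix y :: "nat \<Rightarrow> real" and k
    assume y: "\<forall>i<s. (\<Sum>k<length vs. y k * vs ! k $ i) = 0" and k: "k < length vs"
    have "(\<Sum>m<length us. y m * of_int ((us ! m) i)) = 0" if "i < s" for i
    proof -
      have "(\<Sum>m<length us. y m * of_int ((us ! m) i)) = (\<Sum>k<length vs. y k * vs ! k $ i)"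
        by (intro sum.cong) (auto simp: vs_def rv_def that)
      then show ?thesis using y that by simp
    qed
    then have "\<forall>m<length us. y m = 0" using ind by blast
    then show "y k = 0" using k by (simp add: vs_def)
  qed
  note li = real_independent_imp[OF carr this]
  have comb: "mat_of_cols s vs *\<^sub>v map_vec real_of_int z = rv (\<lambda>i. \<Sum>k<length us. z $ k * (us ! k) i)"
    if "z \<in> carrier_vec (length us)" for z
  proof (rule eq_vecI)
    fix i assume "i < dim_vec (rv (\<lambda>i. \<Sum>k<length us. z $ k * (us ! k) i))"
    then have i: "i < s" by (simp add: rv_def)
    have "(mat_of_cols s vs *\<^sub>v map_vec real_of_int z) $ i
        = (\<Sum>k<length vs. map_vec real_of_int z $ k * (vs ! k $ i))"
      using that by (intro mat_of_cols_mult_vec_index i) (simp add: vs_def)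
    also have "\<dots> = (\<Sum>k<length us. of_int (z $ k * (us ! k) i))"
      using that i by (intro sum.cong) (auto simp: vs_def rv_def)
    finally show "(mat_of_cols s vs *\<^sub>v map_vec real_of_int z) $ i
        = rv (\<lambda>i. \<Sum>k<length us. z $ k * (us ! k) i) $ i"
      using i by (simp add: rv_def)
  qed (simp add: rv_def)
  have "col_lattice n xs = {mat_of_cols s vs *\<^sub>v map_vec real_of_int z | z. z \<in> carrier_vec (length vs)}"
  proof (rule subset_antisym; rule subsetI)
    fix y assume "y \<in> col_lattice n xs"
    then obtain q u where q: "q \<in> carrier_vec n" "W *\<^sub>v q = y" and u: "u \<in> carrier_vec s" "y = map_vec real_of_int u"
      unfolding mem_col_lattice W_def s_def by blast
    define x where "x i = (if i < s then u $ i else 0)" for i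
    have yx: "y = rv x"
      unfolding u(2) by (rule eq_vecI) (use u(1) in \<open>simp_all add: rv_def x_def\<close>)
    have "x \<in> L"
      unfolding L_def mem_Collect_eq
    proof (intro conjI allI impI bexI)
      show "W *\<^sub>v q = rv x" by (rule trans[OF q(2) yx])
    qed (use q(1) in \<open>simp_all add: x_def\<close>)
    then have "\<exists>z. \<forall>i. x i = (\<Sum>m<length us. z m * (us ! m) i)"
      using gen by simp
    then obtain z where z: "\<And>i. x i = (\<Sum>m<length us. z m * (us ! m) i)" by (elim exE) blast
    have "mat_of_cols s vs *\<^sub>v map_vec real_of_int (vec (length us) z)
        = rv (\<lambda>i. \<Sum>k<length us. vec (length us) z $ k * (us ! k) i)" by (rule comb) simp
    also have "(\<lambda>i. \<Sum>k<length us. vec (length us) z $ k * (us ! k) i) = x"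
      by (intro ext) (simp add: z)
    finally have "y = mat_of_cols s vs *\<^sub>v map_vec real_of_int (vec (length us) z)" using yx by simp
    then show "y \<in> {mat_of_cols s vs *\<^sub>v map_vec real_of_int z | z. z \<in> carrier_vec (length vs)}"
      by (intro CollectI exI[of _ "vec (length us) z"]) (simp add: vs_def)
  next
    fix y assume "y \<in> {mat_of_cols s vs *\<^sub>v map_vec real_of_int z | z. z \<in> carrier_vec (length vs)}"
    then obtain z where z: "z \<in> carrier_vec (length us)" "y = mat_of_cols s vs *\<^sub>v map_vec real_of_int z"
      by (auto simp: vs_def)
    \<comment> \<open>Each basis vector is an image under \<open>W\<close>. With the preimages as
      columns of \<open>Q\<close>, the basis matrix is \<open>W * Q\<close>, so integer combinations
      stay in the column space.\<close>
    have "\<forall>k<length us. \<exists>q\<in>carrier_vec n. W *\<^sub>v q = vs ! k"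
    proof (intro allI impI)
      fix k assume k: "k < length us"
      then have "us ! k \<in> L" using us by auto
      then show "\<exists>q\<in>carrier_vec n. W *\<^sub>v q = vs ! k" using k by (simp add: L_def vs_def)
    qed
    then obtain q where q: "\<And>k. k < length us \<Longrightarrow> q k \<in> carrier_vec n" "\<And>k. k < length us \<Longrightarrow> W *\<^sub>v q k = vs ! k"
      by metis
    define Q where "Q = mat_of_cols n (map q [0..<length us])"
    have Q: "Q \<in> carrier_mat n (length us)"
      using mat_of_cols_carrier(1)[of n "map q [0..<length us]"] unfolding Q_def length_map length_upt by simp
    have "W * Q = mat_of_cols s vs"
    proof (rule eq_matI)
      fix i j assume "i < dim_row (mat_of_cols s vs)" "j < dim_col (mat_of_cols s vs)"
      then have ij: "i < s" "j < length us" by (auto simp: vs_def)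
      have "col Q j = q j" using ij q(1) by (simp add: Q_def)
      then have "(W * Q) $$ (i, j) = (W *\<^sub>v q j) $ i" using ij W Q by simp
      also have "\<dots> = mat_of_cols s vs $$ (i, j)" using ij q(2) by (simp add: mat_of_cols_index vs_def)
      finally show "(W * Q) $$ (i, j) = mat_of_cols s vs $$ (i, j)" .
    qed (use W Q in \<open>auto simp: vs_def\<close>)
    then have Wy: "W *\<^sub>v (Q *\<^sub>v map_vec real_of_int z) = y"
      using assoc_mult_mat_vec[OF W Q, of "map_vec real_of_int z"] z by simp
    have Qz: "Q *\<^sub>v map_vec real_of_int z \<in> carrier_vec n" using Q z(1) by simp
    let ?u = "vec s (\<lambda>i. \<Sum>k<length us. z $ k * (us ! k) i)"
    have yu: "y = map_vec real_of_int ?u"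
      unfolding z(2) comb[OF z(1)] by (rule eq_vecI) (simp_all add: rv_def)
    have "?u \<in> carrier_vec (length xs)" by (simp add: s_def)
    with yu have "\<exists>u\<in>carrier_vec (length xs). y = map_vec real_of_int u" ..
    moreover have "\<exists>q\<in>carrier_vec n. row_matrix n xs *\<^sub>v q = y"
      using Wy Qz unfolding W_def ..
    ultimately show "y \<in> col_lattice n xs"
      unfolding mem_col_lattice by (intro conjI)
  qed
  with carr li have "lattice_basis s (col_lattice n xs) vs"
    unfolding lattice_basis_def by (intro conjI)
  then show ?thesis unfolding s_def by (rule exI)
qed

lemma lattice_basis_nth_mem:
  assumes "lattice_basis s L vs" "k < length vs"
  shows "vs ! k \<in> L"
proof -
  have "map_vec real_of_int (unit_vec (length vs) k) = unit_vec (length vs) k"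
    using assms(2) by (intro eq_vecI) auto
  moreover have "mat_of_cols s vs *\<^sub>v unit_vec (length vs) k = vs ! k"
  proof (rule eq_vecI)
    have dim: "vs ! k \<in> carrier_vec s" using assms by (auto simp: lattice_basis_def)
    then show "dim_vec (mat_of_cols s vs *\<^sub>v unit_vec (length vs) k) = dim_vec (vs ! k)" by simp
    fix i assume "i < dim_vec (vs ! k)"
    then have i: "i < s" using dim by simp
    have "(mat_of_cols s vs *\<^sub>v unit_vec (length vs) k) $ i
        = (\<Sum>j<length vs. unit_vec (length vs) k $ j * (vs ! j $ i))"
      by (rule mat_of_cols_mult_vec_index[OF i]) simp
    also have "\<dots> = (\<Sum>j<length vs. if j = k then vs ! k $ i else 0)"
      using assms(2) by (intro sum.cong) auto
    finally show "(mat_of_cols s vs *\<^sub>v unit_vec (length vs) k) $ i = vs ! k $ i" using assms(2) by simp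
  qed
  ultimately have "vs ! k = mat_of_cols s vs *\<^sub>v map_vec real_of_int (unit_vec (length vs) k)" by simp
  moreover have "unit_vec (length vs) k \<in> carrier_vec (length vs)" by simp
  ultimately show ?thesis using assms(1) unfolding lattice_basis_def by blast
qed

text \<open>A basis is an independent set inside the column space of a matrix with \<open>n\<close>
  columns. This lets the bound use the ambient dimension in place of the rank of the
  lattice.\<close>

lemma lattice_basis_col_lattice_length:
  assumes "lattice_basis (length xs) (col_lattice n xs) vs"
  shows "length vs \<le> n"
proof -
  interpret vec_space "TYPE(real)" "length xs" .
  let ?W = "row_matrix n xs"
  let ?S = "span (set (cols ?W))"
  have W: "set (cols ?W) \<subseteq> carrier_vec (length xs)" using cols_dim[of ?W] row_matrix_carrier[of n xs] by auto
  have sub: "set vs \<subseteq> ?S"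
    using lattice_basis_nth_mem[OF assms] by (auto simp: in_set_conv_nth col_lattice_def col_space_def)
  have "lin_indpt (set vs)" using assms by (simp add: lattice_basis_def)
  then have ind: "LinearCombinations.module.lin_indpt class_ring (span_vs (set (cols ?W))) (set vs)"
    using span_li_not_depend(2)[OF sub span_is_submodule] W by simp
  have "vectorspace class_ring (span_vs (set (cols ?W)))"
    using W span_is_subspace subspace_is_vs by simp
  from vectorspace.li_le_dim(2)[OF this _ _ ind] have "card (set vs) \<le> rank ?W"
    using sub fin_dim_span_cols[OF row_matrix_carrier] by (simp add: rank_def)
  also have "\<dots> \<le> n" by (rule rank_le_nc[OF row_matrix_carrier])
  finally show ?thesis using assms by (simp add: lattice_basis_def distinct_card)
qed

text \<open>The rows of a basis matrix \<open>V\<close> of the lattice are as free of relations as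
  the vectors \<open>xs\<close>, so the determinant bound applies to them.\<close>

lemma card_le_log_lattice_det:
  fixes xs :: "int vec list"
  assumes I: "I \<subseteq> {..<length xs}"
    and norel: "\<And>e. e \<in> PiE I (\<lambda>_. {-1, 0, 1}) \<Longrightarrow> \<exists>i\<in>I. e i \<noteq> 0
      \<Longrightarrow> \<exists>j<n. (\<Sum>i\<in>I. e i * (xs ! i $ j)) \<noteq> 0"
  shows "int (card I) \<le> int n + \<lfloor>log 2 (lattice_det (length xs) (col_lattice n xs))\<rfloor>"
proof -
  define s where "s = length xs"
  define vs where "vs = (SOME vs. lattice_basis s (col_lattice n xs) vs)"
  have basis: "lattice_basis s (col_lattice n xs) vs"
    unfolding vs_def s_def using exists_lattice_basis by (rule someI_ex)
  define r where "r = length vs"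
  \<comment> \<open>The entries are integers already; the floor only changes their type.\<close>
  define V where "V i k = \<lfloor>vs ! k $ i\<rfloor>" for i k
  have carr: "vs ! k \<in> carrier_vec s" if "k < r" for k
    using basis that by (auto simp: lattice_basis_def r_def)
  have V: "of_int (V i k) = vs ! k $ i" if ik: "i < s" "k < r" for i k
  proof -
    have "vs ! k \<in> col_lattice n xs" using lattice_basis_nth_mem[OF basis] ik by (simp add: r_def)
    then obtain u where "u \<in> carrier_vec s" "vs ! k = map_vec real_of_int u"
      unfolding mem_col_lattice s_def by blast
    then show ?thesis using ik by (simp add: V_def)
  qed
  have ind: "real_independent s vs"
    using basis by (intro lin_indpt_imp_real_independent) (auto simp: lattice_basis_def)
  define D where "D = det (mat r r (\<lambda>(k, l). \<Sum>i<s. real_of_int (V i k) * real_of_int (V i l)))"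
  have "gram_mat vs = mat r r (\<lambda>(k, l). \<Sum>i<s. real_of_int (V i k) * real_of_int (V i l))"
    unfolding gram_mat_def r_def[symmetric]
  proof (rule eq_matI)
    fix k l assume "k < dim_row (mat r r (\<lambda>(k, l). \<Sum>i<s. real_of_int (V i k) * real_of_int (V i l)))"
      "l < dim_col (mat r r (\<lambda>(k, l). \<Sum>i<s. real_of_int (V i k) * real_of_int (V i l)))"
    then have kl: "k < r" "l < r" by auto
    have "scalar_prod (vs ! k) (vs ! l) = (\<Sum>i<s. real_of_int (V i k) * real_of_int (V i l))"
      unfolding scalar_prod_def using carr[OF kl(2)] V kl by (auto simp: atLeast0LessThan intro!: sum.cong)
    then show "mat r r (\<lambda>(k, l). scalar_prod (vs ! k) (vs ! l)) $$ (k, l)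
        = mat r r (\<lambda>(k, l). \<Sum>i<s. real_of_int (V i k) * real_of_int (V i l)) $$ (k, l)"
      using kl by simp
  qed auto
  then have det: "lattice_det s (col_lattice n xs) = sqrt D"
    unfolding lattice_det_def vs_def[symmetric] D_def by simp
  have indV: "\<forall>k<r. y k = 0" if y: "\<And>i. i < s \<Longrightarrow> (\<Sum>k<r. of_int (V i k) * y k) = 0" for y :: "nat \<Rightarrow> real"
  proof -
    have "(\<Sum>k<length vs. y k * (vs ! k $ i)) = 0" if i: "i < s" for i
    proof -
      have "(\<Sum>k<length vs. y k * (vs ! k $ i)) = (\<Sum>k<r. of_int (V i k) * y k)"
        using V[OF i] by (intro sum.cong) (auto simp: r_def mult.commute)
      then show ?thesis using y[OF i] by simp
    qed
    then show ?thesis using ind unfolding real_independent_def r_def by blast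
  qed
  have norelV: "\<exists>k<r. (\<Sum>i\<in>I. e i * V i k) \<noteq> 0" if e: "e \<in> PiE I (\<lambda>_. {-1, 0, 1})" "\<exists>i\<in>I. e i \<noteq> 0" for e
  proof (rule ccontr)
    assume "\<not> (\<exists>k<r. (\<Sum>i\<in>I. e i * V i k) \<noteq> 0)"
    then have zero: "\<And>k. k < r \<Longrightarrow> (\<Sum>i\<in>I. e i * V i k) = 0" by blast
    obtain j where j: "j < n" "(\<Sum>i\<in>I. e i * (xs ! i $ j)) \<noteq> 0" using norel[OF e] by blast
    \<comment> \<open>The columns of the row matrix are themselves lattice vectors, hence integer
      combinations of the basis; a relation between the rows of \<open>V\<close> therefore passes to
      \<open>xs\<close>.\<close>
    have "col (row_matrix n xs) j \<in> col_lattice n xs"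
      unfolding mem_col_lattice
    proof
      show "\<exists>q\<in>carrier_vec n. row_matrix n xs *\<^sub>v q = col (row_matrix n xs) j"
      proof (rule bexI[of _ "unit_vec n j"])
        have "dim_row (row_matrix n xs) = length xs" "dim_col (row_matrix n xs) = n"
          by (rule carrier_matD[OF row_matrix_carrier])+
        then show "row_matrix n xs *\<^sub>v unit_vec n j = col (row_matrix n xs) j"
          using j(1) by (intro eq_vecI) auto
      qed simp
      show "\<exists>u\<in>carrier_vec (length xs). col (row_matrix n xs) j = map_vec real_of_int u"
        using j(1) by (intro bexI[of _ "vec (length xs) (\<lambda>i. xs ! i $ j)"] eq_vecI)
          (auto simp: row_matrix_def mat_of_rows_index)
    qed
    then obtain z where z: "z \<in> carrier_vec r" "col (row_matrix n xs) j = mat_of_cols s vs *\<^sub>v map_vec real_of_int z"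
      using basis unfolding lattice_basis_def r_def by blast
    have x: "xs ! i $ j = (\<Sum>k<r. z $ k * V i k)" if i: "i < s" for i
    proof -
      have "real_of_int (xs ! i $ j) = col (row_matrix n xs) j $ i"
        using i j(1) by (simp add: s_def row_matrix_def mat_of_rows_index)
      also have "\<dots> = (\<Sum>k<length vs. map_vec real_of_int z $ k * (vs ! k $ i))"
        unfolding z(2) using z(1) by (intro mat_of_cols_mult_vec_index[OF i]) (simp add: r_def)
      also have "\<dots> = (\<Sum>k<r. of_int (z $ k * V i k))"
        using z(1) V[OF i] by (intro sum.cong) (auto simp: r_def)
      finally have "real_of_int (xs ! i $ j) = real_of_int (\<Sum>k<r. z $ k * V i k)" by simp
      then show ?thesis by (simp only: of_int_eq_iff)
    qed
    have "(\<Sum>i\<in>I. e i * (xs ! i $ j)) = (\<Sum>i\<in>I. \<Sum>k<r. z $ k * (e i * V i k))"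
    proof (intro sum.cong refl)
      fix i assume "i \<in> I"
      then have "i < s" using I by (auto simp: s_def)
      then show "e i * (xs ! i $ j) = (\<Sum>k<r. z $ k * (e i * V i k))"
        by (simp add: x sum_distrib_left mult.left_commute)
    qed
    also have "\<dots> = (\<Sum>k<r. \<Sum>i\<in>I. z $ k * (e i * V i k))" by (rule sum.swap)
    also have "\<dots> = 0" using zero by (simp flip: sum_distrib_left)
    finally show False using j(2) by simp
  qed
  have Is: "I \<subseteq> {..<s}" using I by (simp add: s_def)
  have D: "0 < D" and le: "2 ^ card I \<le> 2 ^ r * sqrt D"
    using two_power_card_le_gram_det[where V = V and s = s and r = r and I = I, OF indV Is norelV]
    unfolding D_def by blast+
  have "real (card I) = log 2 (2 ^ card I)" by (simp add: log_nat_power)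
  also have "\<dots> \<le> log 2 (2 ^ r * sqrt D)" using le D by (subst log_le_cancel_iff) auto
  also have "\<dots> = real r + log 2 (sqrt D)" using D by (simp add: log_mult log_nat_power)
  \<comment> \<open>The left-hand side is an integer, so rounding the logarithm down costs
    nothing.\<close>
  finally have "of_int (int (card I) - int r) \<le> log 2 (sqrt D)" by simp
  then have "int (card I) - int r \<le> \<lfloor>log 2 (sqrt D)\<rfloor>" by (simp only: le_floor_iff)
  moreover have "r \<le> n" unfolding r_def by (rule lattice_basis_col_lattice_length[OF basis[unfolded s_def]])
  ultimately show ?thesis unfolding s_def[symmetric] det by simp
qed

text \<open>The previous bound holds for every enumeration of \<open>X\<close>, in particular for
  the one chosen in \<open>H\<close>; a subset \<open>Y\<close> corresponds to the set
  \<open>I\<close> of its positions in the list.\<close>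

lemma card_le_log_H:
  fixes X Y :: "int vec set"
  assumes fin: "finite X" and Y: "Y \<subseteq> X"
    and norel: "\<And>e. e \<in> PiE Y (\<lambda>_. {-1, 0, 1}) \<Longrightarrow> \<exists>y\<in>Y. e y \<noteq> 0
      \<Longrightarrow> \<exists>j<n. (\<Sum>y\<in>Y. e y * (y $ j)) \<noteq> 0"
  shows "int (card Y) \<le> int n + \<lfloor>log 2 (H n X)\<rfloor>"
proof -
  define xs where "xs = (SOME xs. distinct xs \<and> set xs = X)"
  have xs: "distinct xs" "set xs = X"
    using someI_ex[of "\<lambda>xs. distinct xs \<and> set xs = X"] finite_distinct_list[OF fin] unfolding xs_def by blast+
  have len: "length xs = card X" using distinct_card[OF xs(1)] xs(2) by simp
  define I where "I = {i. i < length xs \<and> xs ! i \<in> Y}"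
  have bij: "bij_betw (\<lambda>i. xs ! i) I Y"
    unfolding bij_betw_def inj_on_def I_def
    using xs Y by (auto simp: nth_eq_iff_index_eq in_set_conv_nth image_iff)
      (metis in_set_conv_nth subsetD)
  have "int (card I) \<le> int n + \<lfloor>log 2 (lattice_det (length xs) (col_lattice n xs))\<rfloor>"
  proof (rule card_le_log_lattice_det)
    fix e assume e: "e \<in> PiE I (\<lambda>_. {-1, 0, 1 :: int})" "\<exists>i\<in>I. e i \<noteq> 0"
    define g where "g = the_inv_into I (\<lambda>i. xs ! i)"
    have g: "g (xs ! i) = i" if "i \<in> I" for i
      unfolding g_def using bij that by (intro the_inv_into_f_f) (auto simp: bij_betw_def)
    have YI: "\<exists>i\<in>I. y = xs ! i" if "y \<in> Y" for y using bij that by (auto simp: bij_betw_def)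
    have 1: "(\<lambda>y\<in>Y. e (g y)) \<in> PiE Y (\<lambda>_. {-1, 0, 1})"
      using e(1) YI g by (fastforce simp: PiE_iff)
    have memY: "xs ! i \<in> Y" if "i \<in> I" for i using that by (simp add: I_def)
    have "\<exists>y\<in>Y. (\<lambda>y\<in>Y. e (g y)) y \<noteq> 0" using e(2) g memY by force
    from norel[OF 1 this] obtain j where j: "j < n" "(\<Sum>y\<in>Y. (\<lambda>y\<in>Y. e (g y)) y * (y $ j)) \<noteq> 0" by blast
    have "(\<Sum>y\<in>Y. (\<lambda>y\<in>Y. e (g y)) y * (y $ j)) = (\<Sum>i\<in>I. (\<lambda>y\<in>Y. e (g y)) (xs ! i) * (xs ! i $ j))"
      by (rule sum.reindex_bij_betw[OF bij, symmetric])
    also have "\<dots> = (\<Sum>i\<in>I. e i * (xs ! i $ j))" using g memY by (intro sum.cong) auto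
    finally show "\<exists>j<n. (\<Sum>i\<in>I. e i * (xs ! i $ j)) \<noteq> 0" using j by auto
  qed (auto simp: I_def)
  then show ?thesis using bij_betw_same_card[OF bij] by (simp add: H_def Let_def xs_def[symmetric] len)
qed


subsection \<open>Reduction of the support\<close>

lemma mult_mat_vec_index_sum:
  assumes "A \<in> carrier_mat d t" "x \<in> carrier_vec t" "i < d"
  shows "(A *\<^sub>v x) $ i = (\<Sum>j<t. A $$ (i, j) * x $ j)"
  using assms by (auto simp: scalar_prod_def atLeast0LessThan intro!: sum.cong)

lemma scalar_prod_sum:
  assumes "x \<in> carrier_vec t"
  shows "c \<bullet> x = (\<Sum>j<t. c $ j * x $ j)"
  using assms by (simp add: scalar_prod_def atLeast0LessThan)

lemma zero_le_vec_iff: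
  assumes "x \<in> carrier_vec t"
  shows "0\<^sub>v t \<le> x \<longleftrightarrow> (\<forall>j<t. 0 \<le> x $ j)"
  using assms by (auto simp: less_eq_vec_def)

text \<open>The coefficients of the relation that says that the columns \<open>j\<close> and
  \<open>k\<close> are equal.\<close>

lemma sum_mult_swap_coeff:
  fixes g :: "nat \<Rightarrow> 'a :: comm_ring_1"
  assumes "j < t" "k < t" "j \<noteq> k"
  shows "(\<Sum>l<t. g l * (if l = j then 1 else if l = k then - 1 else 0)) = g j - g k"
proof -
  have "(\<Sum>l<t. g l * (if l = j then 1 else if l = k then - 1 else 0))
      = (\<Sum>l\<in>{j, k}. g l * (if l = j then 1 else if l = k then - 1 else 0))"
    using assms by (intro sum.mono_neutral_right) auto
  then show ?thesis using assms by simp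
qed

text \<open>The last entries of the enlarged columns form \<open>c\<close>, so relations between
  them preserve the objective value exactly, in both directions. The same reduction thus serves the
  pure and the mixed program.\<close>

lemma int_support_reduction:
  fixes A :: "int mat" and c x :: "int vec"
  assumes A: "A \<in> carrier_mat d t" and c: "c \<in> carrier_vec t"
    and x: "x \<in> carrier_vec t" "0\<^sub>v t \<le> x"
  obtains x' where "x' \<in> carrier_vec t" "0\<^sub>v t \<le> x'" "A *\<^sub>v x' = A *\<^sub>v x" "c \<bullet> x' = c \<bullet> x"
    "int (num_nonzero x') \<le> (int d + 1) + \<lfloor>log 2 (H (d + 1) (enlarged_cols A c))\<rfloor>"
proof -
  define S where "S y \<longleftrightarrow> y \<in> carrier_vec t \<and> 0\<^sub>v t \<le> y \<and> A *\<^sub>v y = A *\<^sub>v x \<and> c \<bullet> y = c \<bullet> x" for y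
  have "S x" using x by (simp add: S_def)
  then obtain x' where x': "S x'" and least: "\<And>y. S y \<Longrightarrow> num_nonzero x' \<le> num_nonzero y"
    using ex_has_least_nat[of S x num_nonzero] by blast
  have x'c: "x' \<in> carrier_vec t" and x'0: "\<And>j. j < t \<Longrightarrow> 0 \<le> x' $ j"
    using x' by (auto simp: S_def zero_le_vec_iff)
  define J where "J = {j. j < t \<and> x' $ j \<noteq> 0}"
  have finJ: "finite J" by (simp add: J_def)
  have Jpos: "0 < x' $ j" if "j \<in> J" for j
    using that x'0[of j] by (simp add: J_def)
  have nnz: "num_nonzero x' = card J"
    using x'c by (simp add: num_nonzero_def J_def)
  have main: False
    if e: "\<And>j. e j \<in> {-1, 0, 1}" "\<And>j. j \<notin> J \<Longrightarrow> e j = 0" "e j0 = 1"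
      and Ae: "\<And>i. i < d \<Longrightarrow> (\<Sum>j<t. A $$ (i, j) * e j) = 0" and ce: "(\<Sum>j<t. c $ j * e j) = 0"
    for e :: "nat \<Rightarrow> int" and j0
  proof -
    define K where "K = {j \<in> J. e j = 1}"
    have "j0 \<in> K" using e(2)[of j0] e(3) by (auto simp: K_def)
    then have K: "finite K" "K \<noteq> {}" using finJ by (auto simp: K_def)
    \<comment> \<open>A step of length \<open>x' $ m\<close> along \<open>- e\<close> is integral.
      Where \<open>e\<close> is 1, minimality of \<open>x' $ m\<close> keeps the entries
      nonnegative; where it is -1, they grow; entry \<open>m\<close> itself becomes 0.\<close>
    obtain m where m: "m \<in> K" "\<And>j. j \<in> K \<Longrightarrow> x' $ m \<le> x' $ j"
      using ex_min_if_finite[of "(\<lambda>j. x' $ j) ` K"] K by (auto simp: not_less)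
    define y where "y = vec t (\<lambda>j. x' $ j - x' $ m * e j)"
    have yc: "y \<in> carrier_vec t" and yj: "\<And>j. j < t \<Longrightarrow> y $ j = x' $ j - x' $ m * e j"
      by (simp_all add: y_def)
    have mJ: "m \<in> J" "e m = 1" using m(1) by (auto simp: K_def)
    have split: "(\<Sum>j<t. g j * y $ j) = (\<Sum>j<t. g j * x' $ j) - x' $ m * (\<Sum>j<t. g j * e j)" for g :: "nat \<Rightarrow> int"
      by (simp add: yj sum_distrib_left sum_subtractf[symmetric] algebra_simps)
    have "0 \<le> y $ j" if "j < t" for j
    proof -
      consider "e j = -1" | "e j = 0" | "e j = 1" using e(1)[of j] by auto
      then show ?thesis
      proof cases
        case 3
        then have "j \<in> K" using e(2)[of j] by (auto simp: K_def)
        then show ?thesis using m(2)[of j] 3 yj[OF that] by simp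
      qed (use yj[OF that] x'0[OF that] Jpos[OF mJ(1)] in auto)
    qed
    moreover have "A *\<^sub>v y = A *\<^sub>v x'"
    proof (rule eq_vecI)
      fix i assume "i < dim_vec (A *\<^sub>v x')"
      then have i: "i < d" using A by simp
      show "(A *\<^sub>v y) $ i = (A *\<^sub>v x') $ i"
        unfolding mult_mat_vec_index_sum[OF A yc i] mult_mat_vec_index_sum[OF A x'c i] split Ae[OF i] by simp
    qed simp
    moreover have "c \<bullet> y = c \<bullet> x'"
      unfolding scalar_prod_sum[OF yc] scalar_prod_sum[OF x'c] split ce by simp
    ultimately have "S y" using x' yc by (simp add: S_def zero_le_vec_iff)
    then have "card J \<le> num_nonzero y" using least nnz by simp
    moreover have "{i. i < dim_vec y \<and> y $ i \<noteq> 0} \<subseteq> J - {m}"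
      using yc yj e(2) mJ by (auto simp: J_def)
    then have "num_nonzero y \<le> card (J - {m})"
      unfolding num_nonzero_def using finJ by (intro card_mono) auto
    ultimately show False using mJ(1) finJ card_Diff1_less[of J m] by simp
  qed
  have norel: "e j0 = 0"
    if e: "\<And>j. e j \<in> {-1, 0, 1}" "\<And>j. j \<notin> J \<Longrightarrow> e j = 0"
      and Ae: "\<And>i. i < d \<Longrightarrow> (\<Sum>j<t. A $$ (i, j) * e j) = 0" and ce: "(\<Sum>j<t. c $ j * e j) = 0"
    for e :: "nat \<Rightarrow> int" and j0
  proof -
    have "e j0 \<noteq> 1" using main[of e j0, OF e _ Ae ce] by blast
    moreover have "e j0 \<noteq> -1"
    proof
      assume "e j0 = -1"
      show False
      proof (rule main[of "\<lambda>j. - e j" j0])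
        show "- e j \<in> {-1, 0, 1}" for j using e(1)[of j] by auto
      qed (use e Ae ce \<open>e j0 = -1\<close> in \<open>simp_all add: sum_negf\<close>)
    qed
    ultimately show ?thesis using e(1)[of j0] by blast
  qed
  define f where "f j = col A j @\<^sub>v vec_of_list [c $ j]" for j
  have f: "f j $ i = (if i < d then A $$ (i, j) else c $ j)" if jt: "j < t" and id: "i < d + 1" for i j
  proof -
    consider "i < d" | "i = d" using id by linarith
    then show ?thesis using jt A by cases (simp_all add: f_def vec_of_list_index)
  qed
  have norel_f: "e j0 = 0"
    if e: "\<And>j. e j \<in> {-1, 0, 1}" "\<And>j. j \<notin> J \<Longrightarrow> e j = 0"
      and fe: "\<And>i. i < d + 1 \<Longrightarrow> (\<Sum>j<t. f j $ i * e j) = 0" for e :: "nat \<Rightarrow> int" and j0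
  proof (rule norel[OF e])
    show "(\<Sum>j<t. A $$ (i, j) * e j) = 0" if "i < d" for i
      using fe[of i] f[of _ i] that by simp
    show "(\<Sum>j<t. c $ j * e j) = 0"
      using fe[of d] f[of _ d] by simp
  qed
  \<comment> \<open>The bound counts vectors in a set, so equal enlarged columns in the support have
    to be excluded; two of them would already form a relation.\<close>
  have inj: "inj_on f J"
  proof (rule inj_onI, rule ccontr)
    fix j k assume jk: "j \<in> J" "k \<in> J" "f j = f k" "j \<noteq> k"
    have "(if j = j then 1 else if j = k then - 1 else 0 :: int) = 0"
    proof (rule norel_f[where e = "\<lambda>l. if l = j then 1 else if l = k then - 1 else 0"])
      show "(\<Sum>l<t. f l $ i * (if l = j then 1 else if l = k then - 1 else 0)) = 0" for i
        using jk sum_mult_swap_coeff[of j t k "\<lambda>l. f l $ i"] by (simp add: J_def)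
    qed (use jk in auto)
    then show False by simp
  qed
  have "enlarged_cols A c = f ` {..<t}"
    using A by (auto simp: enlarged_cols_def f_def)
  then have X: "finite (enlarged_cols A c)" "f ` J \<subseteq> enlarged_cols A c"
    by (auto simp: J_def)
  have "int (card (f ` J)) \<le> int (d + 1) + \<lfloor>log 2 (H (d + 1) (enlarged_cols A c))\<rfloor>"
  proof (rule card_le_log_H[OF X], rule ccontr)
    fix e :: "int vec \<Rightarrow> int"
    assume e: "e \<in> PiE (f ` J) (\<lambda>_. {-1, 0, 1})" "\<exists>y\<in>f ` J. e y \<noteq> 0"
      and "\<not> (\<exists>i<d + 1. (\<Sum>y\<in>f ` J. e y * y $ i) \<noteq> 0)"
    then have zero: "\<And>i. i < d + 1 \<Longrightarrow> (\<Sum>y\<in>f ` J. e y * y $ i) = 0" by blast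
    define e' where "e' j = (if j \<in> J then e (f j) else 0)" for j
    have "e' j = 0" for j
    proof (rule norel_f)
      show "e' j \<in> {-1, 0, 1}" for j using e(1) by (auto simp: e'_def PiE_iff)
      fix i assume i: "i < d + 1"
      have "(\<Sum>j<t. f j $ i * e' j) = (\<Sum>j\<in>J. e (f j) * f j $ i)"
        by (intro sum.mono_neutral_cong_right) (auto simp: J_def e'_def)
      also have "\<dots> = (\<Sum>y\<in>f ` J. e y * y $ i)" by (simp add: sum.reindex[OF inj])
      finally show "(\<Sum>j<t. f j $ i * e' j) = 0" using zero[OF i] by simp
    qed (simp add: e'_def)
    moreover obtain j where "j \<in> J" "e (f j) \<noteq> 0" using e(2) by blast
    ultimately show False unfolding e'_def by metis
  qed
  then have "int (num_nonzero x') \<le> (int d + 1) + \<lfloor>log 2 (H (d + 1) (enlarged_cols A c))\<rfloor>"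
    using card_image[OF inj] nnz by simp
  then show thesis using x' that unfolding S_def by blast
qed

text \<open>More columns than the rank are dependent. They are treated as a list, so that equal
  columns count as a dependence too.\<close>

lemma exists_kernel_vector:
  fixes B :: "real mat"
  assumes B: "B \<in> carrier_mat d t" and J: "J \<subseteq> {..<t}" "vec_space.rank d B < card J"
  obtains z :: "nat \<Rightarrow> real" and j where "\<And>j. j \<notin> J \<Longrightarrow> z j = 0" "j \<in> J" "z j \<noteq> 0"
    "\<And>i. i < d \<Longrightarrow> (\<Sum>j<t. B $$ (i, j) * z j) = 0"
proof -
  interpret vec_space "TYPE(real)" d .
  have finJ: "finite J" using J(1) finite_subset by blast
  define js where "js = sorted_list_of_set J"
  have js: "set js = J" "distinct js" "length js = card J" using finJ by (auto simp: js_def)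
  define bs where "bs = map (col B) js"
  have bs: "set bs \<subseteq> set (cols B)"
    using js J(1) B by (auto simp: bs_def cols_def)
  then have carr: "set bs \<subseteq> carrier_vec d" using B cols_dim[of B] by auto
  have "\<not> real_independent d bs"
  proof
    assume ri: "real_independent d bs"
    note li = real_independent_imp[OF carr ri]
    have "card (set bs) \<le> rank B" by (rule rank_ge_card_indpt[OF B bs li(2)])
    then show False using distinct_card[OF li(1)] J(2) js by (simp add: bs_def)
  qed
  then obtain y k where y: "\<And>i. i < d \<Longrightarrow> (\<Sum>k<length bs. y k * (bs ! k $ i)) = 0"
      and k: "k < length bs" "y k \<noteq> 0"
    unfolding real_independent_def by blast
  have bij: "bij_betw (\<lambda>k. js ! k) {..<length js} J"
    using bij_betw_nth[OF js(2) refl js(1)[symmetric]] by simp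
  define g where "g = the_inv_into {..<length js} (\<lambda>k. js ! k)"
  have g: "g (js ! k) = k" if "k < length js" for k
    unfolding g_def using bij that by (intro the_inv_into_f_f) (auto simp: bij_betw_def)
  define z where "z j = (if j \<in> J then y (g j) else 0)" for j
  show thesis
  proof (rule that[of z "js ! k"])
    show "js ! k \<in> J" using k js(1) by (auto simp: bs_def)
    then show "z (js ! k) \<noteq> 0" using k g[of k] by (simp add: z_def bs_def)
    fix i assume i: "i < d"
    have "(\<Sum>j<t. B $$ (i, j) * z j) = (\<Sum>j\<in>J. B $$ (i, j) * y (g j))"
      using J(1) by (intro sum.mono_neutral_cong_right) (auto simp: z_def)
    also have "\<dots> = (\<Sum>k<length js. B $$ (i, js ! k) * y (g (js ! k)))"
      by (rule sum.reindex_bij_betw[OF bij, symmetric])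
    also have "\<dots> = (\<Sum>k<length bs. y k * (bs ! k $ i))"
    proof (intro sum.cong)
      fix k assume "k \<in> {..<length bs}"
      then have k: "k < length js" by (simp add: bs_def)
      then have "js ! k < t" using js(1) J(1) by auto
      then show "B $$ (i, js ! k) * y (g (js ! k)) = y k * (bs ! k $ i)"
        using k g[OF k] B i by (simp add: bs_def)
    qed (simp add: bs_def)
    finally show "(\<Sum>j<t. B $$ (i, j) * z j) = 0" using y[OF i] by simp
  qed (simp add: z_def)
qed

text \<open>The passage to a basic solution of a linear program. From a positive point one can move
  along a kernel vector of \<open>B\<close> in both directions, so optimality forces
  \<open>v\<close> to vanish on it; hence \<open>v\<close> need not be adjoined to \<open>B\<close>
  as a further row.\<close>

lemma real_support_reduction:
  fixes B :: "real mat" and v y :: "real vec"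
  assumes B: "B \<in> carrier_mat d t" and v: "v \<in> carrier_vec t"
    and y: "y \<in> carrier_vec t" "0\<^sub>v t \<le> y"
    and opt: "\<And>w. w \<in> carrier_vec t \<Longrightarrow> 0\<^sub>v t \<le> w \<Longrightarrow> B *\<^sub>v w = B *\<^sub>v y \<Longrightarrow> v \<bullet> y \<le> v \<bullet> w"
  obtains y' where "y' \<in> carrier_vec t" "0\<^sub>v t \<le> y'" "B *\<^sub>v y' = B *\<^sub>v y" "v \<bullet> y' = v \<bullet> y"
    "num_nonzero y' \<le> vec_space.rank d B"
proof -
  define S where "S w \<longleftrightarrow> w \<in> carrier_vec t \<and> 0\<^sub>v t \<le> w \<and> B *\<^sub>v w = B *\<^sub>v y \<and> v \<bullet> w = v \<bullet> y" for w
  have "S y" using y by (simp add: S_def)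
  then obtain y' where y': "S y'" and least: "\<And>w. S w \<Longrightarrow> num_nonzero y' \<le> num_nonzero w"
    using ex_has_least_nat[of S y num_nonzero] by blast
  have y'c: "y' \<in> carrier_vec t" and y'0: "\<And>j. j < t \<Longrightarrow> 0 \<le> y' $ j"
    using y' by (auto simp: S_def zero_le_vec_iff)
  define J where "J = {j. j < t \<and> y' $ j \<noteq> 0}"
  have finJ: "finite J" by (simp add: J_def)
  have Jpos: "0 < y' $ j" if "j \<in> J" for j
    using that y'0[of j] by (simp add: J_def)
  have nnz: "num_nonzero y' = card J"
    using y'c by (simp add: num_nonzero_def J_def)
  define step where "step z a = vec t (\<lambda>j. y' $ j - a * z j)" for z :: "nat \<Rightarrow> real" and a
  have step: "step z a \<in> carrier_vec t" "\<And>j. j < t \<Longrightarrow> step z a $ j = y' $ j - a * z j" for z a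
    by (simp_all add: step_def)
  have split: "(\<Sum>j<t. g j * step z a $ j) = (\<Sum>j<t. g j * y' $ j) - a * (\<Sum>j<t. g j * z j)"
    for g z :: "nat \<Rightarrow> real" and a
    by (simp add: step sum_distrib_left sum_subtractf[symmetric] algebra_simps)
  have Bstep: "B *\<^sub>v step z a = B *\<^sub>v y" if "\<And>i. i < d \<Longrightarrow> (\<Sum>j<t. B $$ (i, j) * z j) = 0" for z a
  proof -
    have "B *\<^sub>v step z a = B *\<^sub>v y'"
    proof (rule eq_vecI)
      fix i assume "i < dim_vec (B *\<^sub>v y')"
      then have i: "i < d" using B by simp
      show "(B *\<^sub>v step z a) $ i = (B *\<^sub>v y') $ i"
        unfolding mult_mat_vec_index_sum[OF B step(1) i] mult_mat_vec_index_sum[OF B y'c i] split that[OF i] by simp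
    qed simp
    then show ?thesis using y' by (simp add: S_def)
  qed
  have vstep: "v \<bullet> step z a = v \<bullet> y - a * (\<Sum>j<t. v $ j * z j)" for z a
    using y' unfolding S_def by (simp add: scalar_prod_sum[OF step(1)] scalar_prod_sum[OF y'c, symmetric] split)
  \<comment> \<open>The ratio test: the longest step that keeps all entries nonnegative makes one of
    them zero. If \<open>z\<close> has no positive entry, any length works, and 1 is taken.\<close>
  have bound: "\<exists>a>0. (\<forall>j<t. 0 \<le> step z a $ j) \<and> ((\<exists>j. 0 < z j) \<longrightarrow> (\<exists>m\<in>J. step z a $ m = 0))"
    if z: "\<And>j. j \<notin> J \<Longrightarrow> z j = 0" for z
  proof (cases "\<exists>j. 0 < z j")
    case False
    then have "\<forall>j<t. 0 \<le> step z 1 $ j"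
      using y'0 by (simp add: step not_less) (meson order_trans)
    then show ?thesis using False by (intro exI[of _ 1]) auto
  next
    case True
    define K where "K = {j \<in> J. 0 < z j}"
    have K: "finite K" "K \<noteq> {}" using finJ True z by (auto simp: K_def) (metis less_irrefl)
    obtain m where m: "m \<in> K" "\<And>j. j \<in> K \<Longrightarrow> y' $ m / z m \<le> y' $ j / z j"
      using ex_min_if_finite[of "(\<lambda>j. y' $ j / z j) ` K"] K by (auto simp: not_less)
    have mJ: "m \<in> J" "0 < z m" "m < t" using m(1) by (auto simp: K_def J_def)
    let ?a = "y' $ m / z m"
    have a: "0 < ?a" using mJ Jpos by simp
    have "0 \<le> step z ?a $ j" if j: "j < t" for j
    proof (cases "0 < z j")
      case True
      then have "j \<in> K" using z[of j] by (auto simp: K_def)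
      then have "?a * z j \<le> y' $ j" using m(2)[of j] True by (simp add: pos_le_divide_eq)
      then show ?thesis by (simp add: step(2)[OF j])
    next
      case False
      then have "?a * z j \<le> 0" using a by (intro mult_nonneg_nonpos) auto
      then show ?thesis using y'0[OF j] unfolding step(2)[OF j] by linarith
    qed
    moreover have "step z ?a $ m = 0" using mJ by (simp add: step)
    ultimately show ?thesis using a mJ by (intro exI[of _ ?a]) blast
  qed
  \<comment> \<open>The step along \<open>- z\<close> stays feasible and cannot improve an optimum.
    Applied to \<open>- z\<close> as well, this yields equality.\<close>
  have vz: "(\<Sum>j<t. v $ j * z j) \<le> 0"
    if z: "\<And>j. j \<notin> J \<Longrightarrow> z j = 0" "\<And>i. i < d \<Longrightarrow> (\<Sum>j<t. B $$ (i, j) * z j) = 0" for z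
  proof -
    obtain a where a: "0 < a" "\<forall>j<t. 0 \<le> step z a $ j" using bound[of z, OF z(1)] by blast
    have "v \<bullet> y \<le> v \<bullet> step z a"
      using a Bstep[OF z(2)] by (intro opt step(1)) (auto simp: zero_le_vec_iff[OF step(1)])
    then have "a * (\<Sum>j<t. v $ j * z j) \<le> 0" unfolding vstep by simp
    then show ?thesis using a(1) by (simp add: mult_le_0_iff)
  qed
  have no_pos: False
    if z: "\<And>j. j \<notin> J \<Longrightarrow> z j = 0" "\<And>i. i < d \<Longrightarrow> (\<Sum>j<t. B $$ (i, j) * z j) = 0" "0 < z j0" for z j0
  proof -
    have "(\<Sum>j<t. v $ j * - z j) \<le> 0" using z by (intro vz) (simp_all add: sum_negf)
    then have v0: "(\<Sum>j<t. v $ j * z j) = 0" using vz[of z, OF z(1,2)] by (simp add: sum_negf)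
    obtain a m where a: "0 < a" "\<forall>j<t. 0 \<le> step z a $ j" "m \<in> J" "step z a $ m = 0"
      using bound[of z, OF z(1)] z(3) by blast
    have "S (step z a)"
      unfolding S_def using a(2) Bstep[OF z(2)] step(1) by (simp add: zero_le_vec_iff[OF step(1)] vstep v0)
    then have "card J \<le> num_nonzero (step z a)" using least nnz by simp
    moreover have "{i. i < dim_vec (step z a) \<and> step z a $ i \<noteq> 0} \<subseteq> J - {m}"
    proof
      fix i assume i: "i \<in> {i. i < dim_vec (step z a) \<and> step z a $ i \<noteq> 0}"
      then have "i < t" using step(1)[of z a] by simp
      then show "i \<in> J - {m}" using i step(2)[of i z a] z(1)[of i] a(4) by (auto simp: J_def)
    qed
    then have "num_nonzero (step z a) \<le> card (J - {m})"
      unfolding num_nonzero_def using finJ by (intro card_mono) auto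
    ultimately show False using a(3) finJ card_Diff1_less[of J m] by simp
  qed
  have "card J \<le> vec_space.rank d B"
  proof (rule ccontr)
    assume "\<not> card J \<le> vec_space.rank d B"
    then have "vec_space.rank d B < card J" by simp
    moreover have "J \<subseteq> {..<t}" by (auto simp: J_def)
    ultimately obtain z j where z: "\<And>j. j \<notin> J \<Longrightarrow> z j = 0" "z j \<noteq> 0"
        "\<And>i. i < d \<Longrightarrow> (\<Sum>j<t. B $$ (i, j) * z j) = 0"
      using exists_kernel_vector[OF B] by metis
    show False
    proof (cases "0 < z j")
      case True
      then show False using no_pos[of z j] z by blast
    next
      case False
      show False
        by (rule no_pos[of "\<lambda>j. - z j" j]) (use z False in \<open>simp_all add: sum_negf\<close>)
    qed
  qed
  then show thesis using y' that[of y'] nnz unfolding S_def by simp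
qed

theorem corollary3:
  fixes d t :: nat and A :: "int mat" and b c :: "int vec"
  assumes "A \<in> carrier_mat d t" and "c \<in> carrier_vec t" and "b \<in> carrier_vec d"
  shows
    "((\<exists>x. ip_optimal A b c x) \<longrightarrow>
        (\<exists>x. ip_optimal A b c x \<and>
           int (num_nonzero x) \<le> (int d + 1) + \<lfloor>log 2 (H (d + 1) (enlarged_cols A c))\<rfloor>)) \<and>
     (\<forall>t2. \<forall>B \<in> carrier_mat d t2. \<forall>v \<in> carrier_vec t2.
        (\<exists>x y. mip_optimal A B b c v (x, y)) \<longrightarrow>
        (\<exists>x y. mip_optimal A B b c v (x, y) \<and>
           int (num_nonzero x + num_nonzero y)
             \<le> (int d + 1) + \<lfloor>log 2 (H (d + 1) (enlarged_cols A c))\<rfloor> + int (vec_space.rank d B)))"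
proof (intro conjI impI allI ballI)
  note A = assms(1) and c = assms(2)
  have dimA: "dim_col A = t" using A by simp
  {
    assume "\<exists>x. ip_optimal A b c x"
    then obtain x where x: "ip_optimal A b c x" ..
    then have xf: "x \<in> carrier_vec t" "0\<^sub>v t \<le> x" "A *\<^sub>v x = b"
      by (simp_all add: ip_optimal_def is_arg_min_def ip_feasible_def dimA)
    obtain x' where x': "x' \<in> carrier_vec t" "0\<^sub>v t \<le> x'" "A *\<^sub>v x' = A *\<^sub>v x" "c \<bullet> x' = c \<bullet> x"
      "int (num_nonzero x') \<le> (int d + 1) + \<lfloor>log 2 (H (d + 1) (enlarged_cols A c))\<rfloor>"
      using int_support_reduction[OF A c xf(1,2)] by blast
    have "ip_optimal A b c x'"
      using x x' xf(3) by (simp add: ip_optimal_def is_arg_min_def ip_feasible_def dimA)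
    then show "\<exists>x. ip_optimal A b c x \<and>
        int (num_nonzero x) \<le> (int d + 1) + \<lfloor>log 2 (H (d + 1) (enlarged_cols A c))\<rfloor>"
      using x'(5) by blast
  }
  fix t2 and B :: "real mat" and v :: "real vec"
  assume B: "B \<in> carrier_mat d t2" and v: "v \<in> carrier_vec t2" and "\<exists>x y. mip_optimal A B b c v (x, y)"
  then obtain x y where xy: "mip_optimal A B b c v (x, y)" by blast
  have dimB: "dim_col B = t2" using B by simp
  have xyf: "x \<in> carrier_vec t" "0\<^sub>v t \<le> x" "y \<in> carrier_vec t2" "0\<^sub>v t2 \<le> y"
      "map_vec real_of_int (A *\<^sub>v x) + B *\<^sub>v y = map_vec real_of_int b"
    and opt: "\<And>x' y'. mip_feasible A B b (x', y') \<Longrightarrow>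
      real_of_int (c \<bullet> x) + v \<bullet> y \<le> real_of_int (c \<bullet> x') + v \<bullet> y'"
    using xy by (auto simp: mip_optimal_def is_arg_min_def mip_feasible_def dimA dimB not_less)
  \<comment> \<open>Both parts are reduced independently: \<open>x'\<close> keeps \<open>A x\<close>
    and \<open>c x\<close>, \<open>y'\<close> keeps \<open>B y\<close> and \<open>v y\<close>, so
    the pair is feasible with the same value.\<close>
  obtain x' where x': "x' \<in> carrier_vec t" "0\<^sub>v t \<le> x'" "A *\<^sub>v x' = A *\<^sub>v x" "c \<bullet> x' = c \<bullet> x"
    "int (num_nonzero x') \<le> (int d + 1) + \<lfloor>log 2 (H (d + 1) (enlarged_cols A c))\<rfloor>"
    using int_support_reduction[OF A c xyf(1,2)] by blast
  \<comment> \<open>With \<open>x\<close> held fixed, \<open>y\<close> is optimal among the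
    nonnegative vectors with the same image under \<open>B\<close>.\<close>
  have opty: "v \<bullet> y \<le> v \<bullet> w" if "w \<in> carrier_vec t2" "0\<^sub>v t2 \<le> w" "B *\<^sub>v w = B *\<^sub>v y" for w
    using opt[of x w] xyf that by (simp add: mip_feasible_def dimA dimB)
  obtain y' where y': "y' \<in> carrier_vec t2" "0\<^sub>v t2 \<le> y'" "B *\<^sub>v y' = B *\<^sub>v y" "v \<bullet> y' = v \<bullet> y"
    "num_nonzero y' \<le> vec_space.rank d B"
    using real_support_reduction[OF B v xyf(3,4) opty] by blast
  have "mip_feasible A B b (x', y')"
    using x' y' xyf by (simp add: mip_feasible_def dimA dimB)
  then have "mip_optimal A B b c v (x', y')"
    using opt x'(4) y'(4) by (auto simp: mip_optimal_def is_arg_min_def not_less)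
  moreover have "int (num_nonzero x' + num_nonzero y')
      \<le> (int d + 1) + \<lfloor>log 2 (H (d + 1) (enlarged_cols A c))\<rfloor> + int (vec_space.rank d B)"
    using x'(5) y'(5) by simp
  ultimately show "\<exists>x y. mip_optimal A B b c v (x, y) \<and>
      int (num_nonzero x + num_nonzero y)
        \<le> (int d + 1) + \<lfloor>log 2 (H (d + 1) (enlarged_cols A c))\<rfloor> + int (vec_space.rank d B)"
    by blast
qed

end
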